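(* Let $0<\beta\leq1$ and let $\phi:\mathbb{C}\to(-\infty,\infty]$ be a lower semi-continuous function of strictly super logarithmic growth, with $\{\phi<\infty\}$ not polar, satisfying the regularity assumption: there is a neighborhood $U$ of the support $S_\phi$ of the equilibrium measure $\mu_\phi$ such that $\phi\in C^5(U)$, $S_\phi$ is a domain with $C^1$-boundary, and $\Delta\phi>0$ on $S_\phi$. Consider the $N$-particle Coulomb gas in $\mathbb{C}$ at inverse temperature $\beta$ with exterior potential $V=N\phi$. For each $N$ let $g_N$ be a functional, defined for all $u\in C(\mathbb{C})$ such that $\phi+u$ has strictly super logarithmic growth, and suppose that for all $N$ and all such $u$, with $U_N:=\frac1N\sum_{i=1}^N u(z_i)$, $$\frac{1}{\beta N^{2}}\log\mathbb{E}\left(e^{-\beta N^{2}U_N}\right)\leq-\mathcal{F}(\phi+u)+\mathcal{F}(\phi)+g_{N}(u).$$ Then there exists such a $u$ for which $\limsup_{N\rightarrow\infty}N\,g_{N}(u)>0$ (that is, the order $O(N^{-1})$ of the error cannot be improved in general).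
   Context: $d\lambda$ is Lebesgue measure on $\mathbb{C}=\mathbb{R}^2$. A function $\phi$ has strictly super logarithmic growth if $\phi(z)\ge(1+\epsilon)\log(1+|z|^2)-C$ for some constants $\epsilon>0$ and $C$. The $N$-particle Coulomb gas at inverse temperature $\beta$ with exterior potential $V$ is $\mathbb{C}^N$ with the probability measure proportional to $\prod_{i<j}|z_i-z_j|^{2\beta}\prod_ie^{-\beta V(z_i)}d\lambda^{\otimes N}$; $\mathbb{E}$ is its expectation. For a lower semi-continuous $\Phi$ of strictly super logarithmic growth with $\{\Phi<\infty\}$ not polar, $\mathcal{F}(\Phi):=\inf_\mu\left(-\frac12\int\log|z-w|^2\mu\otimes\mu+\int\Phi\mu\right)$ over probability measures $\mu$ on $\mathbb{C}$ (it suffices to use compactly supported ones), and $\mu_\Phi$ is the unique minimizer, which has compact support $S_\Phi$. A closed set is here called a domain with $C^1$-boundary if it is the closure of a domain with $C^1$-boundary. *)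

theory Defs
  imports "HOL-Probability.Probability"
begin

definition lower_semicontinuous :: "('a::topological_space \<Rightarrow> ereal) \<Rightarrow> bool" where
  "lower_semicontinuous f \<longleftrightarrow> (\<forall>a. open {x. a < f x})"

definition strictly_super_log_growth :: "(complex \<Rightarrow> ereal) \<Rightarrow> bool" where
  "strictly_super_log_growth f \<longleftrightarrow>
     (\<exists>\<epsilon>>0. \<exists>C::real. \<forall>z. f z \<ge> ereal ((1 + \<epsilon>) * ln (1 + (cmod z)\<^sup>2) - C))"

text \<open>The library function \<^const>\<open>ln\<close> on the reals has \<open>ln 0 = 0\<close>; the extended logarithm below has
  the value \<open>-\<infinity>\<close> there, so that measures with atoms have infinite energy.\<close>

definition elog :: "ennreal \<Rightarrow> ereal" where
  "elog x = (if x = 0 then -\<infinity> else if x = \<infinity> then \<infinity> else ereal (ln (enn2real x)))"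

definition eexp :: "ereal \<Rightarrow> ennreal" where
  "eexp x = (case x of ereal r \<Rightarrow> ennreal (exp r) | PInfty \<Rightarrow> \<infinity> | MInfty \<Rightarrow> 0)"

text \<open>Integral of an extended real function as the integral of the positive part minus that of the
  negative part. If both are infinite, the value is \<open>\<infinity> - \<infinity> = \<infinity>\<close> in \<^typ>\<open>ereal\<close>.\<close>

definition eintegral :: "'a measure \<Rightarrow> ('a \<Rightarrow> ereal) \<Rightarrow> ereal" where
  "eintegral M f = enn2ereal (\<integral>\<^sup>+x. e2ennreal (f x) \<partial>M) - enn2ereal (\<integral>\<^sup>+x. e2ennreal (- f x) \<partial>M)"

definition log_integral :: "complex measure \<Rightarrow> ereal" where
  "log_integral \<mu> = eintegral (\<mu> \<Otimes>\<^sub>M \<mu>) (\<lambda>(z, w). elog (ennreal ((cmod (z - w))\<^sup>2)))"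

definition measure_support :: "'a::topological_space measure \<Rightarrow> 'a set" where
  "measure_support \<mu> = {x. \<forall>W. open W \<and> x \<in> W \<longrightarrow> emeasure \<mu> W > 0}"

text \<open>Polarity in the sense of logarithmic potential theory: every nonzero finite measure with compact
  support in the set has infinite logarithmic energy.\<close>

definition polar :: "complex set \<Rightarrow> bool" where
  "polar E \<longleftrightarrow> (\<forall>\<mu>. finite_measure \<mu> \<and> sets \<mu> = sets borel \<and> emeasure \<mu> UNIV \<noteq> 0
      \<and> compact (measure_support \<mu>) \<and> measure_support \<mu> \<subseteq> E \<longrightarrow> log_integral \<mu> = -\<infinity>)"

definition prob_measures :: "complex measure set" where
  "prob_measures = {\<mu>. prob_space \<mu> \<and> sets \<mu> = sets borel}"

text \<open>When \<open>\<Phi>\<close> has strictly super logarithmic growth, the sum below is of the form \<open>\<infinity> - \<infinity>\<close>, or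
  \<^const>\<open>log_integral\<close> is, only if \<open>\<integral> \<Phi> d\<mu> = \<infinity>\<close>, and then the value in \<^typ>\<open>ereal\<close> is \<open>\<infinity>\<close>.
  Such measures therefore do not affect the infimum.\<close>

definition weighted_energy :: "(complex \<Rightarrow> ereal) \<Rightarrow> complex measure \<Rightarrow> ereal" where
  "weighted_energy \<Phi> \<mu> = - (ereal (1/2) * log_integral \<mu>) + eintegral \<mu> \<Phi>"

definition free_energy :: "(complex \<Rightarrow> ereal) \<Rightarrow> ereal" where
  "free_energy \<Phi> = (INF \<mu>\<in>prob_measures. weighted_energy \<Phi> \<mu>)"

definition is_equilibrium_measure :: "(complex \<Rightarrow> ereal) \<Rightarrow> complex measure \<Rightarrow> bool" where
  "is_equilibrium_measure \<Phi> \<mu> \<longleftrightarrow> \<mu> \<in> prob_measures \<and> weighted_energy \<Phi> \<mu> = free_energy \<Phi>"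

text \<open>\<open>C\<^sup>k\<close> functions; only used on open sets.\<close>

primrec C_k_on :: "nat \<Rightarrow> ('a::euclidean_space \<Rightarrow> real) \<Rightarrow> 'a set \<Rightarrow> bool" where
  "C_k_on 0 f U \<longleftrightarrow> continuous_on U f"
| "C_k_on (Suc k) f U \<longleftrightarrow> (\<forall>x\<in>U. f differentiable (at x)) \<and>
     (\<forall>b\<in>Basis. C_k_on k (\<lambda>x. frechet_derivative f (at x) b) U)"

definition laplacian :: "('a::euclidean_space \<Rightarrow> real) \<Rightarrow> 'a \<Rightarrow> real" where
  "laplacian f x =
     (\<Sum>b\<in>Basis. frechet_derivative (\<lambda>y. frechet_derivative f (at y) b) (at x) b)"

definition C1_domain :: "complex set \<Rightarrow> bool" where
  "C1_domain D \<longleftrightarrow> open D \<and> connected D \<and> D \<noteq> {} \<and>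
     (\<forall>p\<in>frontier D. \<exists>W \<rho>. open W \<and> p \<in> W \<and> C_k_on 1 \<rho> W \<and>
        frechet_derivative \<rho> (at p) \<noteq> (\<lambda>v. 0) \<and> D \<inter> W = {z\<in>W. \<rho> z < 0})"

definition closed_C1_domain :: "complex set \<Rightarrow> bool" where
  "closed_C1_domain S \<longleftrightarrow> (\<exists>D. C1_domain D \<and> S = closure D)"

text \<open>Configurations of \<open>N\<close> particles are the extensional functions on \<open>{..<N}\<close>.\<close>

definition gas_weight :: "nat \<Rightarrow> real \<Rightarrow> (complex \<Rightarrow> ereal) \<Rightarrow> (nat \<Rightarrow> complex) \<Rightarrow> ennreal" where
  "gas_weight N \<beta> V z =
     ennreal (\<Prod>(i, j)\<in>{(i, j). i < j \<and> j < N}. cmod (z i - z j) powr (2 * \<beta>)) *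
     (\<Prod>i<N. eexp (- (ereal \<beta> * V (z i))))"

definition partition_function :: "nat \<Rightarrow> real \<Rightarrow> (complex \<Rightarrow> ereal) \<Rightarrow> ennreal" where
  "partition_function N \<beta> V = (\<integral>\<^sup>+z. gas_weight N \<beta> V z \<partial>(\<Pi>\<^sub>M i\<in>{..<N}. lborel))"

text \<open>For small \<open>N\<close> and \<open>\<beta> < 1\<close> the partition function can be infinite, so that the gas does not exist;
  the measure below is then zero, by \<open>x / \<infinity> = 0\<close> in \<^typ>\<open>ennreal\<close>.\<close>

definition coulomb_gas :: "nat \<Rightarrow> real \<Rightarrow> (complex \<Rightarrow> ereal) \<Rightarrow> (nat \<Rightarrow> complex) measure" where
  "coulomb_gas N \<beta> V = density (\<Pi>\<^sub>M i\<in>{..<N}. lborel)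
     (\<lambda>z. gas_weight N \<beta> V z / partition_function N \<beta> V)"

definition linear_statistic :: "nat \<Rightarrow> (complex \<Rightarrow> real) \<Rightarrow> (nat \<Rightarrow> complex) \<Rightarrow> real" where
  "linear_statistic N u z = (1 / real N) * (\<Sum>i<N. u (z i))"

definition admissible :: "(complex \<Rightarrow> ereal) \<Rightarrow> (complex \<Rightarrow> real) \<Rightarrow> bool" where
  "admissible \<phi> u \<longleftrightarrow>
     continuous_on UNIV u \<and> strictly_super_log_growth (\<lambda>z. \<phi> z + ereal (u z))"

end

theory Submission
  imports Defs "HOL-Complex_Analysis.Cauchy_Integral_Formula" "HOL-Real_Asymp.Real_Asymp"
begin

text \<open>The witness comes from a dilation. Replacing \<open>\<phi>\<close> by \<open>\<phi> (z / c)\<close> with \<open>c > 1\<close> multiplies the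
  partition function by exactly \<open>c\<close> to the power \<open>2 N + \<beta> N (N - 1)\<close> and lowers the free energy by exactly
  \<open>ln c\<close>, so the two sides of the deviation inequality differ by \<open>(2 - \<beta>) ln c / (\<beta> N)\<close>, which is
  positive because \<open>\<beta> < 2\<close>. As \<open>\<phi>\<close> may be irregular or infinite away from the support \<open>S\<close> of the
  equilibrium measure, \<open>u\<close> only interpolates between the dilated weight near \<open>S\<close> and \<open>\<phi>\<close> plus a large
  constant elsewhere. The free energy cannot drop below that of the dilated weight, since mass far from
  \<open>S\<close> is expensive. For the partition function one needs that confining all particles to a
  neighbourhood \<open>K\<close> of \<open>S\<close> costs only a factor \<open>exp (o(N))\<close>.

  This holds even if the Euler-Lagrange inequality is not strict outside \<open>S\<close>. By the domination
  principle the weighted polynomial seen by a particle outside \<open>K\<close> is at most its maximum over \<open>S\<close>, and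
  Cauchy's estimate bounds that maximum by a power of \<open>N\<close> times its integral over \<open>K\<close>. In addition each other
  particle in the same small cell outside \<open>K\<close> gains a fixed factor below one. Moving \<open>n\<close> particles of a
  cell into \<open>K\<close> therefore costs at most \<open>exp (O(n ln N) - h n\<^sup>2)\<close>, and the sum over \<open>n\<close> is \<open>exp (O((ln N)\<^sup>2))\<close>.\<close>

section \<open>The energy kernel\<close>

text \<open>The gain comes from two terms of order N. In the exponent
  \<open>2 N + \<beta> N (N - 1)\<close> the part \<open>\<beta> N^2\<close> is exactly what the
  change of the free energy predicts; \<open>2 N\<close> is the Jacobian of the dilation on N copies
  of the plane, and \<open>- \<beta> N\<close> is due to the absent self-interactions. Only
  \<open>(2 - \<beta>) N ln c\<close> is left, so every other loss in the exponent has to be o(N),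
  and this shapes the proof. Where \<Phi> touches the potential outside S, no exponential factor
  penalizes a particle. Cauchy's estimate and the choice of the particle cost a factor of order N^3
  each time; for up to N particles this would add up to exp (3 N ln N), which is too much. The
  repulsion inside a cell is therefore essential. It is strong enough because the cells have a fixed
  size: finitely many of them cover a large disc, whatever N is, and beyond that disc the growth of
  \<Phi> gives an exponential penalty instead.\<close>

definition weight_growth :: "(complex \<Rightarrow> ereal) \<Rightarrow> real \<Rightarrow> real \<Rightarrow> bool" where
  "weight_growth \<Phi> \<epsilon> C \<longleftrightarrow> 0 < \<epsilon> \<and> 0 \<le> C \<and>
     (\<forall>z. ereal ((1 + \<epsilon>) * ln (1 + (cmod z)\<^sup>2) - C) \<le> \<Phi> z)"

text \<open>Adding \<open>2 C\<close> makes the kernel nonnegative for weights with growth constant \<open>C\<close>, so that energies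
  become nonnegative integrals and need no integrability assumptions.\<close>

definition energy_kernel :: "(complex \<Rightarrow> ereal) \<Rightarrow> real \<Rightarrow> complex \<Rightarrow> complex \<Rightarrow> ennreal" where
  "energy_kernel \<Phi> C z w = (if z = w then \<infinity>
     else e2ennreal (\<Phi> z + \<Phi> w + ereal (2 * C - ln ((cmod (z - w))\<^sup>2))))"

text \<open>With equal arguments this is twice the weighted energy plus \<open>2 * C\<close>
  (\<open>weighted_energy_eq\<close>); with different ones it is the polarized form. The constants
  of \<open>weight_growth\<close> are explicit parameters so that two weights can share the same
  \<open>C\<close>; the shift then cancels when their free energies are compared.\<close>

definition mutual_energy ::
    "(complex \<Rightarrow> ereal) \<Rightarrow> real \<Rightarrow> complex measure \<Rightarrow> complex measure \<Rightarrow> ennreal" where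
  "mutual_energy \<Phi> C \<nu> \<nu>' = (\<integral>\<^sup>+z. (\<integral>\<^sup>+w. energy_kernel \<Phi> C z w \<partial>\<nu>') \<partial>\<nu>)"

lemma lower_semicontinuous_measurable:
  fixes f :: "complex \<Rightarrow> ereal"
  assumes "lower_semicontinuous f"
  shows "f \<in> borel_measurable borel"
proof (rule borel_measurableI_greater)
  fix y show "{x \<in> space borel. y < f x} \<in> sets borel"
    using assms by (auto simp: lower_semicontinuous_def)
qed

lemma weight_growthD:
  assumes "weight_growth \<Phi> \<epsilon> C"
  shows "ereal ((1 + \<epsilon>) * ln (1 + (cmod z)\<^sup>2) - C) \<le> \<Phi> z"
    and "ereal (ln (1 + (cmod z)\<^sup>2) - C) \<le> \<Phi> z" and "ereal (- C) \<le> \<Phi> z" and "\<Phi> z \<noteq> -\<infinity>"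
proof -
  have l: "0 \<le> ln (1 + (cmod z)\<^sup>2)" by simp
  show 1: "ereal ((1 + \<epsilon>) * ln (1 + (cmod z)\<^sup>2) - C) \<le> \<Phi> z"
    using assms unfolding weight_growth_def by blast
  have "ln (1 + (cmod z)\<^sup>2) - C \<le> (1 + \<epsilon>) * ln (1 + (cmod z)\<^sup>2) - C"
    using assms l unfolding weight_growth_def by (simp add: algebra_simps)
  then show 2: "ereal (ln (1 + (cmod z)\<^sup>2) - C) \<le> \<Phi> z"
    using 1 by (meson ereal_less_eq(3) order_trans)
  have "- C \<le> ln (1 + (cmod z)\<^sup>2) - C" using l by simp
  then show "ereal (- C) \<le> \<Phi> z" using 2 by (meson ereal_less_eq(3) order_trans)
  then show "\<Phi> z \<noteq> -\<infinity>" by auto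
qed

text \<open>Lagrange's identity: adding \<open>(1 - |z| |w|)^2\<close> to
  \<open>(|z| + |w|)^2\<close> gives the right-hand side exactly. It bounds the logarithm of a
  distance by a sum of one-particle terms, which the growth of \<Phi> dominates.\<close>

lemma cmod_diff_sq_le: "(cmod (z - w))\<^sup>2 \<le> (1 + (cmod z)\<^sup>2) * (1 + (cmod w)\<^sup>2)"
proof -
  have "cmod (z - w) \<le> cmod z + cmod w" by (rule norm_triangle_ineq4)
  then have "(cmod (z - w))\<^sup>2 \<le> (cmod z + cmod w)\<^sup>2" by (rule power_mono) simp
  also have "\<dots> \<le> (cmod z + cmod w)\<^sup>2 + (1 - cmod z * cmod w)\<^sup>2" by simp
  also have "\<dots> = (1 + (cmod z)\<^sup>2) * (1 + (cmod w)\<^sup>2)" by (simp add: power2_eq_square algebra_simps)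
  finally show ?thesis .
qed

lemma ln_cmod_diff_le:
  "ln ((cmod (z - w))\<^sup>2) \<le> ln (1 + (cmod z)\<^sup>2) + ln (1 + (cmod w)\<^sup>2)"
proof (cases "z = w")
  case True then show ?thesis by simp
next
  case False
  then have "ln ((cmod (z - w))\<^sup>2) \<le> ln ((1 + (cmod z)\<^sup>2) * (1 + (cmod w)\<^sup>2))"
    using cmod_diff_sq_le[of z w] by (intro ln_mono) auto
  also have "\<dots> = ln (1 + (cmod z)\<^sup>2) + ln (1 + (cmod w)\<^sup>2)"
    by (rule ln_mult_pos) (auto intro: add_pos_nonneg)
  finally show ?thesis .
qed

lemma energy_kernel_commute: "energy_kernel \<Phi> C z w = energy_kernel \<Phi> C w z"
  by (simp add: energy_kernel_def norm_minus_commute add.commute)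

lemma measurable_energy_kernel [measurable]:
  assumes [measurable]: "\<Phi> \<in> borel_measurable borel"
  shows "(\<lambda>(z, w). energy_kernel \<Phi> C z w) \<in> borel_measurable (borel \<Otimes>\<^sub>M borel)"
  unfolding energy_kernel_def by measurable

lemma measurable_elog_dist [measurable]:
  "(\<lambda>(z::complex, w). elog (ennreal ((cmod (z - w))\<^sup>2))) \<in> borel_measurable (borel \<Otimes>\<^sub>M borel)"
  unfolding elog_def by measurable

text \<open>The definition of the kernel with its subtractions moved across, so that only
  nonnegative terms occur and both sides can be integrated term by term. On the diagonal both sides
  are infinite, because \<open>elog 0 = -\<infinity>\<close>.\<close>

lemma energy_kernel_identity:
  assumes g: "weight_growth \<Phi> \<epsilon> C"
  shows "energy_kernel \<Phi> C z w + e2ennreal (elog (ennreal ((cmod (z - w))\<^sup>2))) =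
    e2ennreal (\<Phi> z + ereal C) + e2ennreal (\<Phi> w + ereal C)
      + e2ennreal (- elog (ennreal ((cmod (z - w))\<^sup>2)))"
proof (cases "z = w")
  case True then show ?thesis by (simp add: energy_kernel_def elog_def)
next
  case False
  then have pos: "0 < (cmod (z - w))\<^sup>2" by simp
  define l where "l = ln ((cmod (z - w))\<^sup>2)"
  have el: "elog (ennreal ((cmod (z - w))\<^sup>2)) = ereal l"
    using pos by (simp add: elog_def l_def ennreal_eq_0_iff)
  show ?thesis
  proof (cases "\<Phi> z = \<infinity> \<or> \<Phi> w = \<infinity>")
    case True
    then show ?thesis using False weight_growthD(4)[OF g, of z] weight_growthD(4)[OF g, of w]
      by (cases "\<Phi> z"; cases "\<Phi> w") (auto simp: energy_kernel_def)
  next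
    case nf: False
    obtain a where a: "\<Phi> z = ereal a" using nf weight_growthD(4)[OF g, of z] by (cases "\<Phi> z") auto
    obtain b where b: "\<Phi> w = ereal b" using nf weight_growthD(4)[OF g, of w] by (cases "\<Phi> w") auto
    have la: "ln (1 + (cmod z)\<^sup>2) - C \<le> a" using weight_growthD(2)[OF g, of z] a by simp
    have lb: "ln (1 + (cmod w)\<^sup>2) - C \<le> b" using weight_growthD(2)[OF g, of w] b by simp
    have l1: "0 \<le> ln (1 + (cmod z)\<^sup>2)" "0 \<le> ln (1 + (cmod w)\<^sup>2)" by simp_all
    have ll: "l \<le> ln (1 + (cmod z)\<^sup>2) + ln (1 + (cmod w)\<^sup>2)"
      unfolding l_def by (rule ln_cmod_diff_le)
    have k: "energy_kernel \<Phi> C z w = ennreal (a + b + (2 * C - l))"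
      using False by (simp add: energy_kernel_def a b l_def)
    have ab: "0 \<le> a + C" "0 \<le> b + C" "0 \<le> a + b + (2 * C - l)" using la lb l1 ll by linarith+
    show ?thesis
      unfolding k el a b using ab
      by (cases "0 \<le> l") (simp_all add: ennreal_neg algebra_simps ennreal_plus[symmetric] del: ennreal_plus)
  qed
qed

text \<open>The growth at w pays for \<open>ln (1 + |w|^2)\<close>, and a share
  \<open>1 / (1 + \<epsilon>)\<close> of \<open>\<Phi> z + C\<close> pays for
  \<open>ln (1 + |z|^2)\<close>; what remains is bounded below uniformly in w. The first bound makes
  the energy infinite when the integral of \<Phi> is; the second one bounds the support of the
  equilibrium measure.\<close>

lemma energy_kernel_lower:
  assumes g: "weight_growth \<Phi> \<epsilon> C"
  shows "ennreal (\<epsilon> / (1 + \<epsilon>)) * e2ennreal (\<Phi> z + ereal C) \<le> energy_kernel \<Phi> C z w"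
    and "ennreal (\<epsilon> * ln (1 + (cmod z)\<^sup>2)) \<le> energy_kernel \<Phi> C z w"
proof -
  have e: "0 < \<epsilon>" using g by (simp add: weight_growth_def)
  have "ennreal (\<epsilon> / (1 + \<epsilon>)) * e2ennreal (\<Phi> z + ereal C) \<le> energy_kernel \<Phi> C z w \<and>
    ennreal (\<epsilon> * ln (1 + (cmod z)\<^sup>2)) \<le> energy_kernel \<Phi> C z w"
  proof (cases "z = w \<or> \<Phi> z = \<infinity> \<or> \<Phi> w = \<infinity>")
    case True
    then have "energy_kernel \<Phi> C z w = \<infinity>"
      using weight_growthD(4)[OF g, of z] weight_growthD(4)[OF g, of w]
      by (cases "\<Phi> z"; cases "\<Phi> w") (auto simp: energy_kernel_def)
    then show ?thesis by simp
  next
    case nf: False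
    obtain a where a: "\<Phi> z = ereal a" using nf weight_growthD(4)[OF g, of z] by (cases "\<Phi> z") auto
    obtain b where b: "\<Phi> w = ereal b" using nf weight_growthD(4)[OF g, of w] by (cases "\<Phi> w") auto
    define l where "l = ln ((cmod (z - w))\<^sup>2)"
    define lz where "lz = ln (1 + (cmod z)\<^sup>2)"
    have la: "(1 + \<epsilon>) * lz - C \<le> a" using weight_growthD(1)[OF g, of z] a by (simp add: lz_def)
    have lb: "ln (1 + (cmod w)\<^sup>2) - C \<le> b" using weight_growthD(2)[OF g, of w] b by simp
    have ll: "l \<le> lz + ln (1 + (cmod w)\<^sup>2)"
      unfolding l_def lz_def by (rule ln_cmod_diff_le)
    have k: "energy_kernel \<Phi> C z w = ennreal (a + b + (2 * C - l))"
      using nf by (simp add: energy_kernel_def a b l_def)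
    have 1: "a + C - lz \<le> a + b + (2 * C - l)" using lb ll by simp
    have lz0: "0 \<le> lz" by (simp add: lz_def)
    have aC: "0 \<le> a + C" using la lz0 e by (smt (verit) mult_nonneg_nonneg)
    have "lz \<le> (a + C) / (1 + \<epsilon>)" using la e by (simp add: field_simps)
    then have 2: "\<epsilon> / (1 + \<epsilon>) * (a + C) \<le> a + C - lz" using e by (simp add: field_simps)
    have 3: "\<epsilon> * lz \<le> a + C - lz" using la by (simp add: algebra_simps)
    have "ennreal (\<epsilon> / (1 + \<epsilon>)) * e2ennreal (\<Phi> z + ereal C) = ennreal (\<epsilon> / (1 + \<epsilon>) * (a + C))"
      using e aC by (simp add: a ennreal_mult[symmetric])
    then show ?thesis unfolding k lz_def[symmetric]
      using 1 2 3 by (auto intro!: ennreal_leI)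
  qed
  then show "ennreal (\<epsilon> / (1 + \<epsilon>)) * e2ennreal (\<Phi> z + ereal C) \<le> energy_kernel \<Phi> C z w"
    and "ennreal (\<epsilon> * ln (1 + (cmod z)\<^sup>2)) \<le> energy_kernel \<Phi> C z w" by auto
qed

lemma weighted_energy_arith:
  fixes A Q P R Lp Ln :: ennreal and C :: real
  assumes AR: "A + R = P + ennreal C" and Q: "Q + Lp = A + A + Ln"
    and R: "R < \<infinity>" and Lp: "A < \<infinity> \<Longrightarrow> Lp < \<infinity>" and AQ: "A = \<infinity> \<Longrightarrow> Q = \<infinity>" and C: "0 \<le> C"
  shows "- (ereal (1/2) * (enn2ereal Lp - enn2ereal Ln)) + (enn2ereal P - enn2ereal R) =
    ereal (1/2) * enn2ereal Q - ereal C"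
proof (cases "A = \<infinity>")
  case True
  then have P: "P = \<infinity>" using AR C by (cases P) (auto simp: ennreal_plus[symmetric] simp del: ennreal_plus)
  obtain r where r: "R = ennreal r" "0 \<le> r" using R by (cases R) auto
  \<comment> \<open>Here \<open>P - R = \<infinity>\<close>, and
    \<open>-\<infinity> + \<infinity> = \<infinity>\<close> in \<open>ereal\<close>, so the left
    side is infinite whatever the logarithmic integral is.\<close>
  show ?thesis using AQ[OF True] P r by simp
next
  case False
  then obtain a where a: "A = ennreal a" "0 \<le> a" by (cases A) auto
  obtain r where r: "R = ennreal r" "0 \<le> r" using R by (cases R) auto
  obtain lp where lp: "Lp = ennreal lp" "0 \<le> lp" using Lp a by (cases Lp) auto
  obtain p where p: "P = ennreal p" "0 \<le> p" using AR a r C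
    by (cases P) (auto simp: ennreal_plus[symmetric] simp del: ennreal_plus)
  have ap: "a + r = p + C" using AR a r p C
    by (simp add: ennreal_plus[symmetric] del: ennreal_plus)
  show ?thesis
  proof (cases Ln)
    case top
    then have "Q = \<infinity>" using Q lp by (cases Q) (auto simp: ennreal_plus[symmetric] simp del: ennreal_plus)
    then show ?thesis using top lp p r by (simp)
  next
    case (real ln')
    obtain q where q: "Q = ennreal q" "0 \<le> q" using Q a real lp
      by (cases Q) (auto simp: ennreal_plus[symmetric] simp del: ennreal_plus)
    have "q + lp = a + a + ln'" using Q a real lp q
      by (simp add: ennreal_plus[symmetric] del: ennreal_plus)
    then show ?thesis using ap by (simp add: q lp p r real enn2ereal_ennreal field_simps)
  qed
qed

text \<open>This settles the conventions for \<open>\<infinity> - \<infinity>\<close>: afterwards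
  minimality is a statement about nonnegative integrals.\<close>

lemma weighted_energy_eq:
  assumes g: "weight_growth \<Phi> \<epsilon> C" and meas [measurable]: "\<Phi> \<in> borel_measurable borel"
    and \<nu>: "\<nu> \<in> prob_measures"
  shows "weighted_energy \<Phi> \<nu> = ereal (1/2) * enn2ereal (mutual_energy \<Phi> C \<nu> \<nu>) - ereal C"
proof -
  interpret prob_space \<nu> using \<nu> by (simp add: prob_measures_def)
  have s [measurable_cong]: "sets \<nu> = sets borel" using \<nu> by (simp add: prob_measures_def)
  have one: "emeasure \<nu> (space \<nu>) = 1" by (rule emeasure_space_1)
  have C: "0 \<le> C" using g by (simp add: weight_growth_def)
  define A where "A = (\<integral>\<^sup>+z. e2ennreal (\<Phi> z + ereal C) \<partial>\<nu>)"
  define P where "P = (\<integral>\<^sup>+z. e2ennreal (\<Phi> z) \<partial>\<nu>)"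
  define R where "R = (\<integral>\<^sup>+z. e2ennreal (- \<Phi> z) \<partial>\<nu>)"
  define Lp where "Lp = (\<integral>\<^sup>+x. e2ennreal (case x of (z, w) \<Rightarrow> elog (ennreal ((cmod (z - w))\<^sup>2))) \<partial>(\<nu> \<Otimes>\<^sub>M \<nu>))"
  define Ln where "Ln = (\<integral>\<^sup>+x. e2ennreal (- (case x of (z, w) \<Rightarrow> elog (ennreal ((cmod (z - w))\<^sup>2)))) \<partial>(\<nu> \<Otimes>\<^sub>M \<nu>))"
  define Q where "Q = mutual_energy \<Phi> C \<nu> \<nu>"
  have Qp: "Q = (\<integral>\<^sup>+x. (case x of (z, w) \<Rightarrow> energy_kernel \<Phi> C z w) \<partial>(\<nu> \<Otimes>\<^sub>M \<nu>))"
    unfolding Q_def mutual_energy_def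
    using nn_integral_fst[of "\<lambda>(z, w). energy_kernel \<Phi> C z w" \<nu>] by simp
  have A1: "(\<integral>\<^sup>+x. e2ennreal (\<Phi> (fst x) + ereal C) \<partial>(\<nu> \<Otimes>\<^sub>M \<nu>)) = A"
    unfolding A_def by (subst nn_integral_fst[symmetric]) (auto simp: one)
  have A2: "(\<integral>\<^sup>+x. e2ennreal (\<Phi> (snd x) + ereal C) \<partial>(\<nu> \<Otimes>\<^sub>M \<nu>)) = A"
    unfolding A_def by (subst nn_integral_fst[symmetric]) (auto simp: one)
  have c1: "A + R = P + ennreal C"
  proof -
    have "A + R = (\<integral>\<^sup>+z. e2ennreal (\<Phi> z + ereal C) + e2ennreal (- \<Phi> z) \<partial>\<nu>)"
      unfolding A_def R_def by (subst nn_integral_add) auto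
    also have "\<dots> = (\<integral>\<^sup>+z. e2ennreal (\<Phi> z) + ennreal C \<partial>\<nu>)"
    proof (rule nn_integral_cong)
      fix z
      show "e2ennreal (\<Phi> z + ereal C) + e2ennreal (- \<Phi> z) = e2ennreal (\<Phi> z) + ennreal C"
      proof (cases "\<Phi> z")
        case (real r)
        then have "- C \<le> r" using weight_growthD(3)[OF g, of z] by simp
        then show ?thesis using C by (cases "0 \<le> r") (simp_all add: real ennreal_neg flip: ennreal_plus)
      qed (use weight_growthD(4)[OF g, of z] in auto)
    qed
    also have "\<dots> = P + ennreal C" unfolding P_def
      by (subst nn_integral_add) (auto simp: one)
    finally show ?thesis .
  qed
  have c2: "Q + Lp = A + A + Ln"
  proof -
    have "Q + Lp = (\<integral>\<^sup>+x. (case x of (z, w) \<Rightarrow> energy_kernel \<Phi> C z w) + e2ennreal (case x of (z, w) \<Rightarrow> elog (ennreal ((cmod (z - w))\<^sup>2))) \<partial>(\<nu> \<Otimes>\<^sub>M \<nu>))"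
      unfolding Qp Lp_def by (subst nn_integral_add) auto
    also have "\<dots> = (\<integral>\<^sup>+x. (e2ennreal (\<Phi> (fst x) + ereal C) + e2ennreal (\<Phi> (snd x) + ereal C)) + e2ennreal (- (case x of (z, w) \<Rightarrow> elog (ennreal ((cmod (z - w))\<^sup>2)))) \<partial>(\<nu> \<Otimes>\<^sub>M \<nu>))"
      by (rule nn_integral_cong) (auto simp: energy_kernel_identity[OF g] split: prod.splits)
    also have "\<dots> = A + A + Ln"
      by (subst nn_integral_add, measurable) (subst nn_integral_add, auto simp: A1 A2 Ln_def)
    finally show ?thesis .
  qed
  have c3: "R < \<infinity>"
  proof -
    have "R \<le> (\<integral>\<^sup>+z. ennreal C \<partial>\<nu>)" unfolding R_def
    proof (rule nn_integral_mono)
      fix z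
      have "- \<Phi> z \<le> ereal C" using weight_growthD(3)[OF g, of z] by (simp add: ereal_uminus_le_reorder)
      then have "e2ennreal (- \<Phi> z) \<le> e2ennreal (ereal C)" by (rule e2ennreal_mono)
      then show "e2ennreal (- \<Phi> z) \<le> ennreal C" by simp
    qed
    also have "\<dots> < \<infinity>" by (simp add: one)
    finally show ?thesis .
  qed
  have c4: "Lp < \<infinity>" if "A < \<infinity>"
  proof -
    have "Lp \<le> (\<integral>\<^sup>+x. (e2ennreal (\<Phi> (fst x) + ereal C) + e2ennreal (\<Phi> (snd x) + ereal C)) \<partial>(\<nu> \<Otimes>\<^sub>M \<nu>))"
      unfolding Lp_def
    proof (rule nn_integral_mono, clarsimp)
      fix z w
      show "e2ennreal (elog (ennreal ((cmod (z - w))\<^sup>2))) \<le> e2ennreal (\<Phi> z + ereal C) + e2ennreal (\<Phi> w + ereal C)"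
      proof (cases "z = w")
        case False
        have 1: "ennreal (ln (1 + (cmod x)\<^sup>2)) \<le> e2ennreal (\<Phi> x + ereal C)" for x
        proof -
          have "ereal (ln (1 + (cmod x)\<^sup>2)) \<le> \<Phi> x + ereal C"
            using weight_growthD(2)[OF g, of x] by (cases "\<Phi> x") auto
          from e2ennreal_mono[OF this] show ?thesis by simp
        qed
        have "e2ennreal (elog (ennreal ((cmod (z - w))\<^sup>2))) = ennreal (ln ((cmod (z - w))\<^sup>2))"
          using False by (simp add: elog_def ennreal_eq_0_iff)
        also have "\<dots> \<le> ennreal (ln (1 + (cmod z)\<^sup>2) + ln (1 + (cmod w)\<^sup>2))"
          by (intro ennreal_leI ln_cmod_diff_le)
        also have "\<dots> = ennreal (ln (1 + (cmod z)\<^sup>2)) + ennreal (ln (1 + (cmod w)\<^sup>2))"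
          by (simp add: ennreal_plus)
        finally show ?thesis using 1[of z] 1[of w] by (meson add_mono order_trans)
      qed (simp add: elog_def e2ennreal_neg)
    qed
    also have "\<dots> = A + A" by (subst nn_integral_add) (auto simp: A1 A2)
    also have "\<dots> < \<infinity>" using that by simp
    finally show ?thesis .
  qed
  have c5: "Q = \<infinity>" if "A = \<infinity>"
  proof -
    have e: "0 < \<epsilon>" using g by (simp add: weight_growth_def)
    have "ennreal (\<epsilon> / (1 + \<epsilon>)) * A = (\<integral>\<^sup>+z. (\<integral>\<^sup>+w. ennreal (\<epsilon> / (1 + \<epsilon>)) * e2ennreal (\<Phi> z + ereal C) \<partial>\<nu>) \<partial>\<nu>)"
      unfolding A_def by (subst nn_integral_cmult[symmetric]) (auto simp: one)
    also have "\<dots> \<le> Q" unfolding Q_def mutual_energy_def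
      by (intro nn_integral_mono energy_kernel_lower(1)[OF g])
    finally have *: "ennreal (\<epsilon> / (1 + \<epsilon>)) * A \<le> Q" .
    have "0 < \<epsilon> / (1 + \<epsilon>)" using e by simp
    then have "ennreal (\<epsilon> / (1 + \<epsilon>)) * A = \<infinity>"
      using that by (simp add: ennreal_mult_top ennreal_eq_0_iff not_le del: zero_less_divide_iff)
    then show ?thesis using * by (simp add: top_unique)
  qed
  have li: "log_integral \<nu> = enn2ereal Lp - enn2ereal Ln"
    unfolding log_integral_def eintegral_def Lp_def Ln_def by simp
  have ei: "eintegral \<nu> \<Phi> = enn2ereal P - enn2ereal R"
    unfolding eintegral_def P_def R_def by simp
  show ?thesis unfolding weighted_energy_def li ei Q_def[symmetric]
    by (rule weighted_energy_arith[OF c1 c2 c3 c4 c5 C])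
qed

text \<open>Up to the factor \<open>2 * ln 2\<close>, the integrand is at most the number of dyadic
  discs \<open>B n\<close> that contain w, and their areas form a geometric series. There is no
  cutoff at infinity because \<open>ennreal\<close> truncates the negative values for |w| >
  1.\<close>

lemma nn_integral_neg_ln_finite:
  "(\<integral>\<^sup>+w. ennreal (- ln ((cmod w)\<^sup>2)) \<partial>lborel) < \<infinity>"
proof -
  define B where "B n = ball (0::complex) ((1/2) ^ n)" for n :: nat
  have [measurable]: "B n \<in> sets borel" for n by (simp add: B_def)
  define c where "c = unit_ball_vol (real DIM(complex))"
  have c: "0 \<le> c" unfolding c_def by simp
  have pt: "ennreal (- ln ((cmod w)\<^sup>2)) \<le> (\<Sum>n. ennreal (2 * ln 2) * indicator (B n) w)" for w
  proof (cases "w = 0 \<or> 1 \<le> cmod w")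
    case True
    then have "- ln ((cmod w)\<^sup>2) \<le> 0" by auto
    then show ?thesis by (simp add: ennreal_neg)
  next
    case False
    define t where "t = cmod w"
    have t: "0 < t" "t < 1" using False by (auto simp: t_def)
    have ex: "\<exists>n. (1/2) ^ n \<le> t"
      using real_arch_pow_inv[of t "1/2"] t by (auto intro: less_imp_le)
    define m where "m = (LEAST n. (1/2) ^ n \<le> t)"
    have m1: "(1/2) ^ m \<le> t" unfolding m_def using ex by (rule LeastI_ex)
    have m2: "t < (1/2) ^ n" if "n < m" for n
      using not_less_Least[of n "\<lambda>n. (1/2) ^ n \<le> t"] that by (simp add: m_def)
    have "- ln (t\<^sup>2) \<le> real m * (2 * ln 2)"
    proof -
      have "ln ((1/2) ^ m) \<le> ln t" using m1 t by (intro ln_mono) auto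
      then show ?thesis using t by (simp add: ln_realpow ln_div)
    qed
    then have "ennreal (- ln ((cmod w)\<^sup>2)) \<le> ennreal (real m * (2 * ln 2))"
      unfolding t_def by (rule ennreal_leI)
    also have "\<dots> = (\<Sum>n<m. ennreal (2 * ln 2) * indicator (B n) w)"
    proof -
      have "(\<Sum>n<m. ennreal (2 * ln 2) * indicator (B n) w) = (\<Sum>n<m. ennreal (2 * ln 2))"
        by (rule sum.cong) (use m2 in \<open>auto simp: B_def t_def\<close>)
      then show ?thesis by (simp add: ennreal_mult ennreal_of_nat_eq_real_of_nat)
    qed
    also have "\<dots> \<le> (\<Sum>n. ennreal (2 * ln 2) * indicator (B n) w)"
      by (rule sum_le_suminf) auto
    finally show ?thesis .
  qed
  have "(\<integral>\<^sup>+w. ennreal (- ln ((cmod w)\<^sup>2)) \<partial>lborel)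
      \<le> (\<integral>\<^sup>+w. (\<Sum>n. ennreal (2 * ln 2) * indicator (B n) w) \<partial>lborel)"
    by (rule nn_integral_mono) (rule pt)
  also have "\<dots> = (\<Sum>n. \<integral>\<^sup>+w. ennreal (2 * ln 2) * indicator (B n) w \<partial>lborel)"
    by (rule nn_integral_suminf) measurable
  also have "\<dots> = (\<Sum>n. ennreal (2 * ln 2 * c * (1/4) ^ n))"
  proof (rule suminf_cong)
    fix n
    have q: "(1/2) ^ n * (1/2) ^ n = (1/4 :: real) ^ n" by (simp add: power_mult_distrib[symmetric])
    have "(\<integral>\<^sup>+w. ennreal (2 * ln 2) * indicator (B n) w \<partial>lborel) = ennreal (2 * ln 2) * emeasure lborel (B n)"
      by (subst nn_integral_cmult_indicator) (simp_all add: B_def)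
    also have "\<dots> = ennreal (2 * ln 2) * ennreal (c * (1/4) ^ n)"
      unfolding B_def using q by (subst emeasure_ball) (simp_all add: c_def power2_eq_square)
    also have "\<dots> = ennreal (2 * ln 2 * c * (1/4) ^ n)"
      using c by (subst ennreal_mult[symmetric]) (auto simp: mult.assoc)
    finally show "(\<integral>\<^sup>+w. ennreal (2 * ln 2) * indicator (B n) w \<partial>lborel) = ennreal (2 * ln 2 * c * (1/4) ^ n)" .
  qed
  also have "\<dots> < \<infinity>"
  proof -
    have "(\<Sum>n. ennreal (2 * ln 2 * c * (1/4) ^ n)) \<noteq> top"
      using c by (intro ennreal_suminf_neq_top summable_mult summable_geometric) auto
    then show ?thesis by (simp add: less_top)
  qed
  finally show ?thesis .
qed

lemma nn_integral_neg_ln_shift: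
  "(\<integral>\<^sup>+w. ennreal (- ln ((cmod (z - w))\<^sup>2)) \<partial>lborel) = (\<integral>\<^sup>+w. ennreal (- ln ((cmod w)\<^sup>2)) \<partial>lborel)"
proof -
  have "(\<integral>\<^sup>+w. ennreal (- ln ((cmod w)\<^sup>2)) \<partial>lborel)
     = (\<integral>\<^sup>+w. ennreal (- ln ((cmod w)\<^sup>2)) \<partial>(distr lborel borel ((+) (- z))))"
    by (subst lborel_distr_plus) simp
  also have "\<dots> = (\<integral>\<^sup>+w. ennreal (- ln ((cmod (- z + w))\<^sup>2)) \<partial>lborel)"
    by (subst nn_integral_distr) auto
  also have "\<dots> = (\<integral>\<^sup>+w. ennreal (- ln ((cmod (z - w))\<^sup>2)) \<partial>lborel)"
    by (intro nn_integral_cong) (simp add: norm_minus_commute)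
  finally show ?thesis by simp
qed

text \<open>The convex combination \<open>t * \<nu> + (1 - t) * \<mu>\<close>, written as a choice
  by a Bernoulli variable so that the probability property and the integral formula come from the
  Giry monad.\<close>

definition mixture :: "real \<Rightarrow> 'a measure \<Rightarrow> 'a measure \<Rightarrow> 'a measure" where
  "mixture t \<nu> \<mu> = measure_pmf (bernoulli_pmf t) \<bind> (\<lambda>b. if b then \<nu> else \<mu>)"

lemma mixture_kernel:
  assumes "\<nu> \<in> prob_measures" "\<mu> \<in> prob_measures"
  shows "(\<lambda>b. if b then \<nu> else \<mu>) \<in> measurable (measure_pmf (bernoulli_pmf t)) (subprob_algebra borel)"
    and "(\<lambda>b. if b then \<nu> else \<mu>) \<in> measurable (measure_pmf (bernoulli_pmf t)) (prob_algebra borel)"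
  using assms by (auto simp: space_subprob_algebra space_prob_algebra prob_measures_def
      prob_space_imp_subprob_space measurable_def)

lemma mixture_prob_measures:
  assumes "\<nu> \<in> prob_measures" "\<mu> \<in> prob_measures"
  shows "mixture t \<nu> \<mu> \<in> prob_measures"
proof -
  have k: "(\<lambda>b. if b then \<nu> else \<mu>) \<in> measurable (measure_pmf (bernoulli_pmf t)) (subprob_algebra borel)"
    by (rule mixture_kernel[OF assms])
  have "sets (mixture t \<nu> \<mu>) = sets borel"
    unfolding mixture_def by (rule sets_bind[OF sets_kernel[OF k]]) auto
  moreover have "prob_space (mixture t \<nu> \<mu>)"
    unfolding mixture_def
    by (rule prob_space.prob_space_bind[OF _ _ k])
      (use assms in \<open>auto simp: prob_measures_def measure_pmf.prob_space_axioms\<close>)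
  ultimately show ?thesis by (simp add: prob_measures_def)
qed

lemma nn_integral_mixture:
  assumes "\<nu> \<in> prob_measures" "\<mu> \<in> prob_measures" "0 \<le> t" "t \<le> 1" "f \<in> borel_measurable borel"
  shows "(\<integral>\<^sup>+x. f x \<partial>mixture t \<nu> \<mu>) = ennreal t * (\<integral>\<^sup>+x. f x \<partial>\<nu>) + ennreal (1 - t) * (\<integral>\<^sup>+x. f x \<partial>\<mu>)"
  unfolding mixture_def
  by (subst nn_integral_bind[OF assms(5) mixture_kernel(1)[OF assms(1,2)]])
    (use assms in \<open>simp add: mult.commute\<close>)

section \<open>The kernel as a symmetric bilinear form on probability measures\<close>

locale weight =
  fixes \<Phi> :: "complex \<Rightarrow> ereal" and \<epsilon> C :: real
  assumes growth: "weight_growth \<Phi> \<epsilon> C" and meas [measurable]: "\<Phi> \<in> borel_measurable borel"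
begin

abbreviation k where "k \<equiv> energy_kernel \<Phi> C"
abbreviation Q where "Q \<equiv> mutual_energy \<Phi> C"

lemma eps_pos: "0 < \<epsilon>"
  using growth by (simp add: weight_growth_def)

lemma kernel_measurable_section [measurable]: "k z \<in> borel_measurable borel"
  unfolding energy_kernel_def by measurable

lemma eff_measurable:
  assumes "\<nu> \<in> prob_measures"
  shows "(\<lambda>z. \<integral>\<^sup>+w. k z w \<partial>\<nu>) \<in> borel_measurable borel"
proof -
  interpret prob_space \<nu> using assms by (simp add: prob_measures_def)
  have s [measurable_cong]: "sets \<nu> = sets borel" using assms by (simp add: prob_measures_def)
  show ?thesis
    by (rule borel_measurable_nn_integral) measurable
qed

lemma mutual_energy_commute:
  assumes "\<nu> \<in> prob_measures" "\<nu>' \<in> prob_measures"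
  shows "Q \<nu> \<nu>' = Q \<nu>' \<nu>"
proof -
  interpret M: prob_space \<nu> using assms by (simp add: prob_measures_def)
  interpret N: prob_space \<nu>' using assms by (simp add: prob_measures_def)
  interpret pair_sigma_finite \<nu>' \<nu> ..
  have s [measurable_cong]: "sets \<nu> = sets borel" "sets \<nu>' = sets borel"
    using assms by (auto simp: prob_measures_def)
  have "Q \<nu> \<nu>' = (\<integral>\<^sup>+z. (\<integral>\<^sup>+w. k w z \<partial>\<nu>') \<partial>\<nu>)"
    unfolding mutual_energy_def by (simp add: energy_kernel_commute)
  also have "\<dots> = Q \<nu>' \<nu>"
    unfolding mutual_energy_def by (rule Fubini') measurable
  finally show ?thesis .
qed

lemma mutual_energy_mixture:
  assumes \<nu>: "\<nu> \<in> prob_measures" and \<mu>: "\<mu> \<in> prob_measures" and t: "0 \<le> t" "t \<le> 1"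
  shows "Q (mixture t \<nu> \<mu>) (mixture t \<nu> \<mu>) =
    ennreal t * (ennreal t * Q \<nu> \<nu> + ennreal (1 - t) * Q \<nu> \<mu>)
      + ennreal (1 - t) * (ennreal t * Q \<nu> \<mu> + ennreal (1 - t) * Q \<mu> \<mu>)"
proof -
  have m: "mixture t \<nu> \<mu> \<in> prob_measures" by (rule mixture_prob_measures[OF \<nu> \<mu>])
  have 1: "Q \<kappa> (mixture t \<nu> \<mu>) = ennreal t * Q \<kappa> \<nu> + ennreal (1 - t) * Q \<kappa> \<mu>" if \<kappa>: "\<kappa> \<in> prob_measures" for \<kappa>
  proof -
    have [measurable_cong]: "sets \<kappa> = sets borel" using \<kappa> by (auto simp: prob_measures_def)
    have [measurable]: "(\<lambda>z. \<integral>\<^sup>+w. k z w \<partial>\<nu>) \<in> borel_measurable borel" "(\<lambda>z. \<integral>\<^sup>+w. k z w \<partial>\<mu>) \<in> borel_measurable borel"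
      by (rule eff_measurable[OF \<nu>], rule eff_measurable[OF \<mu>])
    show ?thesis
      unfolding mutual_energy_def nn_integral_mixture[OF \<nu> \<mu> t kernel_measurable_section]
      by (subst nn_integral_add, simp, simp) (simp add: nn_integral_cmult)
  qed
  have 2: "Q (mixture t \<nu> \<mu>) \<kappa> = ennreal t * Q \<nu> \<kappa> + ennreal (1 - t) * Q \<mu> \<kappa>" if \<kappa>: "\<kappa> \<in> prob_measures" for \<kappa>
    using 1[OF \<kappa>] mutual_energy_commute \<kappa> m \<nu> \<mu> by simp
  show ?thesis unfolding 2[OF m] 1[OF \<nu>] 1[OF \<mu>]
    using mutual_energy_commute[OF \<nu> \<mu>] by simp
qed

text \<open>The competitors for the first variation: where \<Phi> is bounded above, the kernel
  exceeds a constant only by the logarithmic singularity, whose integral does not depend on its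
  position.\<close>

lemma finite_energy_uniform:
  assumes A: "A \<in> sets borel" "emeasure lborel A \<noteq> 0" "emeasure lborel A < \<infinity>"
    and n: "\<And>z. z \<in> A \<Longrightarrow> \<Phi> z \<le> ereal n"
  shows "uniform_measure lborel A \<in> prob_measures"
    and "Q (uniform_measure lborel A) (uniform_measure lborel A) < \<infinity>"
proof -
  let ?\<nu> = "uniform_measure lborel A"
  show p: "?\<nu> \<in> prob_measures"
    using A by (auto simp: prob_measures_def intro!: prob_space_uniform_measure)
  have [measurable]: "A \<in> sets borel" by fact
  define m where "m = emeasure lborel A"
  define c where "c = ennreal (2 * n + 2 * C) + (\<integral>\<^sup>+w. ennreal (- ln ((cmod w)\<^sup>2)) \<partial>lborel) / m"
  have c: "c < \<infinity>"
    unfolding c_def m_def using nn_integral_neg_ln_finite A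
    by (auto simp: ennreal_divide_eq_top_iff less_top[symmetric])
  have in1: "(\<integral>\<^sup>+w. k z w \<partial>?\<nu>) \<le> c" if z: "z \<in> A" for z
  proof -
    have "(\<integral>\<^sup>+w. k z w \<partial>?\<nu>) = (\<integral>\<^sup>+w. k z w * indicator A w \<partial>lborel) / m"
      unfolding m_def by (subst nn_integral_uniform_measure) auto
    also have "(\<integral>\<^sup>+w. k z w * indicator A w \<partial>lborel) \<le>
       (\<integral>\<^sup>+w. ennreal (2 * n + 2 * C) * indicator A w + ennreal (- ln ((cmod (z - w))\<^sup>2)) \<partial>lborel)"
    proof (rule nn_integral_mono_AE)
      have "AE w in lborel. w \<noteq> z" by (rule AE_lborel_singleton)
      then show "AE w in lborel. k z w * indicator A w \<le> ennreal (2 * n + 2 * C) * indicator A w + ennreal (- ln ((cmod (z - w))\<^sup>2))"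
      proof eventually_elim
        case (elim w)
        show ?case
        proof (cases "w \<in> A")
          case True
          have "\<Phi> z + \<Phi> w + ereal (2 * C - ln ((cmod (z - w))\<^sup>2)) \<le> ereal n + ereal n + ereal (2 * C - ln ((cmod (z - w))\<^sup>2))"
            by (intro add_mono n z True order_refl)
          then have "k z w \<le> ennreal (n + n + (2 * C - ln ((cmod (z - w))\<^sup>2)))"
            using elim e2ennreal_mono by (fastforce simp: energy_kernel_def)
          also have "\<dots> \<le> ennreal (max 0 (2 * n + 2 * C) + max 0 (- ln ((cmod (z - w))\<^sup>2)))"
            by (intro ennreal_leI) auto
          also have "\<dots> = ennreal (2 * n + 2 * C) + ennreal (- ln ((cmod (z - w))\<^sup>2))"
            by (subst ennreal_plus) (auto simp: max_def ennreal_neg)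
          finally show ?thesis using True by simp
        qed simp
      qed
    qed
    also have "\<dots> = ennreal (2 * n + 2 * C) * m + (\<integral>\<^sup>+w. ennreal (- ln ((cmod w)\<^sup>2)) \<partial>lborel)"
      by (subst nn_integral_add) (auto simp: nn_integral_cmult m_def nn_integral_neg_ln_shift)
    finally have "(\<integral>\<^sup>+w. k z w \<partial>?\<nu>) \<le> (ennreal (2 * n + 2 * C) * m + (\<integral>\<^sup>+w. ennreal (- ln ((cmod w)\<^sup>2)) \<partial>lborel)) / m"
      by (simp add: divide_right_mono_ennreal)
    also have "\<dots> = c" unfolding c_def using A
      by (simp add: add_divide_distrib_ennreal m_def mult_divide_eq_ennreal less_top)
    finally show ?thesis .
  qed
  have "Q ?\<nu> ?\<nu> = (\<integral>\<^sup>+z. (\<integral>\<^sup>+w. k z w \<partial>?\<nu>) * indicator A z \<partial>lborel) / m"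
    unfolding mutual_energy_def m_def using eff_measurable[OF p]
    by (subst nn_integral_uniform_measure) auto
  also have "\<dots> \<le> (\<integral>\<^sup>+z. c * indicator A z \<partial>lborel) / m"
    by (intro divide_right_mono_ennreal nn_integral_mono) (auto simp: in1 indicator_def)
  also have "\<dots> = c" using A by (simp add: nn_integral_cmult m_def mult_divide_eq_ennreal less_top)
  finally show "Q ?\<nu> ?\<nu> < \<infinity>" using c by simp
qed

end

section \<open>Equilibrium measures\<close>

lemma ennreal_add_less_le_mono:
  fixes a b c d :: ennreal
  assumes "a < b" "c \<le> d" "c \<noteq> \<infinity>"
  shows "a + c < b + d"
proof -
  have "c + a < c + b" using assms by (simp add: ennreal_add_left_cancel_less)
  also have "\<dots> \<le> d + b" using assms by (intro add_right_mono)
  finally show ?thesis by (simp add: add.commute)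
qed

locale equilibrium = weight +
  fixes \<mu> :: "complex measure"
  assumes mu: "\<mu> \<in> prob_measures" and fin: "Q \<mu> \<mu> < \<infinity>"
    and minimal: "\<And>\<nu>. \<nu> \<in> prob_measures \<Longrightarrow> Q \<mu> \<mu> \<le> Q \<nu> \<nu>"

text \<open>One competitor of finite energy makes the minimum finite; then the affine relation
  between the weighted energy and \<open>Q\<close> carries minimality over.\<close>

lemma (in weight) free_energy_eq_equilibrium:
  assumes eq: "is_equilibrium_measure \<Phi> \<mu>" and \<nu>: "\<nu> \<in> prob_measures" "Q \<nu> \<nu> < \<infinity>"
  shows "equilibrium \<Phi> \<epsilon> C \<mu>" and "free_energy \<Phi> = ereal (enn2real (Q \<mu> \<mu>) / 2 - C)"
proof -
  have mu: "\<mu> \<in> prob_measures" and fe: "weighted_energy \<Phi> \<mu> = free_energy \<Phi>"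
    using eq by (auto simp: is_equilibrium_measure_def)
  have le: "Q \<mu> \<mu> \<le> Q \<nu>' \<nu>'" if n: "\<nu>' \<in> prob_measures" for \<nu>'
  proof -
    have "weighted_energy \<Phi> \<mu> \<le> weighted_energy \<Phi> \<nu>'"
      unfolding fe free_energy_def by (rule INF_lower[OF n])
    then have "ereal (1/2) * enn2ereal (Q \<mu> \<mu>) - ereal C \<le> ereal (1/2) * enn2ereal (Q \<nu>' \<nu>') - ereal C"
      using weighted_energy_eq[OF growth meas mu] weighted_energy_eq[OF growth meas n] by simp
    then show ?thesis
      by (cases "Q \<mu> \<mu>"; cases "Q \<nu>' \<nu>'") (auto simp: enn2ereal_ennreal)
  qed
  have f: "Q \<mu> \<mu> < \<infinity>" using le[OF \<nu>(1)] \<nu>(2) by (rule le_less_trans)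
  show "equilibrium \<Phi> \<epsilon> C \<mu>"
    by unfold_locales (use mu le f in auto)
  obtain q where q: "Q \<mu> \<mu> = ennreal q" "0 \<le> q" using f by (cases "Q \<mu> \<mu>") auto
  show "free_energy \<Phi> = ereal (enn2real (Q \<mu> \<mu>) / 2 - C)"
    using weighted_energy_eq[OF growth meas mu] q unfolding fe by (simp add: enn2ereal_ennreal)
qed

section \<open>Euler-Lagrange inequalities\<close>

context equilibrium
begin

definition eff :: "complex \<Rightarrow> ennreal" where "eff z = (\<integral>\<^sup>+w. k z w \<partial>\<mu>)"

lemma sets_mu [measurable_cong]: "sets \<mu> = sets borel"
  using mu by (simp add: prob_measures_def)

lemma space_mu: "space \<mu> = UNIV"
  using sets_eq_imp_space_eq[OF sets_mu] by simp

lemma prob_mu: "prob_space \<mu>"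
  using mu by (simp add: prob_measures_def)

lemma emeasure_mu: "emeasure \<mu> UNIV = 1"
  using prob_space.emeasure_space_1[OF prob_mu] by (simp add: space_mu)

lemma eff_meas [measurable]: "eff \<in> borel_measurable borel"
  using eff_measurable[OF mu] unfolding eff_def[abs_def] .

lemma mutual_energy_eff: "Q \<nu> \<mu> = (\<integral>\<^sup>+z. eff z \<partial>\<nu>)"
  by (simp add: mutual_energy_def eff_def)

text \<open>The derivative at \<open>t = 0\<close> of the energy of
  \<open>mixture t \<nu> \<mu>\<close> is \<open>2 * (Q \<nu> \<mu> - Q \<mu> \<mu>)\<close>, and
  minimality forces it to be nonnegative.\<close>

lemma first_variation:
  assumes \<nu>: "\<nu> \<in> prob_measures" and f: "Q \<nu> \<nu> < \<infinity>"
  shows "Q \<mu> \<mu> \<le> Q \<nu> \<mu>"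
proof (rule ccontr)
  assume "\<not> ?thesis"
  then have lt: "Q \<nu> \<mu> < Q \<mu> \<mu>" by simp
  obtain q where q: "Q \<mu> \<mu> = ennreal q" "0 \<le> q" using fin by (cases "Q \<mu> \<mu>") auto
  obtain n where n: "Q \<nu> \<nu> = ennreal n" "0 \<le> n" using f by (cases "Q \<nu> \<nu>") auto
  obtain m where m: "Q \<nu> \<mu> = ennreal m" "0 \<le> m" using lt q by (cases "Q \<nu> \<mu>") auto
  have mq: "m < q" using lt q m by (simp add: ennreal_less_iff)
  \<comment> \<open>D exceeds the coefficient of \<open>t^2\<close>. With
    \<open>t * D \<le> q - m\<close> the quadratic term cannot outweigh the linear decrease
    \<open>2 * t * (q - m)\<close>.\<close>
  define D where "D = \<bar>n + q - 2 * m\<bar> + 1"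
  have D: "0 < D" unfolding D_def by simp
  define t where "t = min (1/2) ((q - m) / D)"
  have t: "0 < t" "t \<le> 1/2" "t * D \<le> q - m"
    using mq D by (auto simp: t_def min_def field_simps)
  have "ennreal q \<le> ennreal t * (ennreal t * ennreal n + ennreal (1 - t) * ennreal m)
      + ennreal (1 - t) * (ennreal t * ennreal m + ennreal (1 - t) * ennreal q)"
  proof -
    have "Q \<mu> \<mu> \<le> Q (mixture t \<nu> \<mu>) (mixture t \<nu> \<mu>)"
      by (rule minimal[OF mixture_prob_measures[OF \<nu> mu]])
    also have "\<dots> = ennreal t * (ennreal t * Q \<nu> \<nu> + ennreal (1 - t) * Q \<nu> \<mu>)
      + ennreal (1 - t) * (ennreal t * Q \<nu> \<mu> + ennreal (1 - t) * Q \<mu> \<mu>)"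
      using t by (intro mutual_energy_mixture[OF \<nu> mu]) auto
    finally show ?thesis unfolding q(1) m(1) n(1) .
  qed
  also have "\<dots> = ennreal (t * (t * n + (1 - t) * m) + (1 - t) * (t * m + (1 - t) * q))"
    using t q n m by (simp add: ennreal_mult[symmetric] ennreal_plus[symmetric] del: ennreal_plus)
  finally have "q \<le> t * (t * n + (1 - t) * m) + (1 - t) * (t * m + (1 - t) * q)"
    using t q n m by (subst (asm) ennreal_le_iff) auto
  then have "t * (2 * (q - m)) \<le> t * (t * (n + q - 2 * m))" by (simp add: algebra_simps)
  then have "2 * (q - m) \<le> t * (n + q - 2 * m)" using t by simp
  also have "\<dots> \<le> t * D" using t by (intro mult_left_mono) (auto simp: D_def)
  also have "\<dots> \<le> q - m" by (rule t(3))
  finally show False using mq by simp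
qed

lemma eff_le_imp_finite: "eff z < \<infinity> \<Longrightarrow> \<Phi> z < \<infinity>"
proof (rule ccontr)
  assume e: "eff z < \<infinity>" and "\<not> \<Phi> z < \<infinity>"
  then have "\<Phi> z = \<infinity>" by simp
  then have "k z w = \<infinity>" for w
    using weight_growthD(4)[OF growth, of w] by (cases "\<Phi> w") (auto simp: energy_kernel_def)
  then have "eff z = \<infinity>" by (simp add: eff_def emeasure_mu space_mu)
  then show False using e by simp
qed

text \<open>The uniform measure on the exceptional set would violate the first variation unless that
  set is null; the cutoffs in \<open>A n\<close> give this measure finite energy. Lebesgue almost
  everywhere is sufficient, since the inequality is later either integrated or extended by
  continuity.\<close>

lemma eff_ge: "AE z in lborel. Q \<mu> \<mu> \<le> eff z"
proof -
  define A where "A n = {z \<in> ball 0 (real n). eff z < Q \<mu> \<mu> \<and> \<Phi> z \<le> ereal (real n)}" for n :: nat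
  have Am [measurable]: "A n \<in> sets borel" for n unfolding A_def by measurable
  have "emeasure lborel (A n) = 0" for n
  proof (rule ccontr)
    assume nz: "emeasure lborel (A n) \<noteq> 0"
    have f: "emeasure lborel (A n) < \<infinity>"
      by (rule emeasure_bounded_finite) (auto intro: bounded_subset[OF bounded_ball[of 0 "real n"]] simp: A_def)
    define \<nu> where "\<nu> = uniform_measure lborel (A n)"
    have \<nu>: "\<nu> \<in> prob_measures" "Q \<nu> \<nu> < \<infinity>"
      using finite_energy_uniform[OF Am nz f, of "real n"] by (auto simp: \<nu>_def A_def)
    have s: "sets \<nu> = sets borel" by (simp add: \<nu>_def)
    have one: "emeasure \<nu> (space \<nu>) = 1"
      using \<nu> by (auto simp: prob_measures_def prob_space.emeasure_space_1)
    have AE: "AE z in \<nu>. z \<in> A n"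
      unfolding \<nu>_def by (rule AE_uniform_measureI) auto
    have "(\<integral>\<^sup>+z. eff z \<partial>\<nu>) < (\<integral>\<^sup>+z. Q \<mu> \<mu> \<partial>\<nu>)"
    proof (rule nn_integral_less)
      show "eff \<in> borel_measurable \<nu>" using eff_meas s by (simp cong: measurable_cong_sets)
      show "AE z in \<nu>. eff z \<le> Q \<mu> \<mu>" using AE by eventually_elim (auto simp: A_def)
      show "(\<integral>\<^sup>+z. eff z \<partial>\<nu>) \<noteq> \<infinity>"
      proof -
        have "(\<integral>\<^sup>+z. eff z \<partial>\<nu>) \<le> (\<integral>\<^sup>+z. Q \<mu> \<mu> \<partial>\<nu>)"
          by (rule nn_integral_mono_AE) (use AE in eventually_elim, auto simp: A_def)
        then show ?thesis using fin one by (auto simp: top_unique)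
      qed
      show "\<not> (AE z in \<nu>. Q \<mu> \<mu> \<le> eff z)"
      proof
        assume "AE z in \<nu>. Q \<mu> \<mu> \<le> eff z"
        then have "AE z in \<nu>. False" using AE by eventually_elim (auto simp: A_def)
        then show False using \<nu>(1) by (auto simp: prob_measures_def prob_space.AE_False)
      qed
    qed simp
    then show False using first_variation[OF \<nu>] by (simp add: mutual_energy_eff one not_le)
  qed
  then have "(\<Union>n. A n) \<in> null_sets lborel" by (intro null_sets_UN) (auto intro: null_setsI)
  moreover have "{z \<in> space lborel. \<not> Q \<mu> \<mu> \<le> eff z} \<subseteq> (\<Union>n. A n)"
  proof clarsimp
    fix z assume "\<not> Q \<mu> \<mu> \<le> eff z"
    then have lt: "eff z < Q \<mu> \<mu>" by simp
    then have "\<Phi> z < \<infinity>" using eff_le_imp_finite fin by (meson less_trans)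
    then obtain r where r: "\<Phi> z = ereal r" using weight_growthD(4)[OF growth, of z] by (cases "\<Phi> z") auto
    obtain n where "max (cmod z) r < real n" using reals_Archimedean2 by blast
    then show "\<exists>n. z \<in> A n" using lt r by (intro exI[of _ n]) (auto simp: A_def)
  qed
  ultimately show ?thesis by (rule AE_I')
qed

text \<open>The first variation for \<mu> conditioned on B, whose energy is at most
  \<open>Q \<mu> \<mu>\<close> divided by the square of the mass of B. As \<mu> is not known to have
  a density, the inequality at Lebesgue almost every point does not yield this one.\<close>

lemma set_eff_ge:
  assumes B [measurable]: "B \<in> sets borel"
  shows "Q \<mu> \<mu> * emeasure \<mu> B \<le> (\<integral>\<^sup>+z. eff z * indicator B z \<partial>\<mu>)"
proof (cases "emeasure \<mu> B = 0")
  case False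
  interpret prob_space \<mu> by (rule prob_mu)
  define \<nu> where "\<nu> = uniform_measure \<mu> B"
  have f: "emeasure \<mu> B \<noteq> \<infinity>" by simp
  have \<nu>: "\<nu> \<in> prob_measures"
    unfolding prob_measures_def \<nu>_def using False f
    by (auto intro!: prob_space_uniform_measure simp: sets_mu)
  have in1: "(\<integral>\<^sup>+w. k z w \<partial>\<nu>) \<le> eff z / emeasure \<mu> B" for z
    unfolding \<nu>_def eff_def
    by (subst nn_integral_uniform_measure) (auto intro!: divide_right_mono_ennreal nn_integral_mono simp: indicator_def)
  have "Q \<nu> \<nu> \<le> (\<integral>\<^sup>+z. eff z / emeasure \<mu> B \<partial>\<nu>)"
    unfolding mutual_energy_def by (intro nn_integral_mono in1)
  also have "\<dots> = (\<integral>\<^sup>+z. eff z / emeasure \<mu> B * indicator B z \<partial>\<mu>) / emeasure \<mu> B"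
    unfolding \<nu>_def by (subst nn_integral_uniform_measure) auto
  also have "\<dots> \<le> (\<integral>\<^sup>+z. eff z / emeasure \<mu> B \<partial>\<mu>) / emeasure \<mu> B"
    by (auto intro!: divide_right_mono_ennreal nn_integral_mono simp: indicator_def)
  also have "\<dots> = Q \<mu> \<mu> / emeasure \<mu> B / emeasure \<mu> B"
    by (subst nn_integral_divide) (auto simp: mutual_energy_eff)
  also have "\<dots> < \<infinity>" using fin False by (auto simp: less_top[symmetric] ennreal_divide_eq_top_iff)
  finally have "Q \<mu> \<mu> \<le> Q \<nu> \<mu>" by (intro first_variation[OF \<nu>])
  also have "Q \<nu> \<mu> = (\<integral>\<^sup>+z. eff z * indicator B z \<partial>\<mu>) / emeasure \<mu> B"
    unfolding mutual_energy_eff \<nu>_def by (subst nn_integral_uniform_measure) auto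
  finally have "Q \<mu> \<mu> * emeasure \<mu> B \<le> (\<integral>\<^sup>+z. eff z * indicator B z \<partial>\<mu>) / emeasure \<mu> B * emeasure \<mu> B"
    by (rule mult_right_mono) simp
  also have "\<dots> = (\<integral>\<^sup>+z. eff z * indicator B z \<partial>\<mu>)"
  proof -
    have "emeasure \<mu> B / emeasure \<mu> B = 1"
      using False by (intro ennreal_divide_self) (auto simp: less_top[symmetric])
    then show ?thesis by (simp add: ennreal_divide_times)
  qed
  finally show ?thesis .
qed simp

text \<open>The mean of \<open>eff\<close> over \<mu> is \<open>Q \<mu> \<mu>\<close>, and by
  \<open>set_eff_ge\<close> no set has a smaller mean. An excess on A could therefore not be
  compensated on its complement.\<close>

lemma eff_le: "AE z in \<mu>. eff z \<le> Q \<mu> \<mu>"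
proof (rule ccontr)
  assume neg: "\<not> (AE z in \<mu>. eff z \<le> Q \<mu> \<mu>)"
  interpret prob_space \<mu> by (rule prob_mu)
  define A where "A = {z. Q \<mu> \<mu> < eff z}"
  have A [measurable]: "A \<in> sets borel" unfolding A_def by measurable
  have q: "Q \<mu> \<mu> * emeasure \<mu> B \<noteq> \<infinity>" for B using fin by (auto simp: ennreal_mult_eq_top_iff)
  have "(\<integral>\<^sup>+z. Q \<mu> \<mu> * indicator A z \<partial>\<mu>) < (\<integral>\<^sup>+z. eff z * indicator A z \<partial>\<mu>)"
  proof (rule nn_integral_less)
    show "(\<integral>\<^sup>+z. Q \<mu> \<mu> * indicator A z \<partial>\<mu>) \<noteq> \<infinity>"
      using q[of A] by (simp add: nn_integral_cmult_indicator)
    show "AE z in \<mu>. Q \<mu> \<mu> * indicator A z \<le> eff z * indicator A z"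
      by (rule AE_I2) (auto simp: A_def indicator_def)
    show "\<not> (AE z in \<mu>. eff z * indicator A z \<le> Q \<mu> \<mu> * indicator A z)"
    proof
      assume "AE z in \<mu>. eff z * indicator A z \<le> Q \<mu> \<mu> * indicator A z"
      then have "AE z in \<mu>. eff z \<le> Q \<mu> \<mu>"
      proof eventually_elim
        case (elim z)
        then show ?case by (cases "z \<in> A") (auto simp: A_def)
      qed
      then show False using neg by simp
    qed
  qed measurable
  then have "Q \<mu> \<mu> * emeasure \<mu> A < (\<integral>\<^sup>+z. eff z * indicator A z \<partial>\<mu>)"
    by (simp add: nn_integral_cmult_indicator)
  moreover have "Q \<mu> \<mu> * emeasure \<mu> (- A) \<le> (\<integral>\<^sup>+z. eff z * indicator (- A) z \<partial>\<mu>)"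
    by (rule set_eff_ge) simp
  ultimately have "Q \<mu> \<mu> * emeasure \<mu> A + Q \<mu> \<mu> * emeasure \<mu> (- A) <
     (\<integral>\<^sup>+z. eff z * indicator A z \<partial>\<mu>) + (\<integral>\<^sup>+z. eff z * indicator (- A) z \<partial>\<mu>)"
    using q[of "-A"] by (intro ennreal_add_less_le_mono) auto
  also have "\<dots> = (\<integral>\<^sup>+z. eff z * indicator A z + eff z * indicator (- A) z \<partial>\<mu>)"
    by (subst nn_integral_add) auto
  also have "\<dots> = (\<integral>\<^sup>+z. eff z \<partial>\<mu>)" by (intro nn_integral_cong) (auto simp: indicator_def)
  also have "\<dots> = Q \<mu> \<mu>" by (simp add: mutual_energy_eff)
  also have "Q \<mu> \<mu> * emeasure \<mu> A + Q \<mu> \<mu> * emeasure \<mu> (- A) = Q \<mu> \<mu> * (emeasure \<mu> A + emeasure \<mu> (- A))"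
    by (simp add: distrib_left)
  also have "emeasure \<mu> A + emeasure \<mu> (- A) = 1"
    using emeasure_mu by (subst plus_emeasure) (auto simp: sets_mu)
  finally show False by simp
qed

end

lemma closed_measure_support: "closed (measure_support \<mu>)"
  unfolding closed_def
proof (rule Topological_Spaces.openI)
  fix x assume "x \<in> - measure_support \<mu>"
  then obtain W where W: "open W" "x \<in> W" "\<not> emeasure \<mu> W > 0"
    by (auto simp: measure_support_def)
  then show "\<exists>T. open T \<and> x \<in> T \<and> T \<subseteq> - measure_support \<mu>"
    by (intro exI[of _ W]) (auto simp: measure_support_def)
qed

lemma emeasure_compl_measure_support:
  fixes \<mu> :: "'a::second_countable_topology measure"
  assumes "sets \<mu> = sets borel"
  shows "- measure_support \<mu> \<in> null_sets \<mu>"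
proof -
  obtain B :: "'a set set" where B: "countable B" "topological_basis B" using ex_countable_basis by blast
  define B0 where "B0 = {b \<in> B. emeasure \<mu> b = 0}"
  have op: "b \<in> sets \<mu>" if "b \<in> B" for b
    using topological_basis_open[OF B(2) that] assms by auto
  have "(\<Union>b\<in>B0. b) \<in> null_sets \<mu>"
    using B(1) op by (intro null_sets_UN') (auto simp: B0_def null_sets_def)
  moreover have "- measure_support \<mu> = (\<Union>b\<in>B0. b)"
  proof (intro equalityI subsetI)
    fix x assume "x \<in> - measure_support \<mu>"
    then obtain W where W: "open W" "x \<in> W" "emeasure \<mu> W = 0"
      by (auto simp: measure_support_def)
    obtain b where b: "b \<in> B" "x \<in> b" "b \<subseteq> W" using topological_basisE[OF B(2) W(1,2)] by blast
    have "emeasure \<mu> b \<le> emeasure \<mu> W" using W assms by (intro emeasure_mono b) auto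
    then show "x \<in> (\<Union>b\<in>B0. b)" using W b by (auto simp: B0_def)
  next
    fix x assume "x \<in> (\<Union>b\<in>B0. b)"
    then obtain b where "b \<in> B" "emeasure \<mu> b = 0" "x \<in> b" by (auto simp: B0_def)
    then show "x \<in> - measure_support \<mu>"
      using topological_basis_open[OF B(2)] by (auto simp: measure_support_def intro!: exI[of _ b])
  qed
  ultimately show ?thesis by simp
qed

lemma ln_sq_diff_le:
  fixes a b :: real
  assumes "0 < a" "0 < b"
  shows "ln (a\<^sup>2) - ln (b\<^sup>2) \<le> 2 * \<bar>a - b\<bar> / b"
proof -
  have "ln (a\<^sup>2) - ln (b\<^sup>2) = 2 * ln (a / b)" using assms by (simp add: ln_realpow ln_div)
  also have "\<dots> \<le> 2 * (a / b - 1)" using assms by (intro mult_left_mono ln_le_minus_one) auto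
  also have "\<dots> = 2 * (a - b) / b" using assms by (simp add: field_simps)
  also have "\<dots> \<le> 2 * \<bar>a - b\<bar> / b" using assms by (intro divide_right_mono mult_left_mono) auto
  finally show ?thesis .
qed

section \<open>The logarithmic potential of the equilibrium measure\<close>

locale regular_equilibrium = equilibrium +
  fixes U :: "complex set" and \<phi> :: "complex \<Rightarrow> real" and S :: "complex set"
  defines "\<phi> \<equiv> \<lambda>z. real_of_ereal (\<Phi> z)" and "S \<equiv> measure_support \<mu>"
  assumes open_U: "open U" and S_sub: "S \<subseteq> U" and fin_U: "\<And>z. z \<in> U \<Longrightarrow> \<Phi> z < \<infinity>"
    and cont_U: "continuous_on U \<phi>"
begin

lemma Phi_U: "z \<in> U \<Longrightarrow> \<Phi> z = ereal (\<phi> z)"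
  using fin_U[of z] weight_growthD(4)[OF growth, of z] by (cases "\<Phi> z") (auto simp: \<phi>_def)

lemma closed_S: "closed S" unfolding S_def by (rule closed_measure_support)

lemma S_meas [measurable]: "S \<in> sets borel" using closed_S by simp

lemma AE_S: "AE z in \<mu>. z \<in> S"
  using emeasure_compl_measure_support[OF sets_mu] by (intro AE_I'[of "- S"]) (auto simp: S_def)

lemma S_nonempty: "S \<noteq> {}"
proof
  assume "S = {}"
  then have "AE z in \<mu>. False" using AE_S by simp
  then show False using prob_space.AE_False[OF prob_mu] by simp
qed

lemma phi_meas [measurable]: "\<phi> \<in> borel_measurable borel"
  unfolding \<phi>_def by measurable

text \<open>The kernel is infinite on the diagonal, so an atom alone would make the energy infinite.
  It follows that the convention \<open>ln 0 = 0\<close> does not affect integrals against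
  \<mu>.\<close>

lemma no_atom: "emeasure \<mu> {x} = 0"
proof (rule ccontr)
  assume nz: "emeasure \<mu> {x} \<noteq> 0"
  have "\<infinity> * emeasure \<mu> {x} = (\<integral>\<^sup>+z. \<infinity> * indicator {x} z \<partial>\<mu>)"
    by (subst nn_integral_cmult_indicator) (auto simp: sets_mu)
  also have "\<dots> \<le> (\<integral>\<^sup>+z. eff z \<partial>\<mu>)"
  proof (rule nn_integral_mono)
    fix z
    have "\<infinity> = \<infinity> * emeasure \<mu> {x}" using nz by (simp add: ennreal_top_mult)
    also have "\<dots> = (\<integral>\<^sup>+w. \<infinity> * indicator {x} w \<partial>\<mu>)"
      by (subst nn_integral_cmult_indicator) (auto simp: sets_mu)
    also have "\<dots> \<le> (\<integral>\<^sup>+w. k x w \<partial>\<mu>)"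
      by (rule nn_integral_mono) (auto simp: indicator_def energy_kernel_def)
    finally have "eff x = \<infinity>" by (simp add: eff_def top_unique)
    then show "\<infinity> * indicator {x} z \<le> eff z" by (auto simp: indicator_def)
  qed
  also have "\<dots> = Q \<mu> \<mu>" by (simp add: mutual_energy_eff)
  finally show False using nz fin by (auto simp: ennreal_top_mult top_unique)
qed

lemma AE_neq: "AE z in \<mu>. z \<noteq> x"
  by (rule AE_I'[of "{x}"]) (auto simp: null_sets_def sets_mu no_atom)

lemma kernel_real:
  assumes "z \<noteq> w" "\<Phi> z = ereal r" "\<Phi> w = ereal s"
  shows "k z w = ennreal (r + s + 2 * C - ln ((cmod (z - w))\<^sup>2))"
  using assms by (simp add: energy_kernel_def algebra_simps)

text \<open>By Fatou's lemma \<open>eff\<close> is lower semicontinuous along S, and every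
  neighbourhood of a point of S has positive mass. The bound at \<mu>-almost every point thus
  extends to all of S.\<close>

lemma eff_le_S:
  assumes x: "x \<in> S"
  shows "eff x \<le> Q \<mu> \<mu>"
proof -
  have ex: "\<exists>y. y \<in> ball x (1 / real (Suc n)) \<and> y \<in> S \<and> eff y \<le> Q \<mu> \<mu>" for n
  proof (rule ccontr)
    assume neg: "\<not> ?thesis"
    have "AE y in \<mu>. y \<notin> ball x (1 / real (Suc n))"
      using AE_S eff_le by eventually_elim (use neg in auto)
    then have "emeasure \<mu> (ball x (1 / real (Suc n))) = 0"
      by (subst (asm) AE_iff_measurable[of "ball x (1 / real (Suc n))"]) (auto simp: sets_mu space_mu)
    moreover have "emeasure \<mu> (ball x (1 / real (Suc n))) > 0"
      using x unfolding S_def measure_support_def by auto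
    ultimately show False by simp
  qed
  define y where "y n = (SOME y. y \<in> ball x (1 / real (Suc n)) \<and> y \<in> S \<and> eff y \<le> Q \<mu> \<mu>)" for n
  have y: "\<And>n. y n \<in> ball x (1 / real (Suc n))" "\<And>n. y n \<in> S" "\<And>n. eff (y n) \<le> Q \<mu> \<mu>"
    using someI_ex[OF ex] by (simp_all add: y_def)
  have lim: "y \<longlonglongrightarrow> x"
  proof (rule metric_LIMSEQ_I)
    fix e :: real assume "0 < e"
    then obtain m where m: "1 / real (Suc m) < e" using nat_approx_posE by blast
    show "\<exists>no. \<forall>n\<ge>no. dist (y n) x < e"
    proof (intro exI allI impI)
      fix n assume "m \<le> n"
      then have "1 / real (Suc n) \<le> 1 / real (Suc m)" by (simp add: frac_le)
      then show "dist (y n) x < e" using y(1)[of n] m by (simp add: dist_commute)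
    qed
  qed
  have P: "\<Phi> z = ereal (\<phi> z)" if "z \<in> S" for z using that S_sub Phi_U by auto
  have phl: "(\<lambda>n. \<phi> (y n)) \<longlonglongrightarrow> \<phi> x"
    using cont_U x S_sub y(2) open_U lim
    by (intro isCont_tendsto_compose[of x \<phi>]) (auto simp: continuous_on_eq_continuous_at)
  have "eff x = (\<integral>\<^sup>+w. liminf (\<lambda>n. k (y n) w) \<partial>\<mu>)"
    unfolding eff_def
  proof (rule nn_integral_cong_AE)
    show "AE w in \<mu>. k x w = liminf (\<lambda>n. k (y n) w)"
      using AE_S AE_neq[of x]
    proof eventually_elim
      case (elim w)
      have ne: "\<forall>\<^sub>F n in sequentially. y n \<noteq> w"
        using lim elim by (intro tendsto_imp_eventually_ne) auto
      have "(\<lambda>n. ennreal (\<phi> (y n) + \<phi> w + 2 * C - ln ((cmod (y n - w))\<^sup>2)))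
         \<longlonglongrightarrow> ennreal (\<phi> x + \<phi> w + 2 * C - ln ((cmod (x - w))\<^sup>2))"
        by (intro tendsto_intros phl lim tendsto_ennrealI) (use elim in auto)
      moreover have "\<forall>\<^sub>F n in sequentially. ennreal (\<phi> (y n) + \<phi> w + 2 * C - ln ((cmod (y n - w))\<^sup>2)) = k (y n) w"
        using ne
      proof eventually_elim
        case (elim n)
        show ?case by (rule kernel_real[OF elim P[OF y(2)] P[OF \<open>w \<in> S\<close>], symmetric])
      qed
      moreover have "ennreal (\<phi> x + \<phi> w + 2 * C - ln ((cmod (x - w))\<^sup>2)) = k x w"
        using elim by (intro kernel_real[symmetric] P x) auto
      ultimately have "(\<lambda>n. k (y n) w) \<longlonglongrightarrow> k x w"
        by (simp add: tendsto_cong)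
      then show ?case by (simp add: lim_imp_Liminf)
    qed
  qed
  also have "\<dots> \<le> liminf (\<lambda>n. \<integral>\<^sup>+w. k (y n) w \<partial>\<mu>)"
    by (rule nn_integral_liminf) simp
  also have "\<dots> \<le> Q \<mu> \<mu>"
    using y(3) by (intro Liminf_le) (auto simp: eff_def)
  finally show ?thesis .
qed

definition q where "q = enn2real (Q \<mu> \<mu>)"

lemma Q_eq: "Q \<mu> \<mu> = ennreal q" and q_nonneg: "0 \<le> q"
  using fin by (auto simp: q_def less_top)

text \<open>On S the effective potential is at most \<open>q\<close>, while the growth of \<Phi>
  makes it at least \<open>\<epsilon> * ln (1 + |x|^2)\<close>.\<close>

lemma bounded_S: "bounded S"
proof (rule boundedI)
  fix x assume x: "x \<in> S"
  have "ennreal (\<epsilon> * ln (1 + (cmod x)\<^sup>2)) = (\<integral>\<^sup>+w. ennreal (\<epsilon> * ln (1 + (cmod x)\<^sup>2)) \<partial>\<mu>)"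
    by (simp add: emeasure_mu space_mu)
  also have "\<dots> \<le> eff x" unfolding eff_def
    by (intro nn_integral_mono energy_kernel_lower(2)[OF growth])
  also have "\<dots> \<le> ennreal q" using eff_le_S[OF x] by (simp add: Q_eq)
  finally have "ln (1 + (cmod x)\<^sup>2) \<le> q / \<epsilon>"
    using q_nonneg eps_pos by (simp add: field_simps)
  then have "exp (ln (1 + (cmod x)\<^sup>2)) \<le> exp (q / \<epsilon>)" by simp
  then have "(cmod x)\<^sup>2 \<le> exp (q / \<epsilon>)" by (subst (asm) exp_ln) (auto intro: add_pos_nonneg)
  then show "cmod x \<le> sqrt (exp (q / \<epsilon>))" by (simp add: real_le_rsqrt)
qed

lemma compact_S: "compact S"
  using bounded_S closed_S by (simp add: compact_eq_bounded_closed)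

lemma finite_measure_mu: "finite_measure \<mu>"
  using prob_mu by (simp add: prob_space_def)

lemma integrable_bounded_S:
  assumes "f \<in> borel_measurable borel" "\<And>x. x \<in> S \<Longrightarrow> \<bar>f x\<bar> \<le> B"
  shows "integrable \<mu> (f :: complex \<Rightarrow> real)"
proof -
  interpret finite_measure \<mu> by (rule finite_measure_mu)
  show ?thesis
    by (rule integrable_const_bound[of _ B]) (use AE_S assms in \<open>auto simp: sets_mu cong: measurable_cong_sets\<close>)
qed

lemma integrable_phi: "integrable \<mu> \<phi>"
proof -
  have "compact (\<phi> ` S)"
    by (rule compact_continuous_image[OF continuous_on_subset[OF cont_U S_sub] compact_S])
  then obtain B where "\<And>x. x \<in> S \<Longrightarrow> \<bar>\<phi> x\<bar> \<le> B"
    unfolding compact_eq_bounded_closed bounded_iff by auto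
  then show ?thesis by (intro integrable_bounded_S[of _ B]) auto
qed

text \<open>Taken with a plus sign and with the squared distance, hence subharmonic and of order
  \<open>ln (|z|^2)\<close> at infinity.\<close>

definition pot where "pot z = (\<integral>w. ln ((cmod (z - w))\<^sup>2) \<partial>\<mu>)"
definition phi_mean where "phi_mean = (\<integral>w. \<phi> w \<partial>\<mu>)"
text \<open>The constant in the Euler-Lagrange relations, a modified Robin constant: it makes
  \<open>eff z = \<Phi> z - pot z - b + q\<close>, so that \<open>pot + b\<close> lies above \<phi>
  on S and almost everywhere below \<Phi> off S.\<close>

definition b where "b = q - phi_mean - 2 * C"

lemma prob_mu_measure: "measure \<mu> (space \<mu>) = 1"
  by (rule prob_space.prob_space[OF prob_mu])

lemma kernel_nonneg:
  assumes "\<Phi> z = ereal r" "w \<in> S"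
  shows "0 \<le> r + \<phi> w + 2 * C - ln ((cmod (z - w))\<^sup>2)"
proof -
  have 1: "ln (1 + (cmod z)\<^sup>2) - C \<le> r" using weight_growthD(2)[OF growth, of z] assms by simp
  have 2: "ln (1 + (cmod w)\<^sup>2) - C \<le> \<phi> w" using weight_growthD(2)[OF growth, of w] assms Phi_U S_sub by fastforce
  show ?thesis using 1 2 ln_cmod_diff_le[of z w] by linarith
qed

lemma eff_nn_integral:
  assumes z: "\<Phi> z = ereal r"
  shows "eff z = (\<integral>\<^sup>+w. ennreal (r + \<phi> w + 2 * C - ln ((cmod (z - w))\<^sup>2)) \<partial>\<mu>)"
  unfolding eff_def
proof (rule nn_integral_cong_AE)
  show "AE w in \<mu>. k z w = ennreal (r + \<phi> w + 2 * C - ln ((cmod (z - w))\<^sup>2))"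
    using AE_S AE_neq[of z]
  proof eventually_elim
    case (elim w)
    then show ?case using S_sub by (intro kernel_real[OF _ z Phi_U]) auto
  qed
qed

lemma eff_eq:
  assumes z: "\<Phi> z = ereal r" and i: "integrable \<mu> (\<lambda>w. ln ((cmod (z - w))\<^sup>2))"
  shows "eff z = ennreal (r - pot z - b + q)" and "0 \<le> r - pot z - b + q"
proof -
  have i2: "integrable \<mu> (\<lambda>w. r + \<phi> w + 2 * C - ln ((cmod (z - w))\<^sup>2))"
    using i integrable_phi finite_measure.integrable_const[OF finite_measure_mu]
    by (intro Bochner_Integration.integrable_diff Bochner_Integration.integrable_add) auto
  have AE: "AE w in \<mu>. 0 \<le> r + \<phi> w + 2 * C - ln ((cmod (z - w))\<^sup>2)"
    using AE_S by eventually_elim (rule kernel_nonneg[OF z])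
  have eq: "(\<integral>w. r + \<phi> w + 2 * C - ln ((cmod (z - w))\<^sup>2) \<partial>\<mu>) = r - pot z - b + q"
  proof -
    have c: "integrable \<mu> (\<lambda>w. d)" for d :: real
      by (rule finite_measure.integrable_const[OF finite_measure_mu])
    have "(\<integral>w. r + \<phi> w + 2 * C - ln ((cmod (z - w))\<^sup>2) \<partial>\<mu>) =
        (\<integral>w. (r + 2 * C) + \<phi> w \<partial>\<mu>) - pot z"
      unfolding pot_def
      by (subst Bochner_Integration.integral_diff[symmetric, OF Bochner_Integration.integrable_add[OF c integrable_phi] i])
        (simp add: algebra_simps)
    also have "(\<integral>w. (r + 2 * C) + \<phi> w \<partial>\<mu>) = (r + 2 * C) + phi_mean"
      unfolding phi_mean_def
      by (subst Bochner_Integration.integral_add[OF c integrable_phi]) (simp add: prob_mu_measure)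
    finally show ?thesis by (simp add: b_def)
  qed
  show "eff z = ennreal (r - pot z - b + q)"
    unfolding eff_nn_integral[OF z] nn_integral_eq_integral[OF i2 AE] eq ..
  show "0 \<le> r - pot z - b + q"
    using integral_nonneg_AE[OF AE] eq by simp
qed

text \<open>At a point of S the singularity is not kept away by a positive distance; integrability
  comes from the finite value of \<open>eff\<close> there.\<close>

lemma integrable_S:
  assumes x: "x \<in> S"
  shows "integrable \<mu> (\<lambda>w. ln ((cmod (x - w))\<^sup>2))"
proof -
  have P: "\<Phi> x = ereal (\<phi> x)" using x S_sub Phi_U by auto
  define f where "f w = \<phi> x + \<phi> w + 2 * C - ln ((cmod (x - w))\<^sup>2)" for w
  have [measurable]: "f \<in> borel_measurable borel" unfolding f_def by measurable
  have "(\<integral>\<^sup>+w. ennreal (norm (f w)) \<partial>\<mu>) = (\<integral>\<^sup>+w. ennreal (f w) \<partial>\<mu>)"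
    by (intro nn_integral_cong_AE, use AE_S in eventually_elim)
      (use kernel_nonneg[OF P] in \<open>simp add: f_def\<close>)
  also have "\<dots> = eff x" unfolding eff_nn_integral[OF P] f_def ..
  also have "\<dots> < \<infinity>" using eff_le_S[OF x] fin by (rule le_less_trans)
  finally have "integrable \<mu> f" by (intro integrableI_bounded) auto
  then have "integrable \<mu> (\<lambda>w. \<phi> x + \<phi> w + 2 * C - f w)"
    using integrable_phi finite_measure.integrable_const[OF finite_measure_mu]
    by (intro Bochner_Integration.integrable_diff Bochner_Integration.integrable_add) auto
  then show ?thesis by (simp add: f_def)
qed

lemma phi_le_pot:
  assumes x: "x \<in> S"
  shows "\<phi> x \<le> pot x + b"
proof -
  have P: "\<Phi> x = ereal (\<phi> x)" using x S_sub Phi_U by auto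
  have "ennreal (\<phi> x - pot x - b + q) \<le> ennreal q"
    using eff_le_S[OF x] eff_eq(1)[OF P integrable_S[OF x]] by (simp add: Q_eq)
  then show ?thesis using q_nonneg by (simp add: ennreal_le_iff)
qed

lemma dist_S_pos: "z \<notin> S \<Longrightarrow> 0 < infdist z S"
  using infdist_pos_not_in_closed[OF closed_S S_nonempty] by auto

lemma integrable_off_S:
  assumes z: "z \<notin> S"
  shows "integrable \<mu> (\<lambda>w. ln ((cmod (z - w))\<^sup>2))"
proof -
  define d where "d = infdist z S"
  have d: "0 < d" using dist_S_pos[OF z] by (simp add: d_def)
  obtain R where R: "\<And>x. x \<in> S \<Longrightarrow> cmod x \<le> R" using bounded_S bounded_iff by blast
  obtain x0 where "x0 \<in> S" using S_nonempty by auto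
  then have R0: "0 \<le> R" using R[of x0] by (meson norm_ge_zero order_trans)
  show ?thesis
  proof (rule integrable_bounded_S)
    fix w assume w: "w \<in> S"
    have 1: "d \<le> cmod (z - w)" using infdist_le[OF w, of z] by (simp add: d_def dist_norm)
    have 2: "cmod (z - w) \<le> cmod z + R" using norm_triangle_ineq4[of z w] R[OF w] by linarith
    have "ln (d\<^sup>2) \<le> ln ((cmod (z - w))\<^sup>2)" using 1 d by (intro ln_mono power_mono) auto
    moreover have "ln ((cmod (z - w))\<^sup>2) \<le> ln ((cmod z + R)\<^sup>2)" using 1 2 d by (intro ln_mono power_mono) auto
    ultimately show "\<bar>ln ((cmod (z - w))\<^sup>2)\<bar> \<le> \<bar>ln (d\<^sup>2)\<bar> + \<bar>ln ((cmod z + R)\<^sup>2)\<bar>" by linarith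
  qed measurable
qed

lemma pot_le_phi_AE: "AE z in lborel. z \<notin> S \<longrightarrow> ereal (pot z + b) \<le> \<Phi> z"
  using eff_ge
proof eventually_elim
  case (elim z)
  show ?case
  proof
    assume z: "z \<notin> S"
    show "ereal (pot z + b) \<le> \<Phi> z"
    proof (cases "\<Phi> z")
      case (real r)
      have "ennreal q \<le> ennreal (r - pot z - b + q)"
        using elim eff_eq(1)[OF real integrable_off_S[OF z]] by (simp add: Q_eq)
      then have "q \<le> r - pot z - b + q"
        using eff_eq(2)[OF real integrable_off_S[OF z]] by (simp add: ennreal_le_iff)
      then show ?thesis using real by simp
    qed (use weight_growthD(4)[OF growth, of z] in auto)
  qed
qed

lemma pot_diff_le:
  assumes z: "z \<notin> S" and z': "z' \<notin> S"
  shows "pot z' - pot z \<le> 2 * cmod (z' - z) / infdist z S"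
proof -
  define d where "d = infdist z S"
  have d: "0 < d" using dist_S_pos[OF z] by (simp add: d_def)
  interpret finite_measure \<mu> by (rule finite_measure_mu)
  have "pot z' - pot z = (\<integral>w. ln ((cmod (z' - w))\<^sup>2) - ln ((cmod (z - w))\<^sup>2) \<partial>\<mu>)"
    unfolding pot_def using integrable_off_S z z' by simp
  also have "\<dots> \<le> (\<integral>w. 2 * cmod (z' - z) / d \<partial>\<mu>)"
  proof (rule integral_mono_AE)
    show "AE w in \<mu>. ln ((cmod (z' - w))\<^sup>2) - ln ((cmod (z - w))\<^sup>2) \<le> 2 * cmod (z' - z) / d"
      using AE_S
    proof eventually_elim
      case (elim w)
      have 1: "d \<le> cmod (z - w)" using infdist_le[OF elim, of z] by (simp add: d_def dist_norm)
      have "ln ((cmod (z' - w))\<^sup>2) - ln ((cmod (z - w))\<^sup>2) \<le> 2 * \<bar>cmod (z' - w) - cmod (z - w)\<bar> / cmod (z - w)"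
        using z z' elim by (intro ln_sq_diff_le) auto
      also have "\<dots> \<le> 2 * cmod (z' - z) / cmod (z - w)"
        using norm_triangle_ineq3[of "z' - w" "z - w"] by (intro divide_right_mono) auto
      also have "\<dots> \<le> 2 * cmod (z' - z) / d" using 1 d by (intro divide_left_mono mult_pos_pos) auto
      finally show ?case .
    qed
  qed (use integrable_off_S z z' in auto)
  also have "\<dots> = 2 * cmod (z' - z) / d" using prob_mu_measure by simp
  finally show ?thesis by (simp add: d_def)
qed

lemma continuous_on_pot: "continuous_on (- S) pot"
proof -
  have "isCont pot z" if z: "z \<notin> S" for z
  proof -
    have op: "open (- S)" using closed_S by auto
    have ev: "\<forall>\<^sub>F z' in at z. z' \<notin> S"
      using eventually_at_in_open'[OF op, of z] z by auto
    have d: "((\<lambda>z'. infdist z' S) \<longlongrightarrow> infdist z S) (at z)"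
      by (intro tendsto_infdist tendsto_ident_at)
    have "((\<lambda>z'. pot z' - pot z) \<longlongrightarrow> 0) (at z)"
    proof (rule tendsto_sandwich)
      show "\<forall>\<^sub>F z' in at z. pot z' - pot z \<le> 2 * cmod (z' - z) / infdist z S"
        using ev by eventually_elim (rule pot_diff_le[OF z])
      \<comment> \<open>The same estimate with z and z' exchanged. Its constant involves the
        distance of the moving point z' from S, which is why the limit of
        \<open>infdist z' S\<close> is needed.\<close>
      show "\<forall>\<^sub>F z' in at z. - (2 * cmod (z - z') / infdist z' S) \<le> pot z' - pot z"
        using ev by eventually_elim (use pot_diff_le[OF _ z] in \<open>simp add: minus_le_iff\<close>)
      show "((\<lambda>z'. 2 * cmod (z' - z) / infdist z S) \<longlongrightarrow> 0) (at z)"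
      proof -
        have "((\<lambda>z'. 2 * cmod (z' - z) / infdist z S) \<longlongrightarrow> 2 * cmod (z - z) / infdist z S) (at z)"
          by (intro tendsto_intros) (use dist_S_pos[OF z] in linarith)
        then show ?thesis by simp
      qed
      show "((\<lambda>z'. - (2 * cmod (z - z') / infdist z' S)) \<longlongrightarrow> 0) (at z)"
      proof -
        have "((\<lambda>z'. - (2 * cmod (z - z') / infdist z' S)) \<longlongrightarrow> - (2 * cmod (z - z) / infdist z S)) (at z)"
          by (intro tendsto_intros d) (use dist_S_pos[OF z] in linarith)
        then show ?thesis by simp
      qed
    qed
    then show ?thesis unfolding isCont_def by (simp add: LIM_zero_iff)
  qed
  then show ?thesis by (simp add: continuous_at_imp_continuous_on)
qed

text \<open>Replacing \<open>w\<close> by its nearest point \<open>y\<close> of \<open>S\<close> at most doubles distances to points of \<open>S\<close>;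
  together with \<open>pot y + b \<ge> \<phi> y\<close> this controls the potential near \<open>S\<close> from below.\<close>

lemma pot_liminf:
  assumes x: "x \<in> S" and w: "\<And>n. w n \<notin> S" and lim: "w \<longlonglongrightarrow> x" and e: "0 < e"
  shows "\<forall>\<^sub>F n in sequentially. \<phi> x - e < pot (w n) + b"
proof -
  interpret finite_measure \<mu> by (rule finite_measure_mu)
  have "\<exists>y\<in>S. infdist (w n) S = dist (w n) y" for n
    using infdist_attains_inf[OF closed_S S_nonempty, of "w n"] by metis
  then obtain y where y: "\<And>n. y n \<in> S" "\<And>n. infdist (w n) S = dist (w n) (y n)" by (metis (no_types))
  have near: "dist (w n) (y n) \<le> dist (w n) s" if "s \<in> S" for n s
    using infdist_le[OF that, of "w n"] y(2)[of n] by simp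
  have wx: "(\<lambda>n. dist (w n) x) \<longlonglongrightarrow> 0" using lim by (rule iffD1[OF tendsto_dist_iff])
  have limy: "y \<longlonglongrightarrow> x"
  proof -
    have "(\<lambda>n. dist (y n) x) \<longlonglongrightarrow> 0"
    proof (rule tendsto_sandwich[of "\<lambda>_. 0" _ _ "\<lambda>n. 2 * dist (w n) x"])
      show "\<forall>\<^sub>F n in sequentially. dist (y n) x \<le> 2 * dist (w n) x"
      proof (intro always_eventually allI)
        fix n
        show "dist (y n) x \<le> 2 * dist (w n) x"
          using near[OF x, of n] dist_triangle[of "y n" x "w n"] by (simp add: dist_commute)
      qed
    qed (auto intro!: tendsto_eq_intros wx)
    then show ?thesis by (rule iffD2[OF tendsto_dist_iff])
  qed
  \<comment> \<open>Only the loss in passing from \<open>y n\<close> to \<open>w n\<close> is kept.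
    The two logarithms are not uniformly bounded, but the loss is at most \<open>ln 4\<close> by the
    nearest-point property, so dominated convergence applies.\<close>
  define g where "g n s = (if s = y n \<or> s \<notin> S then 0 else min 0 (ln ((cmod (w n - s))\<^sup>2) - ln ((cmod (y n - s))\<^sup>2)))" for n s
  have [measurable]: "g n \<in> borel_measurable borel" for n
    unfolding g_def[abs_def] by measurable
  have gb: "\<bar>g n s\<bar> \<le> ln 4" for n s
  proof (cases "s = y n \<or> s \<notin> S")
    case False
    have ws: "0 < cmod (w n - s)" using w[of n] False by auto
    have "cmod (y n - s) \<le> 2 * cmod (w n - s)"
      using near[of s n] False dist_triangle[of "y n" s "w n"] by (simp add: dist_norm norm_minus_commute)
    then have "(cmod (y n - s))\<^sup>2 \<le> (2 * cmod (w n - s))\<^sup>2" by (intro power_mono) auto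
    then have "ln ((cmod (y n - s))\<^sup>2) \<le> ln (4 * (cmod (w n - s))\<^sup>2)"
      using False by (intro ln_mono) auto
    also have "\<dots> = ln 4 + ln ((cmod (w n - s))\<^sup>2)" using ws by (subst ln_mult_pos) auto
    finally show ?thesis using False by (auto simp: g_def min_def)
  qed (simp add: g_def)
  have ig: "integrable \<mu> (g n)" for n
    by (rule integrable_bounded_S[of _ "ln 4"]) (auto simp: gb)
  have lim0: "(\<lambda>n. \<integral>s. g n s \<partial>\<mu>) \<longlonglongrightarrow> (\<integral>s. 0 \<partial>\<mu>)"
  proof (rule integral_dominated_convergence[where w = "\<lambda>_. ln 4"])
    show "AE s in \<mu>. (\<lambda>n. g n s) \<longlonglongrightarrow> 0"
      using AE_neq[of x] AE_S
    proof eventually_elim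
      case (elim s)
      have "(\<lambda>n. min 0 (ln ((cmod (w n - s))\<^sup>2) - ln ((cmod (y n - s))\<^sup>2))) \<longlonglongrightarrow>
         min 0 (ln ((cmod (x - s))\<^sup>2) - ln ((cmod (x - s))\<^sup>2))"
        using elim by (intro tendsto_intros lim limy) auto
      moreover have "\<forall>\<^sub>F n in sequentially. y n \<noteq> s"
        using limy elim by (intro tendsto_imp_eventually_ne) auto
      then have "\<forall>\<^sub>F n in sequentially. min 0 (ln ((cmod (w n - s))\<^sup>2) - ln ((cmod (y n - s))\<^sup>2)) = g n s"
        by eventually_elim (use elim in \<open>auto simp: g_def\<close>)
      ultimately show ?case by (simp add: tendsto_cong)
    qed
  qed (auto simp: gb)
  have lower: "pot (y n) + (\<integral>s. g n s \<partial>\<mu>) \<le> pot (w n)" for n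
  proof -
    have "pot (y n) + (\<integral>s. g n s \<partial>\<mu>) = (\<integral>s. ln ((cmod (y n - s))\<^sup>2) + g n s \<partial>\<mu>)"
      unfolding pot_def using integrable_S[OF y(1)] ig by simp
    also have "\<dots> \<le> pot (w n)"
      unfolding pot_def
    proof (rule integral_mono_AE)
      show "AE s in \<mu>. ln ((cmod (y n - s))\<^sup>2) + g n s \<le> ln ((cmod (w n - s))\<^sup>2)"
        using AE_neq[of "y n"] AE_S by eventually_elim (auto simp: g_def)
    qed (use integrable_S[OF y(1)] ig integrable_off_S[OF w] in auto)
    finally show ?thesis .
  qed
  have phl: "(\<lambda>n. \<phi> (y n)) \<longlonglongrightarrow> \<phi> x"
    using cont_U x S_sub open_U limy
    by (intro isCont_tendsto_compose[of x \<phi>]) (auto simp: continuous_on_eq_continuous_at)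
  have "(\<lambda>n. \<phi> (y n) + (\<integral>s. g n s \<partial>\<mu>)) \<longlonglongrightarrow> \<phi> x + 0"
    using lim0 by (intro tendsto_add phl) simp
  then have "\<forall>\<^sub>F n in sequentially. \<phi> x - e < \<phi> (y n) + (\<integral>s. g n s \<partial>\<mu>)"
    using e by (intro order_tendstoD(1)) auto
  then show ?thesis
  proof eventually_elim
    case (elim n)
    then show ?case using lower[of n] phi_le_pot[OF y(1)[of n]] by linarith
  qed
qed

end

section \<open>The domination principle\<close>

definition four_point_sum :: "(complex \<Rightarrow> real) \<Rightarrow> complex \<Rightarrow> real \<Rightarrow> real" where
  "four_point_sum f w r = f (w + of_real r) + f (w - of_real r) + f (w + \<i> * of_real r) + f (w - \<i> * of_real r)"

lemma four_point_product:
  "(x + r) * (x - r) * (x + \<i> * r) * (x - \<i> * r) = x ^ 4 - r ^ 4" for x r :: complex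
proof -
  have "(x + r) * (x - r) * ((x + \<i> * r) * (x - \<i> * r)) = (x\<^sup>2 - r\<^sup>2) * (x\<^sup>2 + r\<^sup>2)"
    by (simp add: algebra_simps power2_eq_square)
  also have "\<dots> = x ^ 4 - r ^ 4" by (simp add: algebra_simps power2_eq_square power4_eq_xxxx)
  finally show ?thesis by (simp add: mult.assoc)
qed

text \<open>The product of \<open>x - r \<i>\<^sup>j\<close> over \<open>j < 4\<close> is \<open>x\<^sup>4 - r\<^sup>4\<close>, so the logarithm is harmonic up to an
  error of order \<open>r\<^sup>4\<close>. This replaces mean values over circles.\<close>

lemma four_point_ln:
  assumes r: "0 \<le> r" "r \<le> cmod x / 2" and x: "x \<noteq> 0"
  shows "\<bar>four_point_sum (\<lambda>w. ln ((cmod w)\<^sup>2)) x r - 4 * ln ((cmod x)\<^sup>2)\<bar> \<le> 4 * (r / cmod x) ^ 4"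
proof -
  define t where "t = (r / cmod x) ^ 4"
  have xp: "0 < cmod x" using x by simp
  have "r / cmod x \<le> 1/2" using r xp by (simp add: field_simps)
  then have "(r / cmod x) ^ 4 \<le> (1/2) ^ 4" using r by (intro power_mono) auto
  then have "t \<le> 1/16" by (simp add: t_def power_divide)
  then have t: "0 \<le> t" "t \<le> 1/2" using r by (auto simp: t_def)
  have lt: "r < cmod x" using r xp by linarith
  have ne: "x + of_real r \<noteq> 0" "x - of_real r \<noteq> 0" "x + \<i> * of_real r \<noteq> 0" "x - \<i> * of_real r \<noteq> 0"
  proof -
    have "cmod x \<noteq> r" using lt by simp
    moreover have "cmod (of_real r) = r" "cmod (\<i> * of_real r) = r" using r by (simp_all add: norm_mult)
    ultimately show "x + of_real r \<noteq> 0" "x - of_real r \<noteq> 0" "x + \<i> * of_real r \<noteq> 0" "x - \<i> * of_real r \<noteq> 0"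
      by (metis add_eq_0_iff norm_minus_cancel, metis right_minus_eq, metis add_eq_0_iff norm_minus_cancel, metis right_minus_eq)
  qed
  define X where "X = cmod (x ^ 4 - of_real r ^ 4)"
  have "four_point_sum (\<lambda>w. ln ((cmod w)\<^sup>2)) x r =
     2 * ln (cmod (x + of_real r) * cmod (x - of_real r) * cmod (x + \<i> * of_real r) * cmod (x - \<i> * of_real r))"
    using ne by (simp add: four_point_sum_def ln_realpow ln_mult_pos)
  also have "\<dots> = 2 * ln X"
    unfolding X_def four_point_product[of x "of_real r", symmetric] by (simp add: norm_mult)
  finally have eq: "four_point_sum (\<lambda>w. ln ((cmod w)\<^sup>2)) x r = 2 * ln X" .
  have n4: "cmod (x ^ 4) = cmod x ^ 4" "cmod (of_real r ^ 4) = r ^ 4" using r by (simp_all add: norm_power)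
  have tx: "r ^ 4 = t * cmod x ^ 4" using xp by (simp add: t_def power_divide)
  have up: "X \<le> cmod x ^ 4 * (1 + t)"
    unfolding X_def using norm_triangle_ineq4[of "x ^ 4" "of_real r ^ 4"] n4 tx by (simp add: algebra_simps)
  have lo: "cmod x ^ 4 * (1 - t) \<le> X"
    unfolding X_def using norm_triangle_ineq2[of "x ^ 4" "of_real r ^ 4"] n4 tx by (simp add: algebra_simps)
  have x4: "0 < cmod x ^ 4" using xp by simp
  have "0 < cmod x ^ 4 * (1 - t)" using x4 t by (intro mult_pos_pos) auto
  then have Xp: "0 < X" using lo by linarith
  have "ln X \<le> ln (cmod x ^ 4 * (1 + t))" using up Xp by (intro ln_mono) auto
  also have "\<dots> = 4 * ln (cmod x) + ln (1 + t)" using x4 t xp by (subst ln_mult_pos) (auto simp: ln_realpow)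
  also have "ln (1 + t) \<le> t" by (rule ln_add_one_self_le_self) (use t in auto)
  finally have u: "ln X \<le> 4 * ln (cmod x) + t" by simp
  have "-(2 * t) \<le> - t - 2 * t\<^sup>2" using t mult_left_mono[of t "1/2" t] by (simp add: power2_eq_square)
  also have "\<dots> \<le> ln (1 - t)" by (rule ln_one_minus_pos_lower_bound) (use t in auto)
  finally have "4 * ln (cmod x) - 2 * t \<le> 4 * ln (cmod x) + ln (1 - t)" by simp
  also have "\<dots> = ln (cmod x ^ 4 * (1 - t))" using x4 t xp by (subst ln_mult_pos) (auto simp: ln_realpow)
  also have "\<dots> \<le> ln X" using lo x4 t by (intro ln_mono mult_pos_pos) auto
  finally have l: "4 * ln (cmod x) - 2 * t \<le> ln X" .
  show ?thesis unfolding eq using u l xp t by (simp add: ln_realpow t_def[symmetric])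
qed

lemma four_point_cmod: "four_point_sum (\<lambda>w. (cmod w)\<^sup>2) w r = 4 * (cmod w)\<^sup>2 + 4 * r\<^sup>2"
  unfolding four_point_sum_def cmod_power2 by (simp add: power2_eq_square algebra_simps)

lemma four_point_mono:
  assumes "\<And>v. cmod (v - w) = \<bar>r\<bar> \<Longrightarrow> f v \<le> g v"
  shows "four_point_sum f w r \<le> four_point_sum g w r"
  unfolding four_point_sum_def
  by (intro add_mono assms) (auto simp: norm_mult)

lemma four_point_const: "four_point_sum (\<lambda>_. c) w r = 4 * c"
  by (simp add: four_point_sum_def)

text \<open>A maximum with a constant keeps the approximate submean inequality, and this is what
  admits clipped factors in the domination principle. The distance c matters only while the factor
  is not clipped; a clipped factor equals d at w and is at least d elsewhere.\<close>

lemma four_point_ln_max: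
  assumes c: "0 < c" "0 \<le> r" "r \<le> c / 2" and d: "0 \<le> d"
    and ca: "d \<le> (cmod (w - a))\<^sup>2 \<Longrightarrow> c \<le> cmod (w - a)"
  shows "4 * ln (max ((cmod (w - a))\<^sup>2) d) - 4 * (r / c) ^ 4
      \<le> four_point_sum (\<lambda>w. ln (max ((cmod (w - a))\<^sup>2) d)) w r"
proof (cases "d \<le> (cmod (w - a))\<^sup>2")
  case True
  have ca: "c \<le> cmod (w - a)" using ca[OF True] .
  have wa: "w - a \<noteq> 0" using ca c by auto
  have "(r / cmod (w - a)) ^ 4 \<le> (r / c) ^ 4"
    using ca c by (intro power_mono divide_left_mono mult_pos_pos) auto
  moreover have "\<bar>four_point_sum (\<lambda>w. ln ((cmod w)\<^sup>2)) (w - a) r - 4 * ln ((cmod (w - a))\<^sup>2)\<bar> \<le> 4 * (r / cmod (w - a)) ^ 4"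
    by (rule four_point_ln) (use wa c ca in auto)
  ultimately have "4 * ln (max ((cmod (w - a))\<^sup>2) d) - 4 * (r / c) ^ 4
      \<le> four_point_sum (\<lambda>w. ln ((cmod w)\<^sup>2)) (w - a) r"
    unfolding max_absorb1[OF True] abs_le_iff by linarith
  also have "\<dots> = four_point_sum (\<lambda>v. ln ((cmod (v - a))\<^sup>2)) w r"
    by (simp add: four_point_sum_def algebra_simps)
  also have "\<dots> \<le> four_point_sum (\<lambda>w. ln (max ((cmod (w - a))\<^sup>2) d)) w r"
  proof (rule four_point_mono)
    fix v assume v: "cmod (v - w) = \<bar>r\<bar>"
    have "cmod (w - a) - cmod (v - w) \<le> cmod (v - a)"
      using norm_triangle_ineq2[of "w - a" "w - v"] by (simp add: norm_minus_commute)
    then have "0 < cmod (v - a)" using v ca c by linarith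
    then show "ln ((cmod (v - a))\<^sup>2) \<le> ln (max ((cmod (v - a))\<^sup>2) d)" by (intro ln_mono) auto
  qed
  finally show ?thesis .
next
  case False
  then have dp: "0 < d" using zero_le_power2[of "cmod (w - a)"] by linarith
  have "4 * ln (max ((cmod (w - a))\<^sup>2) d) - 4 * (r / c) ^ 4 \<le> 4 * ln d"
    using False c by (simp add: max_absorb2)
  also have "\<dots> = four_point_sum (\<lambda>_. ln d) w r" by (simp add: four_point_const)
  also have "\<dots> \<le> four_point_sum (\<lambda>w. ln (max ((cmod (w - a))\<^sup>2) d)) w r"
    using dp by (intro four_point_mono ln_mono) auto
  finally show ?thesis .
qed

context regular_equilibrium
begin

text \<open>\<open>four_point_ln\<close> integrated over \<mu>: off S the potential is harmonic, and
  c bounds the distance to all singularities from below.\<close>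

lemma four_point_pot:
  assumes c: "0 \<le> r" "r \<le> c / 2" "0 < c" "c \<le> infdist w S"
  shows "four_point_sum pot w r \<le> 4 * pot w + 4 * (r / c) ^ 4"
proof -
  interpret finite_measure \<mu> by (rule finite_measure_mu)
  have wS: "w \<notin> S"
  proof
    assume "w \<in> S"
    then have "infdist w S = 0" by simp
    then show False using c by linarith
  qed
  have off: "v \<notin> S" if "cmod (v - w) = \<bar>r\<bar>" for v
  proof
    assume "v \<in> S"
    then have "infdist w S \<le> dist w v" by (rule infdist_le)
    then show False using that c by (simp add: dist_norm norm_minus_commute)
  qed
  have i: "integrable \<mu> (\<lambda>s. ln ((cmod (v - s))\<^sup>2))" if "cmod (v - w) = \<bar>r\<bar>" for v
    by (rule integrable_off_S[OF off[OF that]])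
  have i': "integrable \<mu> (\<lambda>s. ln ((cmod (w + of_real r - s))\<^sup>2))" "integrable \<mu> (\<lambda>s. ln ((cmod (w - of_real r - s))\<^sup>2))"
     "integrable \<mu> (\<lambda>s. ln ((cmod (w + \<i> * of_real r - s))\<^sup>2))" "integrable \<mu> (\<lambda>s. ln ((cmod (w - \<i> * of_real r - s))\<^sup>2))"
    by (rule i, simp add: norm_mult)+
  have "four_point_sum pot w r = (\<integral>s. four_point_sum (\<lambda>v. ln ((cmod (v - s))\<^sup>2)) w r \<partial>\<mu>)"
    unfolding four_point_sum_def pot_def using i' by simp
  also have "\<dots> \<le> (\<integral>s. 4 * ln ((cmod (w - s))\<^sup>2) + 4 * (r / c) ^ 4 \<partial>\<mu>)"
  proof (rule integral_mono_AE)
    show "integrable \<mu> (\<lambda>s. four_point_sum (\<lambda>v. ln ((cmod (v - s))\<^sup>2)) w r)"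
      unfolding four_point_sum_def using i' by simp
    show "AE s in \<mu>. four_point_sum (\<lambda>v. ln ((cmod (v - s))\<^sup>2)) w r \<le> 4 * ln ((cmod (w - s))\<^sup>2) + 4 * (r / c) ^ 4"
      using AE_S
    proof eventually_elim
      case (elim s)
      have ca: "c \<le> cmod (w - s)" using infdist_le[OF elim, of w] c by (simp add: dist_norm)
      have "(r / cmod (w - s)) ^ 4 \<le> (r / c) ^ 4"
        using ca c by (intro power_mono divide_left_mono mult_pos_pos) auto
      moreover have "four_point_sum (\<lambda>v. ln ((cmod (v - s))\<^sup>2)) w r = four_point_sum (\<lambda>w. ln ((cmod w)\<^sup>2)) (w - s) r"
        by (simp add: four_point_sum_def algebra_simps)
      moreover have "\<bar>four_point_sum (\<lambda>w. ln ((cmod w)\<^sup>2)) (w - s) r - 4 * ln ((cmod (w - s))\<^sup>2)\<bar> \<le> 4 * (r / cmod (w - s)) ^ 4"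
        by (rule four_point_ln) (use c ca in auto)
      ultimately show ?case unfolding abs_le_iff by linarith
    qed
  qed (use integrable_off_S[OF wS] in simp)
  also have "\<dots> = 4 * pot w + 4 * (r / c) ^ 4"
    unfolding pot_def using integrable_off_S[OF wS] prob_mu_measure by simp
  finally show ?thesis .
qed

end

section \<open>Maximum principle off the support\<close>

context regular_equilibrium
begin

lemma S_bound: "\<exists>R>0. \<forall>x\<in>S. cmod x \<le> R"
  using bounded_S unfolding bounded_pos by blast

lemma pot_far_lower:
  assumes R: "\<And>x. x \<in> S \<Longrightarrow> cmod x \<le> R" and w: "2 * R \<le> cmod w" "w \<notin> S" "0 < cmod w"
  shows "ln ((cmod w)\<^sup>2) - ln 4 \<le> pot w"
proof -
  interpret finite_measure \<mu> by (rule finite_measure_mu)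
  have "ln ((cmod w)\<^sup>2) - ln 4 = (\<integral>s. ln ((cmod w)\<^sup>2) - ln 4 \<partial>\<mu>)" using prob_mu_measure by simp
  also have "\<dots> \<le> pot w" unfolding pot_def
  proof (rule integral_mono_AE)
    show "AE s in \<mu>. ln ((cmod w)\<^sup>2) - ln 4 \<le> ln ((cmod (w - s))\<^sup>2)"
      using AE_S
    proof eventually_elim
      case (elim s)
      have "cmod w / 2 \<le> cmod (w - s)" using norm_triangle_ineq2[of w s] R[OF elim] w by linarith
      then have "(cmod w / 2)\<^sup>2 \<le> (cmod (w - s))\<^sup>2" by (intro power_mono) auto
      then have "ln ((cmod w / 2)\<^sup>2) \<le> ln ((cmod (w - s))\<^sup>2)" using w by (intro ln_mono) auto
      moreover have "ln ((cmod w / 2)\<^sup>2) = ln ((cmod w)\<^sup>2) - ln 4"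
        using w by (simp add: power_divide ln_div)
      ultimately show ?case by simp
    qed
  qed (use integrable_off_S w in auto)
  finally show ?thesis .
qed

text \<open>A comparison of degrees: the product grows at most like \<open>|w|^(2 * card I)\<close>
  and the exponential decays like \<open>|w|^(-2 * N)\<close>, so with \<open>card I < N\<close> the
  quotient tends to zero. This takes care of the point at infinity in the maximum principle; I will
  consist of the other \<open>N - 1\<close> particles.\<close>

lemma weighted_product_decay:
  fixes a :: "'i \<Rightarrow> complex" and d :: "'i \<Rightarrow> real"
  assumes I: "finite I" "card I < N" and d: "\<And>i. i \<in> I \<Longrightarrow> 0 \<le> d i" and M: "0 < M"
  shows "\<exists>R>0. \<forall>w. w \<notin> S \<longrightarrow> R \<le> cmod w \<longrightarrow>
     (\<Prod>i\<in>I. max ((cmod (w - a i))\<^sup>2) (d i)) * exp (- real N * (pot w + b)) < M"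
proof -
  obtain R0 where R0: "0 < R0" "\<And>x. x \<in> S \<Longrightarrow> cmod x \<le> R0" using S_bound by blast
  define A where "A = 1 + (\<Sum>i\<in>I. cmod (a i) + d i)"
  have sn: "0 \<le> cmod (a i) + d i" if "i \<in> I" for i using d[OF that] by simp
  have A1: "1 \<le> A" unfolding A_def using sn by (simp add: sum_nonneg)
  have Ai: "cmod (a i) \<le> A" "d i \<le> A" if i: "i \<in> I" for i
  proof -
    have "cmod (a i) + d i \<le> (\<Sum>i\<in>I. cmod (a i) + d i)"
      using sn i I by (intro member_le_sum) auto
    then show "cmod (a i) \<le> A" "d i \<le> A" using d[OF i] norm_ge_zero[of "a i"] unfolding A_def by linarith+
  qed
  define E where "E = exp (- real N * b) * 4 ^ (2 * N)"
  have E: "0 < E" by (simp add: E_def)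
  define R where "R = A + 2 * R0 + E / M + 1"
  have EM: "0 < E / M" using E M by simp
  have R: "0 < R" using A1 R0 EM unfolding R_def by linarith
  have "(\<Prod>i\<in>I. max ((cmod (w - a i))\<^sup>2) (d i)) * exp (- real N * (pot w + b)) < M"
    if wS: "w \<notin> S" and wR: "R \<le> cmod w" for w
  proof -
    define t where "t = (cmod w)\<^sup>2"
    have w1: "1 \<le> cmod w" "A \<le> cmod w" "2 * R0 \<le> cmod w" "E / M < cmod w"
      using wR A1 R0 EM unfolding R_def by linarith+
    have wt: "cmod w \<le> t" using w1 mult_left_mono[of 1 "cmod w" "cmod w"] by (simp add: t_def power2_eq_square)
    have t1: "1 \<le> t" using wt w1 by linarith
    have fac: "max ((cmod (w - a i))\<^sup>2) (d i) \<le> 4 * t" if i: "i \<in> I" for i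
    proof -
      have "cmod (w - a i) \<le> 2 * cmod w" using norm_triangle_ineq4[of w "a i"] Ai[OF i] w1 by linarith
      then have "(cmod (w - a i))\<^sup>2 \<le> (2 * cmod w)\<^sup>2" by (intro power_mono) auto
      then have "(cmod (w - a i))\<^sup>2 \<le> 4 * t" by (simp only: t_def power_mult_distrib) simp
      moreover have "d i \<le> 4 * t" using Ai[OF i] w1 wt t1 by linarith
      ultimately show ?thesis by (rule max.boundedI)
    qed
    have "(\<Prod>i\<in>I. max ((cmod (w - a i))\<^sup>2) (d i)) \<le> (\<Prod>i\<in>I. 4 * t)"
      using fac d by (intro prod_mono) (auto simp: le_max_iff_disj)
    also have "\<dots> = (4 * t) ^ card I" by simp
    also have "\<dots> \<le> (4 * t) ^ (N - 1)" using I t1 by (intro power_increasing) auto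
    finally have 1: "(\<Prod>i\<in>I. max ((cmod (w - a i))\<^sup>2) (d i)) \<le> (4 * t) ^ (N - 1)" .
    have "ln t - ln 4 \<le> pot w" unfolding t_def using w1
      by (intro pot_far_lower[of R0] R0 wS) auto
    then have "- real N * (pot w + b) \<le> - real N * (ln t - ln 4 + b)"
      by (intro mult_left_mono_neg) auto
    then have "exp (- real N * (pot w + b)) \<le> exp (- real N * (ln t - ln 4 + b))" by simp
    also have "\<dots> = exp (- real N * b) * (exp (ln 4 - ln t)) ^ N"
      by (simp add: exp_of_nat_mult[symmetric] exp_add[symmetric] algebra_simps)
    also have "exp (ln 4 - ln t) = 4 / t" using t1 by (simp add: exp_diff)
    finally have 2: "exp (- real N * (pot w + b)) \<le> exp (- real N * b) * (4 / t) ^ N" .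
    have "(\<Prod>i\<in>I. max ((cmod (w - a i))\<^sup>2) (d i)) * exp (- real N * (pot w + b))
        \<le> (4 * t) ^ (N - 1) * (exp (- real N * b) * (4 / t) ^ N)"
      using 1 2 t1 by (intro mult_mono) auto
    also have "\<dots> = exp (- real N * b) * (4 ^ (N - 1) * 4 ^ N) * (t ^ (N - 1) / t ^ N)"
      by (simp add: power_mult_distrib power_divide)
    also have "t ^ (N - 1) / t ^ N = 1 / t"
      using t1 I by (cases N) auto
    also have "exp (- real N * b) * (4 ^ (N - 1) * 4 ^ N) * (1 / t) \<le> E * (1 / t)"
      unfolding E_def using t1
      by (intro mult_right_mono mult_left_mono) (auto simp: power_add[symmetric] intro!: power_increasing)
    also have "\<dots> < M"
    proof -
      have "E < t * M" using w1 wt M by (simp add: pos_divide_less_eq[symmetric])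
      then show ?thesis using t1 by (simp add: pos_divide_less_eq mult.commute)
    qed
    finally show ?thesis .
  qed
  then show ?thesis using R by blast
qed

text \<open>Domination principle: a maximum principle for the difference of the two logarithmic potentials
  on the complement of \<open>S\<close>, made strict by the factor \<open>exp (\<eta> \<bar>w\<bar>\<^sup>2)\<close>.\<close>

lemma domination_pos:
  fixes a :: "'i \<Rightarrow> complex" and d :: "'i \<Rightarrow> real"
  assumes I: "finite I" "card I < N" and d: "\<And>i. i \<in> I \<Longrightarrow> 0 \<le> d i" and M: "0 < M"
    and bd: "\<And>x. x \<in> S \<Longrightarrow> (\<Prod>i\<in>I. max ((cmod (x - a i))\<^sup>2) (d i)) \<le> M * exp (real N * \<phi> x)"
    and w1: "w1 \<notin> S"
  shows "(\<Prod>i\<in>I. max ((cmod (w1 - a i))\<^sup>2) (d i)) * exp (- real N * (pot w1 + b)) \<le> M"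
proof (rule ccontr)
  define f where "f w = (\<Prod>i\<in>I. max ((cmod (w - a i))\<^sup>2) (d i))" for w
  define G where "G w = f w * exp (- real N * (pot w + b))" for w
  assume "\<not> ?thesis"
  then have G1: "M < G w1" by (simp add: G_def f_def)
  have N: "0 < N" using I by simp
  have f0: "0 \<le> f w" for w unfolding f_def by (intro prod_nonneg) (auto simp: le_max_iff_disj)
  have cf: "continuous_on A f" for A unfolding f_def by (intro continuous_intros)
  obtain R where R: "0 < R" "\<And>w. w \<notin> S \<Longrightarrow> R \<le> cmod w \<Longrightarrow> G w < M"
    using weighted_product_decay[OF I, of d M a] d M unfolding G_def f_def by blast
  have w1R: "cmod w1 < R" using R(2)[OF w1] G1 by fastforce
  \<comment> \<open>With this choice \<open>exp (\<eta> * R^2)\<close> is the square root of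
    \<open>G w1 / M\<close>, so on the disc of radius R the factor raises values up to M to less
    than \<open>G w1\<close>.\<close>
  define \<eta> where "\<eta> = ln (G w1 / M) / (2 * R\<^sup>2)"
  have lnp: "0 < ln (G w1 / M)" using G1 M by simp
  have \<eta>: "0 < \<eta>" unfolding \<eta>_def using lnp R by simp
  have "exp (\<eta> * R\<^sup>2) < exp (ln (G w1 / M))" using lnp R by (simp add: \<eta>_def)
  also have "\<dots> = G w1 / M" using G1 M by simp
  finally have G1': "M * exp (\<eta> * R\<^sup>2) < G w1" using M by (simp add: field_simps)
  define H where "H w = G w * exp (\<eta> * (cmod w)\<^sup>2)" for w
  have cH: "continuous_on (- S) H"
    unfolding H_def G_def by (intro continuous_intros continuous_on_pot cf)
  have G0: "0 \<le> G w" for w unfolding G_def using f0 by simp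
  have "G w1 * 1 \<le> H w1" unfolding H_def using G0 \<eta> by (intro mult_left_mono) auto
  then have H1: "M * exp (\<eta> * R\<^sup>2) < H w1" using G1' by simp
  define E where "E = {w. w \<notin> S \<and> cmod w \<le> R \<and> H w1 \<le> H w}"
  have "compact E"
    unfolding compact_eq_bounded_closed
  proof
    show "bounded E" by (rule boundedI[of _ R]) (auto simp: E_def)
    show "closed E"
      unfolding closed_sequential_limits
    proof (intro allI impI, elim conjE)
      fix w x assume w: "\<forall>n. w n \<in> E" and lim: "w \<longlonglongrightarrow> x"
      have wn: "w n \<notin> S" "cmod (w n) \<le> R" "H w1 \<le> H (w n)" for n using w by (auto simp: E_def)
      have xR: "cmod x \<le> R"
        by (rule LIMSEQ_le_const2[OF tendsto_norm[OF lim]]) (use wn in auto)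
      have xS: "x \<notin> S"
      proof
        assume x: "x \<in> S"
        \<comment> \<open>Makes \<open>exp (real N * e)\<close> the square root of the ratio of
          \<open>H w1\<close> to \<open>M * exp (\<eta> * R^2)\<close>; a limit point on S would
          then give \<open>H w1 < H w1\<close>.\<close>
        define e where "e = ln (H w1 / (M * exp (\<eta> * R\<^sup>2))) / (2 * real N)"
        have Mp: "0 < M * exp (\<eta> * R\<^sup>2)" using M by simp
        then have "1 < H w1 / (M * exp (\<eta> * R\<^sup>2))" using H1 by (subst less_divide_eq) auto
        then have lp: "0 < ln (H w1 / (M * exp (\<eta> * R\<^sup>2)))" by (rule ln_gt_zero)
        then have e: "0 < e" unfolding e_def using N by simp
        have ev: "\<forall>\<^sub>F n in sequentially. H w1 \<le> f (w n) * exp (- real N * (\<phi> x - e)) * exp (\<eta> * R\<^sup>2)"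
          using pot_liminf[OF x wn(1) lim e]
        proof eventually_elim
          case (elim n)
          have "H w1 \<le> H (w n)" by (rule wn)
          also have "\<dots> \<le> f (w n) * exp (- real N * (\<phi> x - e)) * exp (\<eta> * R\<^sup>2)"
            unfolding H_def G_def using elim wn(2)[of n] \<eta> f0 N
            by (intro mult_mono) (auto intro!: mult_left_mono power_mono)
          finally show ?case .
        qed
        have "isCont f x" using cf[of UNIV] by (simp add: continuous_on_eq_continuous_at)
        then have fl: "(\<lambda>n. f (w n)) \<longlonglongrightarrow> f x" using lim by (rule isCont_tendsto_compose)
        have "H w1 \<le> f x * exp (- real N * (\<phi> x - e)) * exp (\<eta> * R\<^sup>2)"
          by (rule tendsto_lowerbound[OF _ ev]) (auto intro!: tendsto_intros fl)
        also have "\<dots> \<le> M * exp (real N * \<phi> x) * exp (- real N * (\<phi> x - e)) * exp (\<eta> * R\<^sup>2)"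
          using bd[OF x] by (intro mult_right_mono) (auto simp: f_def)
        also have "\<dots> = M * exp (\<eta> * R\<^sup>2) * exp (real N * e)"
          by (simp add: mult_exp_exp algebra_simps)
        also have "\<dots> < M * exp (\<eta> * R\<^sup>2) * exp (ln (H w1 / (M * exp (\<eta> * R\<^sup>2))))"
          using lp M N by (intro mult_strict_left_mono) (auto simp: e_def)
        also have "\<dots> = H w1"
        proof -
          have "0 < H w1 / (M * exp (\<eta> * R\<^sup>2))" using H1 Mp by (intro divide_pos_pos) auto
          then show ?thesis using Mp M by simp
        qed
        finally show False by simp
      qed
      have "isCont H x"
        using cH closed_S xS by (simp add: continuous_on_eq_continuous_at open_Compl)
      then have "(\<lambda>n. H (w n)) \<longlonglongrightarrow> H x" using lim by (rule isCont_tendsto_compose)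
      then have "H w1 \<le> H x" by (rule LIMSEQ_le_const) (use wn in auto)
      then show "x \<in> E" using xR xS by (simp add: E_def)
    qed
  qed
  moreover have "w1 \<in> E" using w1 w1R by (simp add: E_def)
  then have "E \<noteq> {}" by auto
  moreover have "continuous_on E H" by (rule continuous_on_subset[OF cH]) (auto simp: E_def)
  ultimately obtain w where w: "w \<in> E" "\<And>v. v \<in> E \<Longrightarrow> H v \<le> H w"
    using continuous_attains_sup[of E H] by blast
  have wE: "w \<notin> S" "cmod w \<le> R" "H w1 \<le> H w" using w by (auto simp: E_def)
  have max: "H v \<le> H w" if "v \<notin> S" "cmod v \<le> R" for v
    using w(2)[of v] that wE by (cases "H w1 \<le> H v") (auto simp: E_def)
  have "M * exp (\<eta> * R\<^sup>2) < G w * exp (\<eta> * (cmod w)\<^sup>2)" using H1 wE by (simp add: H_def)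
  also have "\<dots> \<le> G w * exp (\<eta> * R\<^sup>2)" using wE G0 \<eta> by (intro mult_left_mono) (auto intro!: power_mono)
  finally have Gw: "M < G w" by simp
  have wR: "cmod w < R" using R(2)[OF wE(1)] Gw by fastforce
  have fw: "0 < f w" using Gw M f0[of w] unfolding G_def by (cases "f w = 0") auto
  have facp: "0 < max ((cmod (w - a i))\<^sup>2) (d i)" if "i \<in> I" for i
  proof -
    have "max ((cmod (w - a i))\<^sup>2) (d i) \<noteq> 0"
    proof
      assume "max ((cmod (w - a i))\<^sup>2) (d i) = 0"
      then have "f w = 0" unfolding f_def using that by (intro prod_zero I bexI[of _ i])
      then show False using fw by simp
    qed
    moreover have "0 \<le> max ((cmod (w - a i))\<^sup>2) (d i)" by (simp add: le_max_iff_disj)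
    ultimately show ?thesis by linarith
  qed
  \<comment> \<open>Only the factors that are not clipped at w restrict the radius; for the other
    indices the clip level itself keeps the factor positive.\<close>
  define K where "K = {i \<in> I. d i \<le> (cmod (w - a i))\<^sup>2}"
  define c where "c = Min (insert (infdist w S) ((\<lambda>i. cmod (w - a i)) ` K))"
  have fK: "finite K" using I by (simp add: K_def)
  have Kp: "0 < cmod (w - a i)" if i: "i \<in> K" for i
  proof -
    have "d i \<le> (cmod (w - a i))\<^sup>2" "i \<in> I" using i by (auto simp: K_def)
    then have "0 < (cmod (w - a i))\<^sup>2" using facp[of i] by (simp only: max_absorb1)
    then show ?thesis by simp
  qed
  have c0: "0 < c" unfolding c_def using fK Kp dist_S_pos[OF wE(1)] by (subst Min_gr_iff) auto
  have cS: "c \<le> infdist w S" unfolding c_def using fK by (intro Min_le) auto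
  have cK: "c \<le> cmod (w - a i)" if "i \<in> K" for i unfolding c_def using fK that by (intro Min_le) auto
  \<comment> \<open>\<open>c / 2\<close> keeps the four points away from S and from the zeros, and
    \<open>R - cmod w\<close> keeps them in the disc on which w is maximal. The last term makes the
    fourth-order errors, at most \<open>8 * N * \<tau>\<close> in total, smaller than the gain
    \<open>4 * \<eta> * r^2\<close> from the factor \<open>exp (\<eta> * |w|^2)\<close>.\<close>
  define r where "r = min (min (c / 2) (R - cmod w)) (c\<^sup>2 * sqrt (\<eta> / (4 * real N)))"
  have r: "0 < r" "r \<le> c / 2" "r \<le> R - cmod w" "r \<le> c\<^sup>2 * sqrt (\<eta> / (4 * real N))"
  proof -
    have "0 < c / 2" "0 < R - cmod w" "0 < c\<^sup>2 * sqrt (\<eta> / (4 * real N))"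
      using c0 wR \<eta> N by simp_all
    then show "0 < r" "r \<le> c / 2" "r \<le> R - cmod w" "r \<le> c\<^sup>2 * sqrt (\<eta> / (4 * real N))"
      unfolding r_def by linarith+
  qed
  have r2: "r\<^sup>2 \<le> c ^ 4 * (\<eta> / (4 * real N))"
  proof -
    have "r\<^sup>2 \<le> (c\<^sup>2 * sqrt (\<eta> / (4 * real N)))\<^sup>2" using r by (intro power_mono) auto
    also have "\<dots> = c ^ 4 * (\<eta> / (4 * real N))" using \<eta> N by (simp add: power_mult_distrib flip: power_mult)
    finally show ?thesis .
  qed
  define \<tau> where "\<tau> = (r / c) ^ 4"
  have \<tau>: "real N * \<tau> \<le> \<eta> * r\<^sup>2 / 4"
  proof -
    have "\<tau> = r\<^sup>2 * (r\<^sup>2 / c ^ 4)" by (simp add: \<tau>_def power_divide power4_eq_xxxx power2_eq_square)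
    also have "\<dots> \<le> r\<^sup>2 * (\<eta> / (4 * real N))" using r2 c0 by (intro mult_left_mono) (auto simp: field_simps)
    finally have "real N * \<tau> \<le> real N * (r\<^sup>2 * (\<eta> / (4 * real N)))" by (intro mult_left_mono) auto
    then show ?thesis using N by (simp add: field_simps)
  qed
  define h where "h v = (\<Sum>i\<in>I. ln (max ((cmod (v - a i))\<^sup>2) (d i))) - real N * (pot v + b) + \<eta> * (cmod v)\<^sup>2" for v
  have near: "v \<notin> S" "cmod v \<le> R" "\<And>i. i \<in> I \<Longrightarrow> 0 < max ((cmod (v - a i))\<^sup>2) (d i)" if v: "cmod (v - w) \<le> r" for v
  proof -
    show "v \<notin> S"
    proof
      assume "v \<in> S"
      then have "infdist w S \<le> dist w v" by (rule infdist_le)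
      then show False using v cS r c0 by (simp add: dist_norm norm_minus_commute)
    qed
    show "cmod v \<le> R" using norm_triangle_ineq2[of v w] v r by linarith
    fix i assume i: "i \<in> I"
    show "0 < max ((cmod (v - a i))\<^sup>2) (d i)"
    proof (cases "i \<in> K")
      case True
      have "cmod (w - a i) - cmod (w - v) \<le> cmod (v - a i)"
        using norm_triangle_ineq2[of "w - a i" "w - v"] by simp
      then have "0 < cmod (v - a i)" using cK[OF True] v r(2) c0 norm_minus_commute[of w v] by linarith
      then show ?thesis by (simp add: less_max_iff_disj)
    next
      case False
      then have "(cmod (w - a i))\<^sup>2 < d i" using i by (auto simp: K_def)
      then have "0 < d i" using zero_le_power2[of "cmod (w - a i)"] by linarith
      then show ?thesis by (simp add: less_max_iff_disj)
    qed
  qed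
  have Hh: "H v = exp (h v)" if v: "cmod (v - w) \<le> r" for v
  proof -
    have "f v = exp (\<Sum>i\<in>I. ln (max ((cmod (v - a i))\<^sup>2) (d i)))"
      unfolding f_def exp_sum[OF I(1)] using near(3)[OF v] by (intro prod.cong) auto
    then show ?thesis unfolding H_def G_def h_def by (simp add: exp_add exp_diff exp_minus field_simps)
  qed
  have hmax: "h v \<le> h w" if v: "cmod (v - w) \<le> r" for v
    using max[OF near(1,2)[OF v]] Hh[OF v] Hh[of w] r by simp
  have "four_point_sum h w r \<le> four_point_sum (\<lambda>_. h w) w r"
    by (rule four_point_mono) (use hmax r in auto)
  then have up: "four_point_sum h w r \<le> 4 * h w" by (simp add: four_point_const)
  have "four_point_sum h w r = (\<Sum>i\<in>I. four_point_sum (\<lambda>v. ln (max ((cmod (v - a i))\<^sup>2) (d i))) w r)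
      - real N * four_point_sum pot w r - 4 * real N * b + \<eta> * four_point_sum (\<lambda>w. (cmod w)\<^sup>2) w r"
    unfolding four_point_sum_def h_def by (simp add: sum.distrib algebra_simps)
  also have "\<dots> \<ge> (\<Sum>i\<in>I. 4 * ln (max ((cmod (w - a i))\<^sup>2) (d i)) - 4 * \<tau>)
      - real N * (4 * pot w + 4 * \<tau>) - 4 * real N * b + \<eta> * (4 * (cmod w)\<^sup>2 + 4 * r\<^sup>2)"
    unfolding four_point_cmod
  proof (intro add_mono diff_mono sum_mono mult_left_mono order_refl)
    show "four_point_sum pot w r \<le> 4 * pot w + 4 * \<tau>"
      unfolding \<tau>_def using r c0 cS by (intro four_point_pot) auto
    fix i assume i: "i \<in> I"
    show "4 * ln (max ((cmod (w - a i))\<^sup>2) (d i)) - 4 * \<tau> \<le> four_point_sum (\<lambda>v. ln (max ((cmod (v - a i))\<^sup>2) (d i))) w r"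
      unfolding \<tau>_def using r c0 d[OF i] cK i by (intro four_point_ln_max) (auto simp: K_def)
  qed (use \<eta> in auto)
  finally have "4 * h w - 4 * real (card I) * \<tau> - 4 * real N * \<tau> + 4 * \<eta> * r\<^sup>2 \<le> four_point_sum h w r"
    by (simp add: h_def sum_subtractf sum_distrib_left algebra_simps)
  then have "4 * \<eta> * r\<^sup>2 \<le> 4 * (real (card I) * \<tau>) + 4 * (real N * \<tau>)" using up by linarith
  moreover have "real (card I) * \<tau> \<le> real N * \<tau>"
    using I by (intro mult_right_mono) (auto simp: \<tau>_def)
  ultimately have "4 * (\<eta> * r\<^sup>2) \<le> 2 * (\<eta> * r\<^sup>2)" using \<tau> by linarith
  then show False using \<eta> r by (simp add: mult_le_cancel_right)
qed

lemma domination: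
  fixes a :: "'i \<Rightarrow> complex" and d :: "'i \<Rightarrow> real"
  assumes I: "finite I" "card I < N" and d: "\<And>i. i \<in> I \<Longrightarrow> 0 \<le> d i" and M: "0 \<le> M"
    and bd: "\<And>x. x \<in> S \<Longrightarrow> (\<Prod>i\<in>I. max ((cmod (x - a i))\<^sup>2) (d i)) \<le> M * exp (real N * \<phi> x)"
    and w: "w \<notin> S"
  shows "(\<Prod>i\<in>I. max ((cmod (w - a i))\<^sup>2) (d i)) \<le> M * exp (real N * (pot w + b))"
proof -
  have "(\<Prod>i\<in>I. max ((cmod (w - a i))\<^sup>2) (d i)) * exp (- real N * (pot w + b)) \<le> M + e" if e: "0 < e" for e
  proof (rule domination_pos[OF I d _ _ w])
    fix x assume "x \<in> S"
    then have "(\<Prod>i\<in>I. max ((cmod (x - a i))\<^sup>2) (d i)) \<le> M * exp (real N * \<phi> x)" by (rule bd)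
    also have "\<dots> \<le> (M + e) * exp (real N * \<phi> x)" using e by (intro mult_right_mono) auto
    finally show "(\<Prod>i\<in>I. max ((cmod (x - a i))\<^sup>2) (d i)) \<le> (M + e) * exp (real N * \<phi> x)" .
  qed (use e M in auto)
  then have "(\<Prod>i\<in>I. max ((cmod (w - a i))\<^sup>2) (d i)) * exp (- real N * (pot w + b)) \<le> M"
    by (rule field_le_epsilon)
  then have "(\<Prod>i\<in>I. max ((cmod (w - a i))\<^sup>2) (d i)) * exp (- real N * (pot w + b)) * exp (real N * (pot w + b))
     \<le> M * exp (real N * (pot w + b))" by (rule mult_right_mono) simp
  then show ?thesis by (simp add: mult.assoc mult_exp_exp)
qed

end

section \<open>Particles outside a neighbourhood of the support\<close>

text \<open>Between the radii \<open>2^(n-1)\<close> and \<open>2^n\<close> the integrand is at most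
  \<open>16 * (1/16)^n\<close>, against an area of order \<open>4^n\<close>.\<close>

lemma nn_integral_decay_finite:
  "(\<integral>\<^sup>+w. ennreal (1 / (1 + (cmod w)\<^sup>2)\<^sup>2) \<partial>lborel) < \<infinity>"
proof -
  define B where "B n = ball (0::complex) (2 ^ n)" for n :: nat
  have [measurable]: "B n \<in> sets borel" for n by (simp add: B_def)
  define c where "c = unit_ball_vol (real DIM(complex))"
  have c: "0 \<le> c" unfolding c_def by simp
  have pt: "ennreal (1 / (1 + (cmod w)\<^sup>2)\<^sup>2) \<le> (\<Sum>n. ennreal (16 * (1/16) ^ n) * indicator (B n) w)" for w
  proof -
    have ex: "\<exists>n. cmod w < 2 ^ n" by (rule real_arch_pow) simp
    define m where "m = (LEAST n. cmod w < 2 ^ n)"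
    have m1: "cmod w < 2 ^ m" unfolding m_def using ex by (rule LeastI_ex)
    have "1 / (1 + (cmod w)\<^sup>2)\<^sup>2 \<le> 16 * (1/16) ^ m"
    proof (cases m)
      case 0
      have "1 \<le> (1 + (cmod w)\<^sup>2)\<^sup>2" by (rule one_le_power) simp
      then have "1 / (1 + (cmod w)\<^sup>2)\<^sup>2 \<le> 1" by (subst divide_le_eq_1) linarith
      then show ?thesis using 0 by simp
    next
      case (Suc n)
      have "\<not> cmod w < 2 ^ n" using not_less_Least[of n "\<lambda>n. cmod w < 2 ^ n"] Suc by (simp add: m_def)
      then have "(2 ^ n)\<^sup>2 \<le> (cmod w)\<^sup>2" by (intro power_mono) auto
      then have "(2 ^ n)\<^sup>2 \<le> 1 + (cmod w)\<^sup>2" by linarith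
      then have "((2 ^ n)\<^sup>2)\<^sup>2 \<le> (1 + (cmod w)\<^sup>2)\<^sup>2" by (intro power_mono) auto
      moreover have "((2 ^ n)\<^sup>2)\<^sup>2 = (16::real) ^ n" by (simp add: power_mult[symmetric] mult.commute[of n]) (simp add: power_mult)
      ultimately have "1 / (1 + (cmod w)\<^sup>2)\<^sup>2 \<le> 1 / 16 ^ n" by (intro divide_left_mono) (auto intro!: mult_pos_pos add_pos_nonneg zero_less_power)
      then show ?thesis using Suc by (simp add: power_divide)
    qed
    then have "ennreal (1 / (1 + (cmod w)\<^sup>2)\<^sup>2) \<le> ennreal (16 * (1/16) ^ m) * indicator (B m) w"
      using m1 by (simp add: B_def ennreal_leI)
    also have "\<dots> = sum (\<lambda>n. ennreal (16 * (1/16) ^ n) * indicator (B n) w) {m}"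
      by (subst sum.insert) auto
    also have "\<dots> \<le> (\<Sum>n. ennreal (16 * (1/16) ^ n) * indicator (B n) w)"
      by (rule sum_le_suminf) auto
    finally show ?thesis .
  qed
  have "(\<integral>\<^sup>+w. ennreal (1 / (1 + (cmod w)\<^sup>2)\<^sup>2) \<partial>lborel)
      \<le> (\<integral>\<^sup>+w. (\<Sum>n. ennreal (16 * (1/16) ^ n) * indicator (B n) w) \<partial>lborel)"
    by (rule nn_integral_mono) (rule pt)
  also have "\<dots> = (\<Sum>n. \<integral>\<^sup>+w. ennreal (16 * (1/16) ^ n) * indicator (B n) w \<partial>lborel)"
    by (rule nn_integral_suminf) measurable
  also have "\<dots> = (\<Sum>n. ennreal (16 * c * (1/4) ^ n))"
  proof (rule suminf_cong)
    fix n
    have q: "(1/16) ^ n * (2 ^ n * 2 ^ n) = (1/4 :: real) ^ n" by (simp add: power_mult_distrib[symmetric])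
    have "(\<integral>\<^sup>+w. ennreal (16 * (1/16) ^ n) * indicator (B n) w \<partial>lborel) = ennreal (16 * (1/16) ^ n) * emeasure lborel (B n)"
      by (subst nn_integral_cmult_indicator) (simp_all add: B_def)
    also have "\<dots> = ennreal (16 * (1/16) ^ n) * ennreal (c * (2 ^ n * 2 ^ n))"
      unfolding B_def by (subst emeasure_ball) (simp_all add: c_def power2_eq_square)
    also have "\<dots> = ennreal ((16 * (1/16) ^ n) * (c * (2 ^ n * 2 ^ n)))"
      using c by (subst ennreal_mult[symmetric]) auto
    also have "(16 * (1/16) ^ n) * (c * (2 ^ n * 2 ^ n)) = 16 * c * ((1/16) ^ n * (2 ^ n * 2 ^ n))" by simp
    finally show "(\<integral>\<^sup>+w. ennreal (16 * (1/16) ^ n) * indicator (B n) w \<partial>lborel) = ennreal (16 * c * (1/4) ^ n)"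
      unfolding q .
  qed
  also have "\<dots> < \<infinity>"
  proof -
    have "(\<Sum>n. ennreal (16 * c * (1/4) ^ n)) \<noteq> top"
      using c by (intro ennreal_suminf_neq_top summable_mult summable_geometric) auto
    then show ?thesis by (simp add: less_top)
  qed
  finally show ?thesis .
qed

text \<open>Cauchy's estimate on discs of radius r bounds the derivative near x by
  \<open>A * |f x| / r\<close>, so over the distance \<open>r / (2 * A)\<close> the function changes
  by at most half of \<open>|f x|\<close>.\<close>

lemma holomorphic_half_lower_bound:
  assumes hol: "f holomorphic_on UNIV" and r: "0 < r" and A: "1 \<le> A"
    and bd: "\<And>y. cmod (y - x) \<le> 2 * r \<Longrightarrow> cmod (f y) \<le> A * cmod (f x)"
    and y: "cmod (y - x) \<le> r / (2 * A)"
  shows "cmod (f x) / 2 \<le> cmod (f y)"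
proof -
  have "norm (f y - f x) \<le> (A * cmod (f x) / r) * norm (y - x)"
  proof (rule field_differentiable_bound[where S = "cball x r" and f' = "deriv f"])
    show "convex (cball x r)" by simp
    show "(f has_field_derivative deriv f z) (at z within cball x r)" if "z \<in> cball x r" for z
      by (rule has_field_derivative_at_within, rule holomorphic_derivI[OF hol]) auto
    show "norm (deriv f z) \<le> A * cmod (f x) / r" if z: "z \<in> cball x r" for z
    proof -
      have "norm ((deriv ^^ 1) f z) \<le> fact 1 * (A * cmod (f x)) / r ^ 1"
      proof (rule Cauchy_inequality)
        show "f holomorphic_on ball z r" using hol by (rule holomorphic_on_subset) simp
        show "continuous_on (cball z r) f"
          by (rule holomorphic_on_imp_continuous_on, rule holomorphic_on_subset[OF hol]) simp
        fix v assume "norm (z - v) = r"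
        then have "cmod (v - x) \<le> 2 * r"
          using z norm_triangle_ineq[of "v - z" "z - x"] by (simp add: dist_norm norm_minus_commute)
        then show "norm (f v) \<le> A * cmod (f x)" by (rule bd)
      qed (rule r)
      then show ?thesis by simp
    qed
    have "r / (2 * A) \<le> r" using r A by (simp add: divide_le_eq)
    then show "y \<in> cball x r" using y by (simp add: dist_norm norm_minus_commute)
    show "x \<in> cball x r" using r by simp
  qed
  also have "\<dots> \<le> (A * cmod (f x) / r) * (r / (2 * A))"
    using y A r by (intro mult_left_mono) auto
  also have "\<dots> = cmod (f x) / 2" using r A by simp
  finally have "norm (f x - f y) \<le> cmod (f x) / 2" by (simp add: norm_minus_commute)
  then show ?thesis using norm_triangle_ineq2[of "f x" "f y"] by linarith
qed

text \<open>The unnormalized conditional density of one particle at w when the others sit at the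
  points \<open>a i\<close>.\<close>

definition particle_weight :: "(complex \<Rightarrow> ereal) \<Rightarrow> real \<Rightarrow> nat \<Rightarrow> 'i set \<Rightarrow> ('i \<Rightarrow> complex) \<Rightarrow> complex \<Rightarrow> ennreal" where
  "particle_weight \<Phi> \<beta> N I a w = ennreal (\<Prod>i\<in>I. cmod (w - a i) powr (2 * \<beta>)) *
     eexp (- (ereal \<beta> * (ereal (real N) * \<Phi> w)))"

lemma measurable_eexp [measurable]: "eexp \<in> borel_measurable borel"
proof -
  have eq: "eexp x = (if x = -\<infinity> then 0 else if x = \<infinity> then \<infinity> else ennreal (exp (real_of_ereal x)))" for x
    by (cases x) (auto simp: eexp_def)
  show ?thesis unfolding eq[abs_def] by measurable
qed

lemma measurable_particle_weight [measurable]: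
  assumes [measurable]: "\<Phi> \<in> borel_measurable borel"
  shows "particle_weight \<Phi> \<beta> N I a \<in> borel_measurable borel"
  unfolding particle_weight_def by measurable

section \<open>The maximum of a weighted polynomial against its integral near the support\<close>

locale lipschitz_equilibrium = regular_equilibrium +
  fixes \<rho> L \<beta> :: real
  assumes rho: "0 < \<rho>" and nbhd: "{z. infdist z S \<le> \<rho>} \<subseteq> U"
    and L0: "0 \<le> L" and lip: "\<And>x y. x \<in> S \<Longrightarrow> cmod (y - x) \<le> \<rho> \<Longrightarrow> \<bar>\<phi> y - \<phi> x\<bar> \<le> L * cmod (y - x)"
    and beta: "0 < \<beta>"
begin

definition K where "K = {z. infdist z S \<le> \<rho>}"

lemma K_meas [measurable]: "K \<in> sets borel"
proof -
  have "closed K" unfolding K_def by (intro closed_Collect_le continuous_intros)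
  then show ?thesis by simp
qed

lemma S_sub_K: "S \<subseteq> K"
  using rho by (auto simp: K_def)

lemma not_K_far: "z \<notin> K \<Longrightarrow> x \<in> S \<Longrightarrow> \<rho> < cmod (x - z)"
  using infdist_le[of x S z] by (simp add: K_def dist_norm norm_minus_commute)

lemma near_K: "x \<in> S \<Longrightarrow> cmod (y - x) \<le> \<rho> \<Longrightarrow> y \<in> K"
  using infdist_le[of x S y] by (simp add: K_def dist_norm)

abbreviation T where "T N I a w \<equiv> particle_weight \<Phi> \<beta> N I a w"

abbreviation inner_mass where
  "inner_mass N I a \<equiv> (\<integral>\<^sup>+w. T N I a w * indicator K w \<partial>lborel)"

text \<open>Both sides are continuous on \<open>U - S\<close>, so the exceptional set is open; being
  null, it is empty.\<close>

lemma pot_le_phi_U: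
  assumes z: "z \<in> U" "z \<notin> S"
  shows "pot z + b \<le> \<phi> z"
proof (rule ccontr)
  assume neg: "\<not> ?thesis"
  define A where "A = {w \<in> U - S. 0 < pot w + b - \<phi> w}"
  have op: "open (U - S)" using open_U closed_S by blast
  have "continuous_on (U - S) (\<lambda>w. pot w + b - \<phi> w)"
    using continuous_on_pot cont_U
    by (intro continuous_intros) (auto elim: continuous_on_subset)
  then have "open ((\<lambda>w. pot w + b - \<phi> w) -` {0<..} \<inter> (U - S))"
    using op open_greaterThan by (simp add: continuous_on_open_vimage)
  moreover have "A = (\<lambda>w. pot w + b - \<phi> w) -` {0<..} \<inter> (U - S)" by (auto simp: A_def)
  ultimately have oA: "open A" by simp
  have zA: "z \<in> A" using z neg by (auto simp: A_def)
  have "AE w in lborel. w \<notin> A"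
    using pot_le_phi_AE
  proof eventually_elim
    case (elim w)
    show ?case
    proof
      assume "w \<in> A"
      then have w: "w \<in> U" "w \<notin> S" "\<phi> w < pot w + b" by (auto simp: A_def)
      then show False using elim Phi_U[OF w(1)] by simp
    qed
  qed
  then have "emeasure lborel A = 0"
    using oA by (subst (asm) AE_iff_measurable[of A]) auto
  then have "A \<in> null_sets lborel" using oA by (intro null_setsI) auto
  then show False using open_not_negligible[OF oA] zA by (auto simp: negligible_iff_null_sets intro: null_sets_completionI)
qed

text \<open>The factors \<open>4 powr \<beta>\<close> and \<open>exp (\<beta> * (2 * L))\<close> are
  the loss of the density against \<open>M powr \<beta>\<close> on the disc of radius
  \<open>1 / (2 * N * exp L)\<close>; the remaining quotient times \<open>N^2\<close> is the inverse
  area of that disc.\<close>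

definition c0 where
  "c0 = 4 powr \<beta> * exp (\<beta> * (2 * L)) * (4 * exp (2 * L)) / unit_ball_vol (real DIM(complex))"

lemma c0_pos: "0 < c0"
  unfolding c0_def by (intro divide_pos_pos mult_pos_pos) auto

text \<open>The clipping changes nothing within \<open>\<rho> / 2\<close> of \<open>S\<close>, because the points \<open>a j\<close> with \<open>j \<in> J\<close> lie outside
  \<open>K\<close>, but at distance at most \<open>\<rho> / 4\<close> from \<open>a j\<close> it raises the factor of \<open>j\<close> at least fourfold. This is the
  origin of the repulsion between particles of one cell.\<close>

definition clipped :: "nat set \<Rightarrow> nat set \<Rightarrow> (nat \<Rightarrow> complex) \<Rightarrow> complex \<Rightarrow> real" where
  "clipped I J a w = (\<Prod>i\<in>I. max ((cmod (w - a i))\<^sup>2) (if i \<in> J then (\<rho> / 2)\<^sup>2 else 0))"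

text \<open>At the point \<open>x\<^sub>0\<close> of \<open>S\<close> where the weighted polynomial is maximal, the domination principle
  controls it on a disc of radius \<open>2 / N\<close>, and Cauchy's estimate shows that it stays comparable to
  its maximum on a disc of radius of order \<open>1 / N\<close>.\<close>

lemma max_le_integral:
  assumes I: "finite I" "card I < N" and N: "4 \<le> real N * \<rho>"
    and J: "\<And>j. j \<in> J \<Longrightarrow> a j \<notin> K"
  shows "\<exists>M\<ge>0. (\<forall>w. w \<notin> S \<longrightarrow> clipped I J a w \<le> M * exp (real N * (pot w + b))) \<and>
     ennreal (M powr \<beta>) \<le> ennreal (c0 * (real N)\<^sup>2) * inner_mass N I a"
proof -
  let ?d = "\<lambda>i. if i \<in> J then (\<rho> / 2)\<^sup>2 else 0"
  let ?f = "clipped I J a"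
  have N0: "0 < real N" using I by simp
  have cf: "continuous_on A ?f" for A unfolding clipped_def by (intro continuous_intros)
  have cF: "continuous_on S (\<lambda>x. ?f x * exp (- real N * \<phi> x))"
    by (intro continuous_intros cf continuous_on_subset[OF cont_U S_sub])
  obtain x0 where x0: "x0 \<in> S" "\<And>x. x \<in> S \<Longrightarrow> ?f x * exp (- real N * \<phi> x) \<le> ?f x0 * exp (- real N * \<phi> x0)"
    using continuous_attains_sup[OF compact_S S_nonempty cF] by blast
  define M where "M = ?f x0 * exp (- real N * \<phi> x0)"
  have f0: "0 \<le> ?f w" for w unfolding clipped_def by (intro prod_nonneg) (auto simp: le_max_iff_disj)
  have M0: "0 \<le> M" unfolding M_def using f0 by simp
  have bd: "?f x \<le> M * exp (real N * \<phi> x)" if "x \<in> S" for x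
  proof -
    have "?f x * exp (- real N * \<phi> x) * exp (real N * \<phi> x) \<le> M * exp (real N * \<phi> x)"
      using x0(2)[OF that] unfolding M_def by (intro mult_right_mono) auto
    then show ?thesis by (simp add: mult.assoc mult_exp_exp)
  qed
  have dom: "?f w \<le> M * exp (real N * (pot w + b))" if "w \<notin> S" for w
    unfolding clipped_def
    by (rule domination[OF I _ M0 _ that]) (use bd in \<open>auto simp: clipped_def\<close>)
  have domU: "?f w \<le> M * exp (real N * \<phi> w)" if w: "w \<in> U" for w
  proof (cases "w \<in> S")
    case False
    have "?f w \<le> M * exp (real N * (pot w + b))" by (rule dom[OF False])
    also have "\<dots> \<le> M * exp (real N * \<phi> w)"
      using pot_le_phi_U[OF w False] M0 by (intro mult_left_mono) (auto intro!: mult_left_mono)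
    finally show ?thesis .
  qed (rule bd)
  define P where "P y = (\<Prod>i\<in>I. y - a i)" for y
  have holP: "P holomorphic_on UNIV" unfolding P_def by (intro holomorphic_intros)
  \<comment> \<open>On the scale 1/N the exponent \<open>N * \<phi>\<close> varies only by a
    constant, and \<open>4 \<le> N * \<rho>\<close> keeps the disc of radius \<open>2 * r\<close>
    within \<open>\<rho> / 2\<close> of x0, where the clipping is inactive.\<close>
  define r where "r = 1 / real N"
  have r: "0 < r" "2 * r \<le> \<rho> / 2" using N N0 by (auto simp: r_def field_simps)
  have fP: "?f y = (cmod (P y))\<^sup>2" if y: "cmod (y - x0) \<le> 2 * r" for y
  proof -
    have "max ((cmod (y - a i))\<^sup>2) (?d i) = (cmod (y - a i))\<^sup>2" if i: "i \<in> I" for i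
    proof (cases "i \<in> J")
      case True
      have "\<rho> < cmod (x0 - a i)" by (rule not_K_far[OF J[OF True] x0(1)])
      moreover have "cmod (x0 - a i) - cmod (x0 - y) \<le> cmod (y - a i)"
        using norm_triangle_ineq2[of "x0 - a i" "x0 - y"] by simp
      ultimately have "\<rho> / 2 \<le> cmod (y - a i)" using y r norm_minus_commute[of x0 y] by linarith
      then have "(\<rho> / 2)\<^sup>2 \<le> (cmod (y - a i))\<^sup>2" using rho by (intro power_mono) auto
      then show ?thesis using True by (simp add: max_absorb1)
    qed simp
    then have "?f y = (\<Prod>i\<in>I. (cmod (y - a i))\<^sup>2)" unfolding clipped_def by (intro prod.cong) auto
    then show ?thesis unfolding P_def by (simp add: prod_norm[symmetric] prod_power_distrib)
  qed
  have MP: "M = (cmod (P x0))\<^sup>2 * exp (- real N * \<phi> x0)" unfolding M_def using fP[of x0] r by simp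
  have philip: "\<bar>real N * \<phi> y - real N * \<phi> x0\<bar> \<le> 2 * L" if y: "cmod (y - x0) \<le> 2 * r" for y
  proof -
    have "\<bar>\<phi> y - \<phi> x0\<bar> \<le> L * cmod (y - x0)" using y r rho by (intro lip x0) auto
    also have "\<dots> \<le> L * (2 * r)" using y L0 by (intro mult_left_mono) auto
    finally have "real N * \<bar>\<phi> y - \<phi> x0\<bar> \<le> real N * (L * (2 * r))" using N0 by (intro mult_left_mono) auto
    moreover have "real N * (L * (2 * r)) = 2 * L" using N0 by (simp add: r_def)
    moreover have "\<bar>real N * \<phi> y - real N * \<phi> x0\<bar> = real N * \<bar>\<phi> y - \<phi> x0\<bar>"
      by (simp add: abs_mult right_diff_distrib[symmetric])
    ultimately show ?thesis by simp
  qed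
  \<comment> \<open>Off S this is the domination principle, on S the maximality of x0. Passing from
    the exponent at y to the one at x0 costs \<open>exp (2 * L)\<close> for the square.\<close>
  have Pbd: "cmod (P y) \<le> exp L * cmod (P x0)" if y: "cmod (y - x0) \<le> 2 * r" for y
  proof -
    have yU: "y \<in> U" using near_K[OF x0(1), of y] y r nbhd rho by (auto simp: K_def)
    have "(cmod (P y))\<^sup>2 \<le> M * exp (real N * \<phi> y)" using domU[OF yU] fP[OF y] by simp
    also have "\<dots> = (cmod (P x0))\<^sup>2 * exp (real N * \<phi> y - real N * \<phi> x0)"
      unfolding MP by (simp add: exp_diff exp_minus field_simps)
    also have "\<dots> \<le> (cmod (P x0))\<^sup>2 * exp (2 * L)" using philip[OF y] by (intro mult_left_mono) auto
    also have "\<dots> = (exp L * cmod (P x0))\<^sup>2" by (simp add: power_mult_distrib exp_double)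
    finally show ?thesis by (rule power2_le_imp_le) simp
  qed
  define s where "s = r / (2 * exp L)"
  have eL: "1 \<le> exp L" using L0 by simp
  have "1 \<le> 2 * exp L" using eL by linarith
  then have "s \<le> r / 1" unfolding s_def by (rule divide_left_mono) (use r in simp_all)
  then have s: "0 < s" "s \<le> r" using r by (auto simp: s_def)
  have low: "ennreal (M powr \<beta> * (4 powr (- \<beta>) * exp (- (\<beta> * (2 * L))))) \<le> T N I a y"
    if y: "cmod (y - x0) \<le> s" for y
  proof -
    have y2: "cmod (y - x0) \<le> 2 * r" using y s r by linarith
    have yU: "y \<in> U" using near_K[OF x0(1), of y] y2 r nbhd rho by (auto simp: K_def)
    have half: "cmod (P x0) / 2 \<le> cmod (P y)"
      by (rule holomorphic_half_lower_bound[OF holP r(1) _ Pbd]) (use y L0 in \<open>auto simp: s_def\<close>)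
    have "(M * (1/4 * exp (- (2 * L)))) \<le> (cmod (P y))\<^sup>2 * exp (- real N * \<phi> y)"
    proof -
      have "M * (1/4 * exp (- (2 * L))) = (cmod (P x0) / 2)\<^sup>2 * exp (- real N * \<phi> x0 - 2 * L)"
        unfolding MP by (simp add: power_divide exp_diff exp_minus field_simps)
      also have "\<dots> \<le> (cmod (P y))\<^sup>2 * exp (- real N * \<phi> y)"
        using half philip[OF y2] by (intro mult_mono power_mono) (auto simp: abs_le_iff)
      finally show ?thesis .
    qed
    then have "(M * (1/4 * exp (- (2 * L)))) powr \<beta> \<le> ((cmod (P y))\<^sup>2 * exp (- real N * \<phi> y)) powr \<beta>"
      using M0 beta by (intro powr_mono2) auto
    moreover have "(M * (1/4 * exp (- (2 * L)))) powr \<beta> = M powr \<beta> * (4 powr (- \<beta>) * exp (- (\<beta> * (2 * L))))"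
    proof -
      have "(1/4 * exp (- (2 * L))) powr \<beta> = (1/4) powr \<beta> * exp (- (2 * L)) powr \<beta>" by (rule powr_mult)
      moreover have "(1/4::real) powr \<beta> = 4 powr (- \<beta>)" by (simp add: powr_divide powr_minus_divide)
      moreover have "exp (- (2 * L)) powr \<beta> = exp (- (\<beta> * (2 * L)))" by (simp add: powr_def)
      ultimately show ?thesis by (simp only: powr_mult)
    qed
    moreover have "((cmod (P y))\<^sup>2 * exp (- real N * \<phi> y)) powr \<beta> = (\<Prod>i\<in>I. cmod (y - a i) powr (2 * \<beta>)) * exp (- (\<beta> * (real N * \<phi> y)))"
    proof -
      have "((cmod (P y))\<^sup>2) powr \<beta> = (\<Prod>i\<in>I. cmod (y - a i)) powr (2 * \<beta>)"
        by (simp add: P_def prod_norm[symmetric] power2_eq_square powr_mult powr_add[symmetric])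
      also have "\<dots> = (\<Prod>i\<in>I. cmod (y - a i) powr (2 * \<beta>))"
        by (rule prod_powr_distrib)
      finally have "((cmod (P y))\<^sup>2) powr \<beta> = (\<Prod>i\<in>I. cmod (y - a i) powr (2 * \<beta>))" .
      moreover have "exp (- real N * \<phi> y) powr \<beta> = exp (- (\<beta> * (real N * \<phi> y)))" by (simp add: powr_def)
      ultimately show ?thesis by (simp add: powr_mult)
    qed
    moreover have "T N I a y = ennreal ((\<Prod>i\<in>I. cmod (y - a i) powr (2 * \<beta>)) * exp (- (\<beta> * (real N * \<phi> y))))"
      unfolding particle_weight_def Phi_U[OF yU] by (simp add: eexp_def ennreal_mult prod_nonneg)
    ultimately show ?thesis by (simp add: ennreal_leI)
  qed
  define m where "m = M powr \<beta> * (4 powr (- \<beta>) * exp (- (\<beta> * (2 * L))))"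
  have m0: "0 \<le> m" unfolding m_def by simp
  define v where "v = unit_ball_vol (real DIM(complex))"
  have v: "0 < v" unfolding v_def by simp
  have "ennreal m * ennreal (v * s\<^sup>2) = (\<integral>\<^sup>+w. ennreal m * indicator (ball x0 s) w \<partial>lborel)"
    using s by (subst nn_integral_cmult_indicator) (simp_all add: emeasure_ball v_def)
  also have "\<dots> \<le> inner_mass N I a"
  proof (rule nn_integral_mono)
    fix w
    show "ennreal m * indicator (ball x0 s) w \<le> T N I a w * indicator K w"
    proof (cases "w \<in> ball x0 s")
      case True
      then have 1: "cmod (w - x0) \<le> s" by (simp add: dist_norm norm_minus_commute)
      moreover have "w \<in> K" using near_K[OF x0(1), of w] 1 s r rho by auto
      ultimately show ?thesis using low[OF 1] True by (simp add: m_def)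
    qed simp
  qed
  finally have int: "ennreal (m * (v * s\<^sup>2)) \<le> inner_mass N I a"
    using m0 v by (simp add: ennreal_mult)
  have eq: "M powr \<beta> = c0 * (real N)\<^sup>2 * (m * (v * s\<^sup>2))"
  proof -
    define e1 where "e1 = exp (\<beta> * (2 * L))"
    define e2 where "e2 = exp L"
    define p where "p = 4 powr \<beta>"
    have pos: "0 < e1" "0 < e2" "0 < p" by (auto simp: e1_def e2_def p_def)
    have 1: "exp (2 * L) = e2\<^sup>2" by (simp add: e2_def exp_double)
    have 2: "exp (- (\<beta> * (2 * L))) = 1 / e1" by (simp add: e1_def exp_minus inverse_eq_divide)
    have 3: "4 powr (- \<beta>) = 1 / p" by (simp add: p_def powr_minus_divide)
    show ?thesis
      unfolding c0_def m_def s_def r_def 1 2 3 v_def[symmetric] e1_def[symmetric] e2_def[symmetric] p_def[symmetric]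
      using pos v N0 by (simp add: power2_eq_square field_simps)
  qed
  have "ennreal (M powr \<beta>) = ennreal (c0 * (real N)\<^sup>2) * ennreal (m * (v * s\<^sup>2))"
    unfolding eq using c0_pos m0 v by (intro ennreal_mult) auto
  also have "\<dots> \<le> ennreal (c0 * (real N)\<^sup>2) * inner_mass N I a"
    by (intro mult_left_mono int) simp
  finally have fin: "ennreal (M powr \<beta>) \<le> ennreal (c0 * (real N)\<^sup>2) * inner_mass N I a" .
  show ?thesis using M0 dom fin by blast
qed

end

section \<open>The cost of one particle in a cell\<close>

context lipschitz_equilibrium
begin

text \<open>A point of J within \<open>\<rho> / 4\<close> of w contributes at most a quarter of its
  clip level \<open>(\<rho> / 2)^2\<close>, hence the factor \<open>4 powr (- \<beta>)\<close> after
  raising to the power \<beta>. The gap \<open>r - pot w - b\<close> is kept because the region near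
  infinity draws its decay from it.\<close>

lemma particle_weight_le:
  assumes I: "finite I" "J \<subseteq> I" and w: "w \<notin> S" and near: "\<And>j. j \<in> J \<Longrightarrow> cmod (w - a j) \<le> \<rho> / 4"
    and M: "0 \<le> M" "clipped I J a w \<le> M * exp (real N * (pot w + b))" and r: "\<Phi> w = ereal r"
  shows "T N I a w \<le> ennreal ((4 powr (- \<beta>)) ^ card J * M powr \<beta> * exp (- (\<beta> * real N * (r - pot w - b))))"
proof -
  define X where "X = (\<Prod>i\<in>I. cmod (w - a i))"
  define n where "n = card J"
  have "4 ^ n * X\<^sup>2 = (\<Prod>i\<in>I. (if i \<in> J then 4 else 1) * (cmod (w - a i))\<^sup>2)"
  proof -
    have "(\<Prod>i\<in>I. if i \<in> J then 4 else 1) = (4::real) ^ n"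
      using I by (simp add: prod.If_cases n_def Int_absorb1)
    then show ?thesis by (simp add: prod.distrib X_def prod_power_distrib)
  qed
  also have "\<dots> \<le> clipped I J a w"
    unfolding clipped_def
  proof (intro prod_mono conjI)
    fix i assume i: "i \<in> I"
    show "(if i \<in> J then 4 else 1) * (cmod (w - a i))\<^sup>2 \<le> max ((cmod (w - a i))\<^sup>2) (if i \<in> J then (\<rho> / 2)\<^sup>2 else 0)"
    proof (cases "i \<in> J")
      case True
      have "(cmod (w - a i))\<^sup>2 \<le> (\<rho> / 4)\<^sup>2" using near[OF True] by (intro power_mono) auto
      then have "4 * (cmod (w - a i))\<^sup>2 \<le> (\<rho> / 2)\<^sup>2" by (simp add: power_divide)
      then show ?thesis using True by (simp add: le_max_iff_disj)
    qed simp
  qed simp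
  also have "\<dots> \<le> M * exp (real N * (pot w + b))" by (rule M)
  finally have "X\<^sup>2 \<le> (1/4) ^ n * (M * exp (real N * (pot w + b)))"
    by (simp add: power_divide field_simps)
  then have "(X\<^sup>2) powr \<beta> \<le> ((1/4) ^ n * (M * exp (real N * (pot w + b)))) powr \<beta>"
    using beta by (intro powr_mono2) auto
  moreover have "((1/4::real) ^ n) powr \<beta> = (4 powr (- \<beta>)) ^ n"
  proof -
    have "(1/4::real) powr \<beta> = 4 powr (- \<beta>)" by (simp add: powr_divide powr_minus_divide)
    moreover have "(x ^ n) powr \<beta> = (x powr \<beta>) ^ n" for x :: real by (induction n) (simp_all add: powr_mult)
    ultimately show ?thesis by simp
  qed
  moreover have "exp (real N * (pot w + b)) powr \<beta> = exp (\<beta> * (real N * (pot w + b)))" by (simp add: powr_def)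
  moreover have "(X\<^sup>2) powr \<beta> = (\<Prod>i\<in>I. cmod (w - a i) powr (2 * \<beta>))"
  proof -
    have "(X\<^sup>2) powr \<beta> = X powr (2 * \<beta>)"
      by (simp add: power2_eq_square powr_mult powr_add[symmetric])
    then show ?thesis by (simp only: X_def prod_powr_distrib)
  qed
  ultimately have le: "(\<Prod>i\<in>I. cmod (w - a i) powr (2 * \<beta>)) \<le> (4 powr (- \<beta>)) ^ n * (M powr \<beta> * exp (\<beta> * (real N * (pot w + b))))"
    by (simp only: powr_mult)
  have "T N I a w = ennreal ((\<Prod>i\<in>I. cmod (w - a i) powr (2 * \<beta>)) * exp (- (\<beta> * (real N * r))))"
    unfolding particle_weight_def r by (simp add: eexp_def ennreal_mult prod_nonneg)
  also have "\<dots> \<le> ennreal (((4 powr (- \<beta>)) ^ n * (M powr \<beta> * exp (\<beta> * (real N * (pot w + b))))) * exp (- (\<beta> * (real N * r))))"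
    by (intro ennreal_leI mult_right_mono le) auto
  also have "((4 powr (- \<beta>)) ^ n * (M powr \<beta> * exp (\<beta> * (real N * (pot w + b))))) * exp (- (\<beta> * (real N * r)))
     = (4 powr (- \<beta>)) ^ n * M powr \<beta> * exp (- (\<beta> * real N * (r - pot w - b)))"
  proof -
    have "exp (\<beta> * (real N * (pot w + b))) * exp (- (\<beta> * (real N * r))) = exp (- (\<beta> * real N * (r - pot w - b)))"
      unfolding mult_exp_exp by (simp add: algebra_simps)
    then show ?thesis by (simp only: mult.assoc)
  qed
  finally show ?thesis by (simp add: n_def)
qed

text \<open>Moving a particle from \<open>B\<close> into \<open>K\<close> costs at most a factor \<open>X\<close>, and gains a factor \<open>Y\<close> for every further
  particle in \<open>B\<close>.\<close>

definition cell :: "nat \<Rightarrow> complex set \<Rightarrow> ennreal \<Rightarrow> ennreal \<Rightarrow> bool" where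
  "cell N B X Y \<longleftrightarrow> (\<forall>(I :: nat set) J a. finite I \<and> card I < N \<and> J \<subseteq> I \<and> (\<forall>j\<in>J. a j \<in> B) \<longrightarrow>
     (\<integral>\<^sup>+w. T N I a w * indicator B w \<partial>lborel) \<le> X * Y ^ card J * inner_mass N I a)"

lemma cell_mono:
  assumes "cell N B X Y" "B' \<subseteq> B"
  shows "cell N B' X Y"
  unfolding cell_def
proof (intro allI impI, elim conjE)
  fix I J :: "nat set" and a assume a: "finite I" "card I < N" "J \<subseteq> I" "\<forall>j\<in>J. a j \<in> B'"
  have "(\<integral>\<^sup>+w. T N I a w * indicator B' w \<partial>lborel) \<le> (\<integral>\<^sup>+w. T N I a w * indicator B w \<partial>lborel)"
    using assms(2) by (intro nn_integral_mono) (auto simp: indicator_def)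
  also have "\<dots> \<le> X * Y ^ card J * inner_mass N I a"
    using assms a unfolding cell_def by blast
  finally show "(\<integral>\<^sup>+w. T N I a w * indicator B' w \<partial>lborel) \<le> X * Y ^ card J * inner_mass N I a" .
qed

lemma particle_weight_infinite: "\<Phi> w = \<infinity> \<Longrightarrow> 0 < N \<Longrightarrow> T N I a w = 0"
  using beta by (simp add: particle_weight_def eexp_def)

text \<open>The bound on the diameter lets every particle of J count as close to w. As
  \<open>pot + b \<le> \<Phi>\<close> almost everywhere off S, the exponential of the gap is at most
  one, and what remains is constant on B and contributes the volume.\<close>

lemma near_cell:
  assumes B [measurable]: "B \<in> sets borel" and BK: "B \<inter> K = {}"
    and diam: "\<And>x y. x \<in> B \<Longrightarrow> y \<in> B \<Longrightarrow> cmod (x - y) \<le> \<rho> / 4"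
    and vol: "emeasure lborel B \<le> ennreal v" and v: "0 \<le> v" and N: "4 \<le> real N * \<rho>"
  shows "cell N B (ennreal (c0 * (real N)\<^sup>2 * v)) (ennreal (4 powr (- \<beta>)))"
  unfolding cell_def
proof (intro allI impI, elim conjE)
  fix I J :: "nat set" and a assume I: "finite I" "card I < N" "J \<subseteq> I" and J: "\<forall>j\<in>J. a j \<in> B"
  have JK: "a j \<notin> K" if "j \<in> J" for j using J BK that by auto
    have ex: "\<exists>M\<ge>0. (\<forall>w. w \<notin> S \<longrightarrow> clipped I J a w \<le> M * exp (real N * (pot w + b))) \<and>
      ennreal (M powr \<beta>) \<le> ennreal (c0 * (real N)\<^sup>2) * inner_mass N I a"
      by (rule max_le_integral[OF I(1,2) N], erule JK)
  obtain M where M: "0 \<le> M" "\<And>w. w \<notin> S \<Longrightarrow> clipped I J a w \<le> M * exp (real N * (pot w + b))"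
    "ennreal (M powr \<beta>) \<le> ennreal (c0 * (real N)\<^sup>2) * inner_mass N I a"
    using ex by blast
  define Y where "Y = 4 powr (- \<beta>)"
  have "(\<integral>\<^sup>+w. T N I a w * indicator B w \<partial>lborel) \<le> (\<integral>\<^sup>+w. ennreal (Y ^ card J * M powr \<beta>) * indicator B w \<partial>lborel)"
  proof (rule nn_integral_mono_AE, use pot_le_phi_AE in eventually_elim)
    fix w assume el: "w \<notin> S \<longrightarrow> ereal (pot w + b) \<le> \<Phi> w"
    show "T N I a w * indicator B w \<le> ennreal (Y ^ card J * M powr \<beta>) * indicator B w"
    proof (cases "w \<in> B")
      case w: True
      then have wS: "w \<notin> S" using BK S_sub_K by auto
      show ?thesis
      proof (cases "\<Phi> w")
        case (real r)
        have "T N I a w \<le> ennreal (Y ^ card J * M powr \<beta> * exp (- (\<beta> * real N * (r - pot w - b))))"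
          unfolding Y_def
          by (rule particle_weight_le[OF I(1,3) wS diam[OF w bspec[OF J]] M(1) M(2)[OF wS] real])
        also have "\<dots> \<le> ennreal (Y ^ card J * M powr \<beta> * 1)"
          using el wS real beta by (intro ennreal_leI mult_left_mono) (auto simp: Y_def)
        finally show ?thesis using w by simp
      next
        case PInf
        then show ?thesis using particle_weight_infinite[OF PInf, of N I a] I by simp
      qed (use weight_growthD(4)[OF growth, of w] in auto)
    qed simp
  qed
  also have "\<dots> = ennreal (Y ^ card J * M powr \<beta>) * emeasure lborel B"
    by (subst nn_integral_cmult_indicator) auto
  also have "\<dots> \<le> ennreal (Y ^ card J * M powr \<beta>) * ennreal v"
    by (intro mult_left_mono vol) simp
  also have "\<dots> = ennreal v * ennreal Y ^ card J * ennreal (M powr \<beta>)"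
    by (simp add: ennreal_mult Y_def ennreal_power mult_ac)
  also have "\<dots> \<le> ennreal v * ennreal Y ^ card J * (ennreal (c0 * (real N)\<^sup>2) * inner_mass N I a)"
    by (intro mult_left_mono M) simp
  also have "\<dots> = ennreal (c0 * (real N)\<^sup>2 * v) * ennreal Y ^ card J * inner_mass N I a"
    using c0_pos v by (simp add: ennreal_mult mult_ac)
  finally show "(\<integral>\<^sup>+w. T N I a w * indicator B w \<partial>lborel) \<le> ennreal (c0 * (real N)\<^sup>2 * v) * ennreal (4 powr (- \<beta>)) ^ card J * inner_mass N I a"
    by (simp add: Y_def)
qed

definition decay_const :: real where
  "decay_const = enn2real (\<integral>\<^sup>+w. ennreal (1 / (1 + (cmod w)\<^sup>2)\<^sup>2) \<partial>lborel)"

lemma pot_upper: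
  assumes R: "\<And>x. x \<in> S \<Longrightarrow> cmod x \<le> R" and w: "w \<notin> S"
  shows "pot w \<le> ln (1 + (cmod w)\<^sup>2) + ln (1 + R\<^sup>2)"
proof -
  interpret finite_measure \<mu> by (rule finite_measure_mu)
  have "pot w \<le> (\<integral>s. ln (1 + (cmod w)\<^sup>2) + ln (1 + R\<^sup>2) \<partial>\<mu>)"
    unfolding pot_def
  proof (rule integral_mono_AE)
    show "AE s in \<mu>. ln ((cmod (w - s))\<^sup>2) \<le> ln (1 + (cmod w)\<^sup>2) + ln (1 + R\<^sup>2)"
      using AE_S
    proof eventually_elim
      case (elim s)
      have "(cmod s)\<^sup>2 \<le> R\<^sup>2" using R[OF elim] by (intro power_mono) auto
      then have "ln (1 + (cmod s)\<^sup>2) \<le> ln (1 + R\<^sup>2)" by (intro ln_mono) (auto intro: add_pos_nonneg)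
      then show ?case using ln_cmod_diff_le[of w s] by linarith
    qed
  qed (use integrable_off_S[OF w] in auto)
  then show ?thesis using prob_mu_measure by simp
qed

text \<open>An unbounded region has no diameter, so J is ignored and \<open>Y = 1\<close>. In place
  of repulsion there is a gap: \<Phi> exceeds \<open>pot + b\<close> by
  \<open>\<epsilon> * ln (1 + |w|^2)\<close> up to a constant, which yields
  \<open>exp (- (\<beta> * N))\<close> times an integrable factor.\<close>

lemma far_cell:
  "\<exists>R>0. \<forall>N. 4 \<le> real N * \<rho> \<longrightarrow> 4 \<le> \<beta> * real N * \<epsilon> \<longrightarrow>
     cell N {w. R < cmod w} (ennreal (c0 * (real N)\<^sup>2 * (exp (- (\<beta> * real N)) * decay_const))) 1"
proof -
  obtain R0 where R0: "0 < R0" "\<And>x. x \<in> S \<Longrightarrow> cmod x \<le> R0" using S_bound by blast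
  define C2 where "C2 = C + ln (1 + R0\<^sup>2) + b"
  \<comment> \<open>Beyond R one half of \<open>\<epsilon> * l\<close> absorbs
    \<open>C2 + 1\<close>; the other half, multiplied by
    \<open>\<beta> * N \<ge> 4 / \<epsilon>\<close>, yields the integrable factor
    \<open>(1 + |w|^2)^(-2)\<close>.\<close>
  define R where "R = R0 + 1 + exp (2 * (C2 + 1) / \<epsilon>)"
  have Rp: "0 < R" "R0 < R" "1 \<le> R" unfolding R_def using R0 exp_gt_zero[of "2 * (C2 + 1) / \<epsilon>"] by linarith+
  have "cell N {w. R < cmod w} (ennreal (c0 * (real N)\<^sup>2 * (exp (- (\<beta> * real N)) * decay_const))) 1"
    if N: "4 \<le> real N * \<rho>" and Ne: "4 \<le> \<beta> * real N * \<epsilon>" for N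
    unfolding cell_def
  proof (intro allI impI, elim conjE)
    fix I J :: "nat set" and a assume I: "finite I" "card I < N" and "J \<subseteq> I" "\<forall>j\<in>J. a j \<in> {w. R < cmod w}"
    have ex: "\<exists>M\<ge>0. (\<forall>w. w \<notin> S \<longrightarrow> clipped I {} a w \<le> M * exp (real N * (pot w + b))) \<and>
      ennreal (M powr \<beta>) \<le> ennreal (c0 * (real N)\<^sup>2) * inner_mass N I a"
      by (rule max_le_integral[OF I N], erule emptyE)
    obtain M where M: "0 \<le> M" "\<And>w. w \<notin> S \<Longrightarrow> clipped I {} a w \<le> M * exp (real N * (pot w + b))"
      "ennreal (M powr \<beta>) \<le> ennreal (c0 * (real N)\<^sup>2) * inner_mass N I a"
    using ex by blast
    define D where "D = M powr \<beta> * exp (- (\<beta> * real N))"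
    have D0: "0 \<le> D" by (simp add: D_def)
    have "(\<integral>\<^sup>+w. T N I a w * indicator {w. R < cmod w} w \<partial>lborel) \<le> (\<integral>\<^sup>+w. ennreal D * ennreal (1 / (1 + (cmod w)\<^sup>2)\<^sup>2) \<partial>lborel)"
    proof (rule nn_integral_mono)
      fix w
      show "T N I a w * indicator {w. R < cmod w} w \<le> ennreal D * ennreal (1 / (1 + (cmod w)\<^sup>2)\<^sup>2)"
      proof (cases "R < cmod w")
        case w: True
        then have wS: "w \<notin> S" using R0(2)[of w] Rp by auto
        show ?thesis
        proof (cases "\<Phi> w")
          case (real r)
          define l where "l = ln (1 + (cmod w)\<^sup>2)"
          have l0: "0 \<le> l" by (simp add: l_def)
          have "(1 + \<epsilon>) * l - C \<le> r" using weight_growthD(1)[OF growth, of w] real by (simp add: l_def)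
          moreover have "pot w \<le> l + ln (1 + R0\<^sup>2)" unfolding l_def by (rule pot_upper[OF R0(2) wS])
          ultimately have gap: "\<epsilon> * l - C2 \<le> r - pot w - b" by (simp add: C2_def algebra_simps)
          have "exp (2 * (C2 + 1) / \<epsilon>) \<le> 1 + (cmod w)\<^sup>2"
          proof -
            have "exp (2 * (C2 + 1) / \<epsilon>) \<le> R" using R0 unfolding R_def by simp
            also have "\<dots> \<le> cmod w" using w by simp
            also have "\<dots> \<le> (cmod w)\<^sup>2" using w Rp by (intro self_le_power) auto
            finally show ?thesis by simp
          qed
          then have "ln (exp (2 * (C2 + 1) / \<epsilon>)) \<le> l" unfolding l_def by (intro ln_mono) auto
          then have "2 * (C2 + 1) \<le> \<epsilon> * l" using eps_pos by (simp add: field_simps)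
          then have gap2: "1 + \<epsilon> / 2 * l \<le> r - pot w - b" using gap by simp
          have "\<beta> * real N + 2 * l \<le> \<beta> * real N * (r - pot w - b)"
          proof -
            have "\<beta> * real N * (1 + \<epsilon> / 2 * l) \<le> \<beta> * real N * (r - pot w - b)"
              using gap2 beta by (intro mult_left_mono) auto
            moreover have "2 * l \<le> (\<beta> * real N * \<epsilon> / 2) * l" using Ne l0 by (intro mult_right_mono) auto
            ultimately show ?thesis by (simp add: algebra_simps)
          qed
          then have "exp (- (\<beta> * real N * (r - pot w - b))) \<le> exp (- (\<beta> * real N) - 2 * l)" by simp
          also have "\<dots> = exp (- (\<beta> * real N)) * (1 / (1 + (cmod w)\<^sup>2)\<^sup>2)"
          proof -
            have "exp l = 1 + (cmod w)\<^sup>2" unfolding l_def by (rule exp_ln) (auto intro: add_pos_nonneg)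
            then show ?thesis by (simp add: exp_diff exp_double)
          qed
          finally have e: "exp (- (\<beta> * real N * (r - pot w - b))) \<le> exp (- (\<beta> * real N)) * (1 / (1 + (cmod w)\<^sup>2)\<^sup>2)" .
          have "T N I a w \<le> ennreal ((4 powr (- \<beta>)) ^ card ({} :: nat set) * M powr \<beta> * exp (- (\<beta> * real N * (r - pot w - b))))"
            by (rule particle_weight_le[OF I(1) _ wS _ M(1) M(2)[OF wS] real]) auto
          also have "\<dots> \<le> ennreal (M powr \<beta> * (exp (- (\<beta> * real N)) * (1 / (1 + (cmod w)\<^sup>2)\<^sup>2)))"
            by (intro ennreal_leI) (use mult_left_mono[OF e, of "M powr \<beta>"] in simp)
          also have "\<dots> = ennreal D * ennreal (1 / (1 + (cmod w)\<^sup>2)\<^sup>2)"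
            unfolding D_def by (subst ennreal_mult[symmetric]) (auto simp: mult.assoc)
          finally show ?thesis using w by simp
        next
          case PInf
          then show ?thesis using particle_weight_infinite[OF PInf, of N I a] I by simp
        qed (use weight_growthD(4)[OF growth, of w] in auto)
      qed simp
    qed
    also have "\<dots> = ennreal D * ennreal decay_const"
    proof -
      have "ennreal decay_const = (\<integral>\<^sup>+w. ennreal (1 / (1 + (cmod w)\<^sup>2)\<^sup>2) \<partial>lborel)"
        unfolding decay_const_def using nn_integral_decay_finite by (intro ennreal_enn2real) simp
      then show ?thesis by (subst nn_integral_cmult) simp_all
    qed
    also have "\<dots> = ennreal (exp (- (\<beta> * real N)) * decay_const) * ennreal (M powr \<beta>)"
      by (simp add: D_def ennreal_mult decay_const_def mult_ac)
    also have "\<dots> \<le> ennreal (exp (- (\<beta> * real N)) * decay_const) * (ennreal (c0 * (real N)\<^sup>2) * inner_mass N I a)"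
      by (intro mult_left_mono M) simp
    also have "\<dots> = ennreal (c0 * (real N)\<^sup>2 * (exp (- (\<beta> * real N)) * decay_const)) * 1 ^ card J * inner_mass N I a"
      using c0_pos by (simp add: ennreal_mult decay_const_def mult_ac)
    finally show "(\<integral>\<^sup>+w. T N I a w * indicator {w. R < cmod w} w \<partial>lborel) \<le> \<dots>" .
  qed
  then show ?thesis using Rp by blast
qed

end

section \<open>Confinement of the gas\<close>

lemma prod_pairs_split:
  fixes g :: "complex \<Rightarrow> complex \<Rightarrow> real"
  assumes i: "i < (N::nat)" and sym: "\<And>x y. g x y = g y x"
  shows "(\<Prod>(j, l)\<in>{(j, l). j < l \<and> l < N}. g (z j) (z l)) =
    (\<Prod>(j, l)\<in>{(j, l). j < l \<and> l < N \<and> j \<noteq> i \<and> l \<noteq> i}. g (z j) (z l)) * (\<Prod>j\<in>{..<N} - {i}. g (z i) (z j))"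
proof -
  let ?A = "{(j, l). j < l \<and> l < N \<and> j \<noteq> i \<and> l \<noteq> i}"
  let ?B = "{(j, l). j < l \<and> l < N \<and> (j = i \<or> l = i)}"
  have fin: "finite {(j, l). j < l \<and> l < N}"
    by (rule finite_subset[of _ "{..<N} \<times> {..<N}"]) auto
  have fA: "finite ?A" and fB: "finite ?B"
    by (rule finite_subset[OF _ fin], auto)+
  have "{(j, l). j < l \<and> l < N} = ?A \<union> ?B" by auto
  then have "(\<Prod>(j, l)\<in>{(j, l). j < l \<and> l < N}. g (z j) (z l)) = (\<Prod>(j, l)\<in>?A. g (z j) (z l)) * (\<Prod>(j, l)\<in>?B. g (z j) (z l))"
    by (simp only:) (rule prod.union_disjoint[OF fA fB], auto)
  also have "(\<Prod>(j, l)\<in>?B. g (z j) (z l)) = (\<Prod>j\<in>{..<N} - {i}. g (z i) (z j))"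
  proof (rule prod.reindex_bij_witness[of _ "\<lambda>j. (min i j, max i j)" "\<lambda>(j, l). if j = i then l else j"])
    fix x assume "x \<in> ?B"
    then show "g (z i) (z (case x of (j, l) \<Rightarrow> if j = i then l else j)) = (case x of (j, l) \<Rightarrow> g (z j) (z l))"
      using sym by auto
  qed (use i in \<open>auto simp: min_def max_def split: if_splits\<close>)
  finally show ?thesis .
qed

abbreviation configurations :: "nat \<Rightarrow> (nat \<Rightarrow> complex) measure" where
  "configurations N \<equiv> \<Pi>\<^sub>M i\<in>{..<N}. lborel"

definition rest_weight :: "nat \<Rightarrow> real \<Rightarrow> (complex \<Rightarrow> ereal) \<Rightarrow> nat \<Rightarrow> (nat \<Rightarrow> complex) \<Rightarrow> ennreal" where
  "rest_weight N \<beta> V i z =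
     ennreal (\<Prod>(j, l)\<in>{(j, l). j < l \<and> l < N \<and> j \<noteq> i \<and> l \<noteq> i}. cmod (z j - z l) powr (2 * \<beta>)) *
     (\<Prod>j\<in>{..<N} - {i}. eexp (- (ereal \<beta> * V (z j))))"

lemma gas_weight_upd:
  assumes i: "i < N"
  shows "gas_weight N \<beta> (\<lambda>w. ereal (real N) * \<Phi> w) (z(i := w)) =
     rest_weight N \<beta> (\<lambda>w. ereal (real N) * \<Phi> w) i z * particle_weight \<Phi> \<beta> N ({..<N} - {i}) z w"
proof -
  let ?g = "\<lambda>x y. cmod (x - y) powr (2 * \<beta>)"
  have "(\<Prod>(j, l)\<in>{(j, l). j < l \<and> l < N}. ?g ((z(i := w)) j) ((z(i := w)) l)) =
    (\<Prod>(j, l)\<in>{(j, l). j < l \<and> l < N \<and> j \<noteq> i \<and> l \<noteq> i}. ?g ((z(i := w)) j) ((z(i := w)) l)) *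
    (\<Prod>j\<in>{..<N} - {i}. ?g ((z(i := w)) i) ((z(i := w)) j))"
    by (rule prod_pairs_split[OF i]) (simp add: norm_minus_commute)
  also have "(\<Prod>(j, l)\<in>{(j, l). j < l \<and> l < N \<and> j \<noteq> i \<and> l \<noteq> i}. ?g ((z(i := w)) j) ((z(i := w)) l))
     = (\<Prod>(j, l)\<in>{(j, l). j < l \<and> l < N \<and> j \<noteq> i \<and> l \<noteq> i}. ?g (z j) (z l))"
    by (rule prod.cong) auto
  also have "(\<Prod>j\<in>{..<N} - {i}. ?g ((z(i := w)) i) ((z(i := w)) j)) = (\<Prod>j\<in>{..<N} - {i}. ?g w (z j))"
    by (rule prod.cong) auto
  finally have 1: "ennreal (\<Prod>(j, l)\<in>{(j, l). j < l \<and> l < N}. ?g ((z(i := w)) j) ((z(i := w)) l)) =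
    ennreal (\<Prod>(j, l)\<in>{(j, l). j < l \<and> l < N \<and> j \<noteq> i \<and> l \<noteq> i}. ?g (z j) (z l)) * ennreal (\<Prod>j\<in>{..<N} - {i}. ?g w (z j))"
    by (simp only:) (rule ennreal_mult, auto intro!: prod_nonneg)
  have "(\<Prod>j<N. eexp (- (ereal \<beta> * (ereal (real N) * \<Phi> ((z(i := w)) j))))) =
     eexp (- (ereal \<beta> * (ereal (real N) * \<Phi> w))) * (\<Prod>j\<in>{..<N} - {i}. eexp (- (ereal \<beta> * (ereal (real N) * \<Phi> (z j)))))"
    using i by (subst prod.remove[of _ i]) (auto intro!: prod.cong)
  then show ?thesis unfolding gas_weight_def rest_weight_def particle_weight_def 1
    by (simp add: mult_ac)
qed

lemma measurable_gas_weight [measurable]: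
  assumes [measurable]: "V \<in> borel_measurable borel"
  shows "gas_weight N \<beta> V \<in> borel_measurable (configurations N)"
proof -
  have pr: "(\<lambda>z. \<Prod>(j, l)\<in>{(j, l). j < l \<and> l < N}. cmod (z j - z l) powr (2 * \<beta>)) \<in> borel_measurable (configurations N)"
  proof (rule borel_measurable_prod, clarify)
    fix j l assume "j < l" "l < N"
    then have [measurable]: "(\<lambda>z. z j) \<in> borel_measurable (configurations N)"
      "(\<lambda>z. z l) \<in> borel_measurable (configurations N)"
      using measurable_component_singleton[of j "{..<N}" "\<lambda>_. lborel :: complex measure"]
        measurable_component_singleton[of l "{..<N}" "\<lambda>_. lborel :: complex measure"] by auto
    show "(\<lambda>z. cmod (z j - z l) powr (2 * \<beta>)) \<in> borel_measurable (configurations N)"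
      by measurable
  qed
  have ee: "(\<lambda>z. eexp (- (ereal \<beta> * V (z i)))) \<in> borel_measurable (configurations N)" if "i \<in> {..<N}" for i
  proof -
    have [measurable]: "(\<lambda>z. z i) \<in> borel_measurable (configurations N)"
      using measurable_component_singleton[of i "{..<N}" "\<lambda>_. lborel :: complex measure"] that by auto
    show ?thesis by measurable
  qed
  show ?thesis unfolding gas_weight_def
    by (intro borel_measurable_times_ennreal measurable_compose[OF pr measurable_ennreal] borel_measurable_prod_ennreal ee)
qed

interpretation lborel_product: product_sigma_finite "\<lambda>_::nat. lborel :: complex measure"
  by unfold_locales

definition restricted_gas :: "nat \<Rightarrow> real \<Rightarrow> (complex \<Rightarrow> ereal) \<Rightarrow> complex set \<Rightarrow> ennreal" where
  "restricted_gas N \<beta> \<Phi> D = (\<integral>\<^sup>+z. gas_weight N \<beta> (\<lambda>w. ereal (real N) * \<Phi> w) z * (\<Prod>i<N. indicator D (z i))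
      \<partial>(configurations N))"

definition mixed_gas :: "nat \<Rightarrow> real \<Rightarrow> (complex \<Rightarrow> ereal) \<Rightarrow> complex set \<Rightarrow> complex set \<Rightarrow> nat set \<Rightarrow> ennreal" where
  "mixed_gas N \<beta> \<Phi> D B A = (\<integral>\<^sup>+z. gas_weight N \<beta> (\<lambda>w. ereal (real N) * \<Phi> w) z *
      ((\<Prod>i\<in>A. indicator B (z i)) * (\<Prod>i\<in>{..<N} - A. indicator D (z i))) \<partial>(configurations N))"

lemma measurable_indicator_prod:
  assumes [measurable]: "D \<in> sets borel" and A: "A \<subseteq> {..<N}"
  shows "(\<lambda>z. \<Prod>i\<in>A. indicator D (z i) :: ennreal) \<in> borel_measurable (configurations N)"
proof (rule borel_measurable_prod_ennreal)
  fix i assume "i \<in> A"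
  then have "(\<lambda>z. z i) \<in> measurable (configurations N) borel"
    using measurable_component_singleton[of i "{..<N}" "\<lambda>_. lborel :: complex measure"] A by auto
  then show "(\<lambda>z. indicator D (z i) :: ennreal) \<in> borel_measurable (configurations N)"
    by measurable
qed

lemma restricted_gas_Un:
  assumes B [measurable]: "B \<in> sets borel" and D [measurable]: "D \<in> sets borel"
    and V [measurable]: "\<Phi> \<in> borel_measurable borel" and disj: "D \<inter> B = {}"
  shows "restricted_gas N \<beta> \<Phi> (D \<union> B) = (\<Sum>A\<in>Pow {..<N}. mixed_gas N \<beta> \<Phi> D B A)"
proof -
  have ind: "indicator (D \<union> B) x = (indicator B x + indicator D x :: ennreal)" for x
    using disj by (auto simp: indicator_def)
  have "restricted_gas N \<beta> \<Phi> (D \<union> B) = (\<integral>\<^sup>+z. (\<Sum>A\<in>Pow {..<N}. gas_weight N \<beta> (\<lambda>w. ereal (real N) * \<Phi> w) z *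
      ((\<Prod>i\<in>A. indicator B (z i)) * (\<Prod>i\<in>{..<N} - A. indicator D (z i)))) \<partial>(configurations N))"
    unfolding restricted_gas_def ind by (subst prod_add) (simp_all add: sum_distrib_left)
  also have "\<dots> = (\<Sum>A\<in>Pow {..<N}. mixed_gas N \<beta> \<Phi> D B A)"
    unfolding mixed_gas_def
    by (intro nn_integral_sum borel_measurable_times_ennreal measurable_gas_weight measurable_indicator_prod) auto
  finally show ?thesis .
qed

section \<open>Relocation of a single particle\<close>

context lipschitz_equilibrium
begin

text \<open>Integrating over particle i alone, with all others frozen, is the situation of
  \<open>cell\<close>: J consists of the other particles already in B, and
  \<open>K \<subseteq> D\<close> lets the relocated particle count towards D.\<close>

lemma mixed_gas_step:
  assumes c: "cell N B X Y" and B [measurable]: "B \<in> sets borel" and D [measurable]: "D \<in> sets borel"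
    and KD: "K \<subseteq> D" and A: "A \<subseteq> {..<N}" and i: "i \<in> A"
  shows "mixed_gas N \<beta> \<Phi> D B A \<le> X * Y ^ (card A - 1) * mixed_gas N \<beta> \<Phi> D B (A - {i})"
proof -
  define I where "I = {..<N} - {i}"
  define J where "J = A - {i}"
  have iN: "i < N" using A i by auto
  have ins: "insert i I = {..<N}" using iN by (auto simp: I_def)
  have fI: "finite I" "i \<notin> I" "card I < N" using iN by (auto simp: I_def)
  have JI: "J \<subseteq> I" using A by (auto simp: I_def J_def)
  have fA: "finite A" using A finite_subset by blast
  have cJ: "card J = card A - 1" using fA i by (simp add: J_def)
  define V where "V = (\<lambda>w. ereal (real N) * \<Phi> w)"
  have [measurable]: "V \<in> borel_measurable borel" unfolding V_def by measurable
  \<comment> \<open>Everything that does not depend on the position of particle i. It is the same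
    for A and for \<open>A - {i}\<close>, and it vanishes unless all particles of J lie in B, as
    \<open>cell\<close> requires.\<close>
  define F where "F z = rest_weight N \<beta> V i z * ((\<Prod>j\<in>J. indicator B (z j)) * (\<Prod>j\<in>I - J. indicator D (z j)))" for z
  have iterate: "mixed_gas N \<beta> \<Phi> D B A' = (\<integral>\<^sup>+z. (\<integral>\<^sup>+w. F z * (T N I z w * indicator E w) \<partial>lborel) \<partial>(\<Pi>\<^sub>M i\<in>I. lborel))"
      "(\<lambda>z. \<integral>\<^sup>+w. F z * (T N I z w * indicator E w) \<partial>lborel) \<in> borel_measurable (\<Pi>\<^sub>M i\<in>I. lborel)"
    if A': "A' - {i} = J" "A' \<subseteq> {..<N}" and E: "E = (if i \<in> A' then B else D)" for A' E
  proof -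
    have meas: "(\<lambda>z. gas_weight N \<beta> V z * ((\<Prod>i\<in>A'. indicator B (z i)) * (\<Prod>i\<in>{..<N} - A'. indicator D (z i))))
        \<in> borel_measurable (\<Pi>\<^sub>M i\<in>insert i I. lborel)"
      unfolding ins using A' by (intro borel_measurable_times_ennreal measurable_gas_weight measurable_indicator_prod) auto
    have pt: "gas_weight N \<beta> V (z(i := w)) * ((\<Prod>j\<in>A'. indicator B ((z(i := w)) j)) * (\<Prod>j\<in>{..<N} - A'. indicator D ((z(i := w)) j)))
       = F z * (T N I z w * indicator E w)" for z w
    proof -
      have "(\<Prod>j\<in>A'. indicator B ((z(i := w)) j)) * (\<Prod>j\<in>{..<N} - A'. indicator D ((z(i := w)) j)) =
         ((\<Prod>j\<in>J. indicator B (z j)) * (\<Prod>j\<in>I - J. indicator D (z j))) * (indicator E w :: ennreal)"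
      proof (cases "i \<in> A'")
        case True
        have fA': "finite A'" using A' finite_subset by blast
        have "(\<Prod>j\<in>A'. indicator B ((z(i := w)) j)) = indicator B w * (\<Prod>j\<in>J. indicator B (z j) :: ennreal)"
          unfolding prod.remove[OF fA' True] A'(1)[symmetric] by (auto intro!: prod.cong)
        moreover have "{..<N} - A' = I - J" using True A' by (auto simp: I_def)
        moreover have "(\<Prod>j\<in>I - J. indicator D ((z(i := w)) j)) = (\<Prod>j\<in>I - J. indicator D (z j) :: ennreal)"
          by (rule prod.cong) (auto simp: I_def)
        ultimately show ?thesis using True E by (simp add: mult_ac)
      next
        case False
        then have AJ: "A' = J" using A' by auto
        have "{..<N} - A' = insert i (I - J)" using False A' iN by (auto simp: I_def)
        then have "(\<Prod>j\<in>{..<N} - A'. indicator D ((z(i := w)) j)) = indicator D w * (\<Prod>j\<in>I - J. indicator D ((z(i := w)) j) :: ennreal)"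
          using fI by simp
        moreover have "(\<Prod>j\<in>I - J. indicator D ((z(i := w)) j)) = (\<Prod>j\<in>I - J. indicator D (z j) :: ennreal)"
          by (rule prod.cong) (auto simp: I_def)
        moreover have "(\<Prod>j\<in>A'. indicator B ((z(i := w)) j)) = (\<Prod>j\<in>J. indicator B (z j) :: ennreal)"
          unfolding AJ by (rule prod.cong) (auto simp: J_def)
        ultimately show ?thesis using False E by (simp add: mult_ac)
      qed
      moreover have "gas_weight N \<beta> V (z(i := w)) = rest_weight N \<beta> V i z * T N I z w"
        unfolding V_def I_def by (rule gas_weight_upd[OF iN])
      ultimately show ?thesis by (simp add: F_def mult_ac)
    qed
    have "mixed_gas N \<beta> \<Phi> D B A' = (\<integral>\<^sup>+z. (\<integral>\<^sup>+w. gas_weight N \<beta> V (z(i := w)) *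
        ((\<Prod>j\<in>A'. indicator B ((z(i := w)) j)) * (\<Prod>j\<in>{..<N} - A'. indicator D ((z(i := w)) j))) \<partial>lborel) \<partial>(\<Pi>\<^sub>M i\<in>I. lborel))"
      unfolding mixed_gas_def V_def[symmetric] ins[symmetric]
      by (rule lborel_product.product_nn_integral_insert[OF fI(1,2) meas[unfolded ins[symmetric]]])
    then show "mixed_gas N \<beta> \<Phi> D B A' = (\<integral>\<^sup>+z. (\<integral>\<^sup>+w. F z * (T N I z w * indicator E w) \<partial>lborel) \<partial>(\<Pi>\<^sub>M i\<in>I. lborel))"
      unfolding pt .
    have "(\<lambda>x. gas_weight N \<beta> V ((case x of (z, w) \<Rightarrow> z(i := w))) *
        ((\<Prod>j\<in>A'. indicator B ((case x of (z, w) \<Rightarrow> z(i := w)) j)) * (\<Prod>j\<in>{..<N} - A'. indicator D ((case x of (z, w) \<Rightarrow> z(i := w)) j))))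
       \<in> borel_measurable ((\<Pi>\<^sub>M i\<in>I. lborel) \<Otimes>\<^sub>M lborel)"
      by (rule measurable_compose[OF measurable_add_dim meas])
    also have "(\<lambda>x. gas_weight N \<beta> V ((case x of (z, w) \<Rightarrow> z(i := w))) *
        ((\<Prod>j\<in>A'. indicator B ((case x of (z, w) \<Rightarrow> z(i := w)) j)) * (\<Prod>j\<in>{..<N} - A'. indicator D ((case x of (z, w) \<Rightarrow> z(i := w)) j))))
      = (\<lambda>(z, w). F z * (T N I z w * indicator E w))"
    proof
      fix x :: "(nat \<Rightarrow> complex) \<times> complex"
      obtain z w where x: "x = (z, w)" by (cases x)
      show "gas_weight N \<beta> V ((case x of (z, w) \<Rightarrow> z(i := w))) *
        ((\<Prod>j\<in>A'. indicator B ((case x of (z, w) \<Rightarrow> z(i := w)) j)) * (\<Prod>j\<in>{..<N} - A'. indicator D ((case x of (z, w) \<Rightarrow> z(i := w)) j)))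
        = (case x of (z, w) \<Rightarrow> F z * (T N I z w * indicator E w))"
        unfolding x prod.case by (rule pt)
    qed
    finally show "(\<lambda>z. \<integral>\<^sup>+w. F z * (T N I z w * indicator E w) \<partial>lborel) \<in> borel_measurable (\<Pi>\<^sub>M i\<in>I. lborel)"
      by (rule lborel.borel_measurable_nn_integral)
  qed
  have "mixed_gas N \<beta> \<Phi> D B A = (\<integral>\<^sup>+z. (\<integral>\<^sup>+w. F z * (T N I z w * indicator B w) \<partial>lborel) \<partial>(\<Pi>\<^sub>M i\<in>I. lborel))"
    by (rule iterate(1)) (use A i in \<open>auto simp: J_def\<close>)
  also have "\<dots> \<le> (\<integral>\<^sup>+z. X * Y ^ card J * (\<integral>\<^sup>+w. F z * (T N I z w * indicator D w) \<partial>lborel) \<partial>(\<Pi>\<^sub>M i\<in>I. lborel))"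
  proof (rule nn_integral_mono)
    fix z
    show "(\<integral>\<^sup>+w. F z * (T N I z w * indicator B w) \<partial>lborel) \<le> X * Y ^ card J * (\<integral>\<^sup>+w. F z * (T N I z w * indicator D w) \<partial>lborel)"
    proof (cases "\<forall>j\<in>J. z j \<in> B")
      case True
      have "(\<integral>\<^sup>+w. T N I z w * indicator B w \<partial>lborel) \<le> X * Y ^ card J * (\<integral>\<^sup>+w. T N I z w * indicator K w \<partial>lborel)"
        using c fI JI True unfolding cell_def by blast
      also have "\<dots> \<le> X * Y ^ card J * (\<integral>\<^sup>+w. T N I z w * indicator D w \<partial>lborel)"
        using KD by (intro mult_left_mono nn_integral_mono) (auto simp: indicator_def)
      finally have "F z * (\<integral>\<^sup>+w. T N I z w * indicator B w \<partial>lborel) \<le> F z * (X * Y ^ card J * (\<integral>\<^sup>+w. T N I z w * indicator D w \<partial>lborel))"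
        by (rule mult_left_mono) simp
      then show ?thesis by (simp add: nn_integral_cmult mult_ac)
    next
      case False
      then obtain j where j: "j \<in> J" "z j \<notin> B" by auto
      have "finite J" using JI fI finite_subset by blast
      then have "(\<Prod>j\<in>J. indicator B (z j) :: ennreal) = 0" using j by (intro prod_zero bexI[of _ j]) (auto simp: indicator_def)
      then have "F z = 0" by (simp add: F_def)
      then show ?thesis by simp
    qed
  qed
  also have "\<dots> = X * Y ^ card J * mixed_gas N \<beta> \<Phi> D B (A - {i})"
  proof -
    have "mixed_gas N \<beta> \<Phi> D B (A - {i}) = (\<integral>\<^sup>+z. (\<integral>\<^sup>+w. F z * (T N I z w * indicator D w) \<partial>lborel) \<partial>(\<Pi>\<^sub>M i\<in>I. lborel))"
      by (rule iterate(1)) (use A i in \<open>auto simp: J_def\<close>)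
    moreover have "(\<lambda>z. \<integral>\<^sup>+w. F z * (T N I z w * indicator D w) \<partial>lborel) \<in> borel_measurable (\<Pi>\<^sub>M i\<in>I. lborel)"
      by (rule iterate(2)[of "A - {i}"]) (use A in \<open>auto simp: J_def\<close>)
    ultimately show ?thesis by (simp add: nn_integral_cmult)
  qed
  finally show ?thesis by (simp add: cJ)
qed

end

lemma sum_Pow_power_card:
  fixes t :: real
  assumes "finite A"
  shows "(\<Sum>B\<in>Pow A. t ^ card B) = (1 + t) ^ card A"
proof -
  have "(\<Prod>i\<in>A. t + 1) = (\<Sum>B\<in>Pow A. (\<Prod>i\<in>B. t) * (\<Prod>i\<in>A - B. 1))"
    using assms by (rule prod_add)
  then show ?thesis by (simp add: add.commute)
qed

text \<open>Completing the square. For a of order ln N the bound is of order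
  \<open>(ln N)^2\<close>, uniformly in the number t of particles.\<close>

lemma quadratic_exponent_le:
  fixes a h t :: real
  assumes h: "0 < h"
  shows "a * t - h * (t * (t - 1) / 2) \<le> (a + h / 2)\<^sup>2 / (2 * h)"
proof -
  have "0 \<le> (h * t - (a + h / 2))\<^sup>2 / (2 * h)" using h by simp
  also have "\<dots> = (a + h / 2)\<^sup>2 / (2 * h) - (a * t - h * (t * (t - 1) / 2))"
    using h by (simp add: power2_eq_square field_simps)
  finally show ?thesis by simp
qed

section \<open>Summation over sets of particles and over cells\<close>

context lipschitz_equilibrium
begin

abbreviation rgas where "rgas N D \<equiv> restricted_gas N \<beta> \<Phi> D"

text \<open>The particles are relocated one after another. When j others are still in B the factor
  is \<open>Y ^ j\<close>, and 0 + 1 + ... + (n - 1) gives the exponent.\<close>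

lemma mixed_gas_bound:
  assumes c: "cell N B X Y" and B: "B \<in> sets borel" and D: "D \<in> sets borel"
    and KD: "K \<subseteq> D" and A: "A \<subseteq> {..<N}"
  shows "mixed_gas N \<beta> \<Phi> D B A \<le> X ^ card A * Y ^ (card A * (card A - 1) div 2) * rgas N D"
proof -
  have "finite A" using A finite_subset by blast
  then show ?thesis using A
  proof (induction A rule: finite_induct)
    case empty
    show ?case by (simp add: mixed_gas_def restricted_gas_def)
  next
    case (insert i A)
    have "mixed_gas N \<beta> \<Phi> D B (insert i A) \<le> X * Y ^ (card (insert i A) - 1) * mixed_gas N \<beta> \<Phi> D B (insert i A - {i})"
      using insert by (intro mixed_gas_step[OF c B D KD]) auto
    also have "insert i A - {i} = A" using insert by auto
    also have "X * Y ^ (card (insert i A) - 1) * mixed_gas N \<beta> \<Phi> D B A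
        \<le> X * Y ^ (card (insert i A) - 1) * (X ^ card A * Y ^ (card A * (card A - 1) div 2) * rgas N D)"
      using insert by (intro mult_left_mono) auto
    also have "\<dots> = X ^ Suc (card A) * Y ^ (card A + card A * (card A - 1) div 2) * rgas N D"
      using insert by (simp add: power_add mult_ac)
    also have "card A + card A * (card A - 1) div 2 = Suc (card A) * (Suc (card A) - 1) div 2"
      by (cases "card A") (simp_all add: algebra_simps)
    finally show ?case using insert by simp
  qed
qed

text \<open>There are at most \<open>N^n\<close> sets of n particles. A factor N is attached to x
  for this, and the compensating \<open>(1 / N)^n\<close> makes the sum over all sets at most
  \<open>(1 + 1 / N)^N \<le> exp 1\<close>.\<close>

lemma restricted_gas_cell:
  assumes c: "cell N B (ennreal x) (ennreal y)" and B: "B \<in> sets borel" and D: "D \<in> sets borel"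
    and KD: "K \<subseteq> D" and xy: "0 \<le> x" "0 \<le> y" and N: "0 < N"
    and bd: "\<And>n. (real N * x) ^ n * y ^ (n * (n - 1) div 2) \<le> E"
  shows "rgas N (D \<union> B) \<le> ennreal (exp 1 * E) * rgas N D"
proof -
  have E0: "0 \<le> E" using bd[of 0] by simp
  \<comment> \<open>Removing D makes the two regions disjoint, as the expansion over sets of
    particles requires.\<close>
  have c': "cell N (B - D) (ennreal x) (ennreal y)" by (rule cell_mono[OF c]) auto
  have B': "B - D \<in> sets borel" using B D by auto
  have "rgas N (D \<union> B) = rgas N (D \<union> (B - D))" by simp
  also have "\<dots> = (\<Sum>A\<in>Pow {..<N}. mixed_gas N \<beta> \<Phi> D (B - D) A)"
    by (rule restricted_gas_Un[OF B' D meas]) auto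
  also have "\<dots> \<le> (\<Sum>A\<in>Pow {..<N}. ennreal (E * (1 / real N) ^ card A) * rgas N D)"
  proof (rule sum_mono)
    fix A assume A: "A \<in> Pow {..<N}"
    let ?n = "card A"
    have "mixed_gas N \<beta> \<Phi> D (B - D) A \<le> ennreal x ^ ?n * ennreal y ^ (?n * (?n - 1) div 2) * rgas N D"
      using A by (intro mixed_gas_bound[OF c' B' D KD]) auto
    also have "ennreal x ^ ?n * ennreal y ^ (?n * (?n - 1) div 2) = ennreal (x ^ ?n * y ^ (?n * (?n - 1) div 2))"
      using xy by (simp add: ennreal_power ennreal_mult)
    also have "x ^ ?n * y ^ (?n * (?n - 1) div 2) = ((real N * x) ^ ?n * y ^ (?n * (?n - 1) div 2)) * (1 / real N) ^ ?n"
      using N by (simp add: power_mult_distrib power_divide)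
    also have "ennreal \<dots> * rgas N D \<le> ennreal (E * (1 / real N) ^ ?n) * rgas N D"
      by (intro mult_right_mono ennreal_leI bd) auto
    finally show "mixed_gas N \<beta> \<Phi> D (B - D) A \<le> ennreal (E * (1 / real N) ^ ?n) * rgas N D" .
  qed
  also have "\<dots> = ennreal (\<Sum>A\<in>Pow {..<N}. E * (1 / real N) ^ card A) * rgas N D"
    unfolding sum_distrib_right[symmetric] using E0 by (subst sum_ennreal) auto
  also have "(\<Sum>A\<in>Pow {..<N}. E * (1 / real N) ^ card A) = E * (1 + 1 / real N) ^ N"
    unfolding sum_distrib_left[symmetric] by (subst sum_Pow_power_card) auto
  also have "ennreal (E * (1 + 1 / real N) ^ N) \<le> ennreal (exp 1 * E)"
  proof (rule ennreal_leI)
    have "(1 + 1 / real N) ^ N \<le> exp (1 / real N) ^ N" by (intro power_mono exp_ge_add_one_self) auto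
    also have "\<dots> = exp 1" using N by (simp add: exp_of_nat_mult[symmetric])
    finally show "E * (1 + 1 / real N) ^ N \<le> exp 1 * E" using E0 by (simp add: mult.commute mult_left_mono)
  qed
  finally show ?thesis by (simp add: mult_right_mono)
qed

text \<open>The threshold for N does not depend on D. This uniformity makes the notion stable under
  finite unions, where the second set is added to D together with the first.\<close>

definition negligible_cost :: "complex set \<Rightarrow> bool" where
  "negligible_cost B \<longleftrightarrow> B \<in> sets borel \<and> (\<forall>\<delta>>0. \<forall>\<^sub>F N in sequentially. \<forall>D\<in>sets borel. K \<subseteq> D \<longrightarrow>
     rgas N (D \<union> B) \<le> ennreal (exp (\<delta> * real N)) * rgas N D)"

lemma negligible_costD:
  assumes "negligible_cost B" "0 < \<delta>"
  shows "\<forall>\<^sub>F N in sequentially. \<forall>D\<in>sets borel. K \<subseteq> D \<longrightarrow>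
     rgas N (D \<union> B) \<le> ennreal (exp (\<delta> * real N)) * rgas N D"
  using assms by (simp add: negligible_cost_def)

lemma negligible_cost_Un:
  assumes A: "negligible_cost A" and B: "negligible_cost B"
  shows "negligible_cost (A \<union> B)"
  unfolding negligible_cost_def
proof (intro conjI allI impI)
  show "A \<union> B \<in> sets borel" using A B by (auto simp: negligible_cost_def)
  fix \<delta> :: real assume "0 < \<delta>"
  then have d: "0 < \<delta> / 2" by simp
  have "\<forall>\<^sub>F N in sequentially. \<forall>D\<in>sets borel. K \<subseteq> D \<longrightarrow> rgas N (D \<union> A) \<le> ennreal (exp (\<delta> / 2 * real N)) * rgas N D"
    "\<forall>\<^sub>F N in sequentially. \<forall>D\<in>sets borel. K \<subseteq> D \<longrightarrow> rgas N (D \<union> B) \<le> ennreal (exp (\<delta> / 2 * real N)) * rgas N D"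
    by (rule negligible_costD[OF A d], rule negligible_costD[OF B d])
  then show "\<forall>\<^sub>F N in sequentially. \<forall>D\<in>sets borel. K \<subseteq> D \<longrightarrow> rgas N (D \<union> (A \<union> B)) \<le> ennreal (exp (\<delta> * real N)) * rgas N D"
  proof eventually_elim
    case (elim N)
    show ?case
    proof (intro ballI impI)
      fix D assume D: "D \<in> sets borel" "K \<subseteq> D"
      have DA: "D \<union> A \<in> sets borel" "K \<subseteq> D \<union> A" using D A by (auto simp: negligible_cost_def)
      have "rgas N (D \<union> (A \<union> B)) = rgas N ((D \<union> A) \<union> B)" by (simp add: Un_assoc)
      also have "\<dots> \<le> ennreal (exp (\<delta> / 2 * real N)) * rgas N (D \<union> A)"
        using elim(2) DA by blast
      also have "\<dots> \<le> ennreal (exp (\<delta> / 2 * real N)) * (ennreal (exp (\<delta> / 2 * real N)) * rgas N D)"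
        using elim(1) D by (intro mult_left_mono) auto
      also have "\<dots> = ennreal (exp (\<delta> * real N)) * rgas N D"
        by (simp add: mult.assoc[symmetric] ennreal_mult[symmetric] mult_exp_exp)
      finally show "rgas N (D \<union> (A \<union> B)) \<le> ennreal (exp (\<delta> * real N)) * rgas N D" .
    qed
  qed
qed

lemma eventually_real_ge:
  assumes "0 < c"
  shows "\<forall>\<^sub>F N in sequentially. a \<le> c * real N"
  using filterlim_tendsto_pos_mult_at_top[OF tendsto_const assms filterlim_real_sequentially]
  by (simp add: filterlim_at_top)

text \<open>The radius \<open>\<rho> / 8\<close> gives the diameter \<open>\<rho> / 4\<close> that
  \<open>near_cell\<close> requires.\<close>

lemma negligible_cost_ball: "negligible_cost (ball p (\<rho> / 8) - K)"
  unfolding negligible_cost_def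
proof (intro conjI allI impI)
  let ?B = "ball p (\<rho> / 8) - K"
  show B: "?B \<in> sets borel" by simp
  fix \<delta> :: real assume d: "0 < \<delta>"
  define v where "v = unit_ball_vol (real DIM(complex)) * (\<rho> / 8) ^ DIM(complex)"
  have v0: "0 < v" unfolding v_def using rho by simp
  have vol: "emeasure lborel ?B \<le> ennreal v"
  proof -
    have "emeasure lborel ?B \<le> emeasure lborel (ball p (\<rho> / 8))" by (rule emeasure_mono) auto
    also have "\<dots> = ennreal v" unfolding v_def using rho by (intro emeasure_ball) auto
    finally show ?thesis .
  qed
  have diam: "cmod (x - y) \<le> \<rho> / 4" if "x \<in> ?B" "y \<in> ?B" for x y
  proof -
    have "dist x y < \<rho> / 8 + \<rho> / 8" using that dist_triangle2[of x y p] by (auto simp: dist_commute)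
    then show ?thesis by (simp add: dist_norm)
  qed
  define y where "y = 4 powr (- \<beta>)"
  define h where "h = \<beta> * ln 4"
  have h: "0 < h" unfolding h_def using beta by simp
  have y0: "0 < y" by (simp add: y_def)
  have lny: "ln y = - h" by (simp add: y_def h_def ln_powr)
  define A where "A = ln (c0 * v)"
  \<comment> \<open>The exponent consists of 1 from the sum over sets of particles and of the
    completed square with \<open>a = A + 3 * ln N\<close>: one N for the choice of a particle,
    \<open>N^2\<close> for the inverse area in Cauchy's estimate.\<close>
  have lim: "(\<lambda>N. (1 + (A + 3 * ln (real N) + h / 2)\<^sup>2 / (2 * h)) / real N) \<longlonglongrightarrow> 0"
    using h by real_asymp
  have ev1: "\<forall>\<^sub>F N in sequentially. (1 + (A + 3 * ln (real N) + h / 2)\<^sup>2 / (2 * h)) / real N < \<delta>"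
    by (rule order_tendstoD(2)[OF lim d])
  have ev2: "\<forall>\<^sub>F N in sequentially. 4 \<le> \<rho> * real N" by (rule eventually_real_ge[OF rho])
  show "\<forall>\<^sub>F N in sequentially. \<forall>D\<in>sets borel. K \<subseteq> D \<longrightarrow> rgas N (D \<union> ?B) \<le> ennreal (exp (\<delta> * real N)) * rgas N D"
    using ev1 ev2 eventually_gt_at_top[of 0]
  proof eventually_elim
    case (elim N)
    define x where "x = c0 * (real N)\<^sup>2 * v"
    have N0: "0 < real N" using elim by simp
    have x0: "0 < x" unfolding x_def using c0_pos v0 N0 by simp
    have cl: "cell N ?B (ennreal x) (ennreal y)"
      unfolding x_def y_def by (rule near_cell[OF B _ diam vol]) (use v0 elim in \<open>auto simp: mult.commute\<close>)
    define a where "a = ln (real N * x)"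
    have a: "a = A + 3 * ln (real N)"
    proof -
      have "real N * x = (c0 * v) * real N ^ 3" by (simp add: x_def power2_eq_square power3_eq_cube)
      then show ?thesis unfolding a_def A_def using c0_pos v0 N0 by (simp add: ln_mult_pos ln_realpow)
    qed
    define E where "E = exp ((a + h / 2)\<^sup>2 / (2 * h))"
    have bd: "(real N * x) ^ n * y ^ (n * (n - 1) div 2) \<le> E" for n
    proof -
      have rn: "real (n * (n - 1) div 2) = real n * (real n - 1) / 2"
        by (cases n) (simp_all add: real_of_nat_div algebra_simps)
      have "(real N * x) ^ n * y ^ (n * (n - 1) div 2) = exp (real n * a) * exp (real (n * (n - 1) div 2) * ln y)"
        using x0 y0 N0 by (simp add: a_def exp_of_nat_mult)
      also have "\<dots> = exp (a * real n - h * (real n * (real n - 1) / 2))"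
        unfolding lny rn mult_exp_exp by (simp add: field_simps)
      also have "\<dots> \<le> E" unfolding E_def using quadratic_exponent_le[OF h] by simp
      finally show ?thesis .
    qed
    have "1 + (a + h / 2)\<^sup>2 / (2 * h) \<le> \<delta> * real N"
      using elim(1) N0 unfolding a by (simp add: pos_divide_less_eq)
    then have eE: "exp 1 * E \<le> exp (\<delta> * real N)" unfolding E_def mult_exp_exp by simp
    show ?case
    proof (intro ballI impI)
      fix D assume D: "D \<in> sets borel" "K \<subseteq> D"
      have "rgas N (D \<union> ?B) \<le> ennreal (exp 1 * E) * rgas N D"
        by (rule restricted_gas_cell[OF cl B D _ _ _ bd]) (use x0 y0 elim in auto)
      also have "\<dots> \<le> ennreal (exp (\<delta> * real N)) * rgas N D"
        by (intro mult_right_mono ennreal_leI eE) simp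
      finally show "rgas N (D \<union> ?B) \<le> ennreal (exp (\<delta> * real N)) * rgas N D" .
    qed
  qed
qed

text \<open>Without repulsion the cost of each particle has to be small by itself, and it is:
  \<open>exp (- (\<beta> * N))\<close> beats the factor \<open>N^3\<close>.\<close>

lemma negligible_cost_far: "\<exists>R>0. negligible_cost {w. R < cmod w}"
proof -
  obtain R where R: "0 < R" "\<And>N. 4 \<le> real N * \<rho> \<Longrightarrow> 4 \<le> \<beta> * real N * \<epsilon> \<Longrightarrow>
     cell N {w. R < cmod w} (ennreal (c0 * (real N)\<^sup>2 * (exp (- (\<beta> * real N)) * decay_const))) 1"
    using far_cell by blast
  let ?B = "{w. R < cmod w}"
  have B: "?B \<in> sets borel" by measurable
  have dc: "0 \<le> decay_const" by (simp add: decay_const_def)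
  have "negligible_cost ?B"
    unfolding negligible_cost_def
  proof (intro conjI allI impI B)
    fix \<delta> :: real assume d: "0 < \<delta>"
    have lim: "(\<lambda>N. real N * (c0 * (real N)\<^sup>2 * (exp (- (\<beta> * real N)) * decay_const))) \<longlonglongrightarrow> 0"
    proof -
      have "(\<lambda>N. real N * ((real N)\<^sup>2 * exp (- (\<beta> * real N)))) \<longlonglongrightarrow> 0"
        using beta by real_asymp
      from tendsto_mult_left[OF this, of "c0 * decay_const"] show ?thesis by (simp add: mult_ac)
    qed
    have ev1: "\<forall>\<^sub>F N in sequentially. real N * (c0 * (real N)\<^sup>2 * (exp (- (\<beta> * real N)) * decay_const)) < 1"
      by (rule order_tendstoD(2)[OF lim]) simp
    have ev2: "\<forall>\<^sub>F N in sequentially. 4 \<le> \<rho> * real N" by (rule eventually_real_ge[OF rho])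
    have ev3: "\<forall>\<^sub>F N in sequentially. 4 \<le> (\<beta> * \<epsilon>) * real N" by (rule eventually_real_ge) (use beta eps_pos in simp)
    have ev4: "\<forall>\<^sub>F N in sequentially. 1 \<le> \<delta> * real N" by (rule eventually_real_ge[OF d])
    show "\<forall>\<^sub>F N in sequentially. \<forall>D\<in>sets borel. K \<subseteq> D \<longrightarrow> rgas N (D \<union> ?B) \<le> ennreal (exp (\<delta> * real N)) * rgas N D"
      using ev1 ev2 ev3 ev4 eventually_gt_at_top[of 0]
    proof eventually_elim
      case (elim N)
      define x where "x = c0 * (real N)\<^sup>2 * (exp (- (\<beta> * real N)) * decay_const)"
      have x0: "0 \<le> x" unfolding x_def using c0_pos dc by simp
      have cl: "cell N ?B (ennreal x) (ennreal 1)"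
        using R(2)[of N] elim unfolding x_def by (simp add: mult_ac)
      have bd: "(real N * x) ^ n * 1 ^ (n * (n - 1) div 2) \<le> 1" for n
        using elim(1) x0 by (simp add: x_def power_le_one)
      show ?case
      proof (intro ballI impI)
        fix D assume D: "D \<in> sets borel" "K \<subseteq> D"
        have "rgas N (D \<union> ?B) \<le> ennreal (exp 1 * 1) * rgas N D"
          by (rule restricted_gas_cell[OF cl B D _ _ _ bd]) (use x0 elim in auto)
        also have "\<dots> \<le> ennreal (exp (\<delta> * real N)) * rgas N D"
          using elim by (intro mult_right_mono ennreal_leI) auto
        finally show "rgas N (D \<union> ?B) \<le> ennreal (exp (\<delta> * real N)) * rgas N D" .
      qed
    qed
  qed
  then show ?thesis using R by blast
qed

lemma negligible_cost_UN:
  assumes "finite P" "P \<noteq> {}" "\<And>p. p \<in> P \<Longrightarrow> negligible_cost (B p)"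
  shows "negligible_cost (\<Union>p\<in>P. B p)"
  using assms
proof (induction P rule: finite_ne_induct)
  case (insert p P)
  then have "negligible_cost (B p \<union> (\<Union>p\<in>P. B p))" by (intro negligible_cost_Un) auto
  then show ?case by simp
qed simp

lemma negligible_cost_compl: "negligible_cost (- K)"
proof -
  obtain R where R: "negligible_cost {w. R < cmod w}" using negligible_cost_far by blast
  have "seq_compact (cball (0::complex) R)" by (intro compact_imp_seq_compact compact_cball)
  then have "\<forall>e>0. \<exists>k. finite k \<and> k \<subseteq> cball (0::complex) R \<and> cball 0 R \<subseteq> (\<Union>x\<in>k. ball x e)"
    by (rule seq_compact_imp_totally_bounded)
  moreover have "0 < \<rho> / 8" using rho by simp
  ultimately have "\<exists>k. finite k \<and> k \<subseteq> cball (0::complex) R \<and> cball 0 R \<subseteq> (\<Union>x\<in>k. ball x (\<rho> / 8))"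
    by (elim allE[of _ "\<rho> / 8"] impE)
  then obtain P where P: "finite P" "cball (0::complex) R \<subseteq> (\<Union>p\<in>P. ball p (\<rho> / 8))"
    by (elim exE conjE)
  \<comment> \<open>\<open>insert 0\<close> makes the index set nonempty. The cover does not depend
    on N, so only finitely many sets of negligible cost are joined.\<close>
  let ?A = "{w. R < cmod w} \<union> (\<Union>p\<in>insert 0 P. ball p (\<rho> / 8) - K)"
  have A: "negligible_cost ?A"
    by (intro negligible_cost_Un R negligible_cost_UN) (use P negligible_cost_ball in auto)
  have sub: "K \<union> ?A = K \<union> - K"
    using P by (auto simp: subset_iff)
  have "rgas N (D \<union> - K) = rgas N (D \<union> ?A)" if "K \<subseteq> D" for N D
  proof -
    have "D \<union> - K = D \<union> ?A" using sub that by blast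
    then show ?thesis by simp
  qed
  then show ?thesis using A unfolding negligible_cost_def by auto
qed

lemma partition_function_le:
  assumes d: "0 < \<delta>"
  shows "\<forall>\<^sub>F N in sequentially. partition_function N \<beta> (\<lambda>w. ereal (real N) * \<Phi> w) \<le> ennreal (exp (\<delta> * real N)) * rgas N K"
proof -
  have "\<forall>\<^sub>F N in sequentially. \<forall>D\<in>sets borel. K \<subseteq> D \<longrightarrow> rgas N (D \<union> - K) \<le> ennreal (exp (\<delta> * real N)) * rgas N D"
    by (rule negligible_costD[OF negligible_cost_compl d])
  then show ?thesis
  proof eventually_elim
    case (elim N)
    have "rgas N (K \<union> - K) \<le> ennreal (exp (\<delta> * real N)) * rgas N K" using elim K_meas by blast
    then show ?case by (simp add: restricted_gas_def partition_function_def)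
  qed
qed

end

section \<open>Dilations\<close>

lemma lborel_scale:
  fixes c :: real
  assumes "0 < c" "A \<in> sets borel"
  shows "ennreal (c\<^sup>2) * emeasure lborel ((\<lambda>z::complex. of_real c * z) -` A) = emeasure lborel A"
proof -
  have "emeasure lborel A = emeasure (density (distr lborel borel (\<lambda>x::complex. 0 + c *\<^sub>R x)) (\<lambda>_. ennreal (\<bar>c\<bar> ^ DIM(complex)))) A"
    using lborel_affine[of c "0::complex"] assms by simp
  also have "\<dots> = ennreal (c\<^sup>2) * emeasure (distr lborel borel (\<lambda>x::complex. 0 + c *\<^sub>R x)) A"
    using assms by (subst emeasure_density_const) auto
  also have "emeasure (distr lborel borel (\<lambda>x::complex. 0 + c *\<^sub>R x)) A = emeasure lborel ((\<lambda>z::complex. of_real c * z) -` A)"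
    using assms by (subst emeasure_distr) (auto simp: scaleR_conv_of_real)
  finally show ?thesis by simp
qed

lemma nn_integral_PiM_scale:
  fixes c :: real
  assumes c: "0 < c" and f [measurable]: "f \<in> borel_measurable (configurations N)"
  shows "(\<integral>\<^sup>+z. f z \<partial>(configurations N)) =
    ennreal (c\<^sup>2) ^ N * (\<integral>\<^sup>+z. f (\<lambda>i\<in>{..<N}. of_real c * z i) \<partial>(configurations N))"
proof -
  let ?M = "configurations N"
  define h where "h z = (\<lambda>i\<in>{..<N}. of_real c * z i)" for z :: "nat \<Rightarrow> complex"
  have h [measurable]: "h \<in> measurable ?M ?M"
    unfolding h_def
  proof (rule measurable_restrict)
    fix i assume "i \<in> {..<N}"
    then have [measurable]: "(\<lambda>z. z i) \<in> borel_measurable ?M"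
      using measurable_component_singleton[of i "{..<N}" "\<lambda>_. lborel :: complex measure"] by auto
    show "(\<lambda>z. of_real c * z i) \<in> measurable ?M lborel" by measurable
  qed
  have "density (distr ?M ?M h) (\<lambda>_. ennreal (c\<^sup>2) ^ N) = ?M"
  proof (rule lborel_product.PiM_eqI)
    fix A :: "nat \<Rightarrow> complex set" assume A: "\<And>i. i \<in> {..<N} \<Longrightarrow> A i \<in> sets lborel"
    have Am: "Pi\<^sub>E {..<N} A \<in> sets ?M" using A by (intro sets_PiM_I_finite) auto
    have pre: "(\<lambda>z::complex. of_real c * z) -` A i \<in> sets lborel" if "i \<in> {..<N}" for i
      using measurable_sets[of "\<lambda>z::complex. of_real c * z" borel borel "A i"] A[OF that] by auto
    have "h -` Pi\<^sub>E {..<N} A \<inter> space ?M = Pi\<^sub>E {..<N} (\<lambda>i. (\<lambda>z. of_real c * z) -` A i)"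
      by (auto simp: h_def space_PiM PiE_iff)
    then have "emeasure (distr ?M ?M h) (Pi\<^sub>E {..<N} A) = emeasure ?M (Pi\<^sub>E {..<N} (\<lambda>i. (\<lambda>z. of_real c * z) -` A i))"
      by (simp only: emeasure_distr[OF h Am])
    also have "\<dots> = (\<Prod>i<N. emeasure lborel ((\<lambda>z::complex. of_real c * z) -` A i))"
      by (rule lborel_product.emeasure_PiM) (use pre in auto)
    finally have "emeasure (distr ?M ?M h) (Pi\<^sub>E {..<N} A) = (\<Prod>i<N. emeasure lborel ((\<lambda>z::complex. of_real c * z) -` A i))" .
    then have "emeasure (density (distr ?M ?M h) (\<lambda>_. ennreal (c\<^sup>2) ^ N)) (Pi\<^sub>E {..<N} A) =
       (\<Prod>i<N. ennreal (c\<^sup>2)) * (\<Prod>i<N. emeasure lborel ((\<lambda>z::complex. of_real c * z) -` A i))"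
      using Am by (subst emeasure_density_const) auto
    also have "\<dots> = (\<Prod>i<N. emeasure lborel (A i))"
      unfolding prod.distrib[symmetric] using A by (intro prod.cong lborel_scale c) auto
    finally show "emeasure (density (distr ?M ?M h) (\<lambda>_. ennreal (c\<^sup>2) ^ N)) (Pi\<^sub>E {..<N} A) = (\<Prod>i\<in>{..<N}. emeasure lborel (A i))" .
  qed auto
  then have "(\<integral>\<^sup>+z. f z \<partial>?M) = (\<integral>\<^sup>+z. f z \<partial>density (distr ?M ?M h) (\<lambda>_. ennreal (c\<^sup>2) ^ N))" by simp
  also have "\<dots> = (\<integral>\<^sup>+z. ennreal (c\<^sup>2) ^ N * f z \<partial>distr ?M ?M h)"
    by (subst nn_integral_density) auto
  also have "\<dots> = ennreal (c\<^sup>2) ^ N * (\<integral>\<^sup>+z. f z \<partial>distr ?M ?M h)"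
    by (subst nn_integral_cmult) auto
  also have "(\<integral>\<^sup>+z. f z \<partial>distr ?M ?M h) = (\<integral>\<^sup>+z. f (h z) \<partial>?M)"
    by (subst nn_integral_distr) auto
  finally show ?thesis by (simp add: h_def)
qed

lemma prod_mono_ennreal:
  fixes f g :: "'i \<Rightarrow> ennreal"
  assumes "\<And>i. i \<in> I \<Longrightarrow> f i \<le> g i"
  shows "prod f I \<le> prod g I"
  using assms by (induction I rule: infinite_finite_induct) (auto intro: mult_mono)

lemma card_pairs: "card {(j, l). j < l \<and> l < (N::nat)} = N * (N - 1) div 2"
proof (induction N)
  case (Suc N)
  have "{(j, l). j < l \<and> l < Suc N} = {(j, l). j < l \<and> l < N} \<union> (\<lambda>j. (j, N)) ` {..<N}"
    by (auto simp: less_Suc_eq)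
  moreover have "finite {(j, l). j < l \<and> l < N}"
    by (rule finite_subset[of _ "{..<N} \<times> {..<N}"]) auto
  ultimately have "card {(j, l). j < l \<and> l < Suc N} = card {(j, l). j < l \<and> l < N} + card ((\<lambda>j. (j, N)) ` {..<N})"
    by (simp add: card_Un_disjoint disjoint_iff image_iff)
  also have "card ((\<lambda>j. (j, N)) ` {..<N}) = N" by (subst card_image) (auto simp: inj_on_def)
  finally show ?case using Suc by (cases N) (simp_all add: algebra_simps)
qed simp

lemma gas_weight_scale:
  assumes c: "0 < c"
  shows "gas_weight N \<beta> V (\<lambda>i\<in>{..<N}. of_real c * z i) =
    ennreal (c powr (\<beta> * (real N * (real N - 1)))) * gas_weight N \<beta> (\<lambda>w. V (of_real c * w)) z"
proof -
  let ?P = "{(j, l). j < l \<and> l < N}"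
  have "(\<Prod>(j, l)\<in>?P. cmod ((\<lambda>i\<in>{..<N}. of_real c * z i) j - (\<lambda>i\<in>{..<N}. of_real c * z i) l) powr (2 * \<beta>)) =
    (\<Prod>(j, l)\<in>?P. c powr (2 * \<beta>) * cmod (z j - z l) powr (2 * \<beta>))"
  proof (rule prod.cong[OF refl], clarify)
    fix j l assume "j < l" "l < N"
    then have "(\<lambda>i\<in>{..<N}. of_real c * z i) j - (\<lambda>i\<in>{..<N}. of_real c * z i) l = of_real c * (z j - z l)"
      by (simp add: algebra_simps)
    then show "cmod ((\<lambda>i\<in>{..<N}. of_real c * z i) j - (\<lambda>i\<in>{..<N}. of_real c * z i) l) powr (2 * \<beta>) = c powr (2 * \<beta>) * cmod (z j - z l) powr (2 * \<beta>)"
      using c by (simp only: norm_mult powr_mult) simp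
  qed
  also have "\<dots> = (c powr (2 * \<beta>)) ^ card ?P * (\<Prod>(j, l)\<in>?P. cmod (z j - z l) powr (2 * \<beta>))"
    by (simp add: prod.distrib case_prod_unfold)
  also have "(c powr (2 * \<beta>)) ^ card ?P = c powr (\<beta> * (real N * (real N - 1)))"
  proof -
    have rn: "real (N * (N - 1) div 2) = real N * (real N - 1) / 2"
      by (cases N) (simp_all add: real_of_nat_div algebra_simps)
    have "(c powr (2 * \<beta>)) ^ card ?P = c powr (real (card ?P) * (2 * \<beta>))" using c by (simp add: powr_power)
    moreover have "real N * (real N - 1) / 2 * (2 * \<beta>) = \<beta> * (real N * (real N - 1))" by simp
    ultimately show ?thesis unfolding card_pairs rn by (simp only:)
  qed
  finally have 1: "(\<Prod>(j, l)\<in>?P. cmod ((\<lambda>i\<in>{..<N}. of_real c * z i) j - (\<lambda>i\<in>{..<N}. of_real c * z i) l) powr (2 * \<beta>)) =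
    c powr (\<beta> * (real N * (real N - 1))) * (\<Prod>(j, l)\<in>?P. cmod (z j - z l) powr (2 * \<beta>))" .
  have 2: "0 \<le> (\<Prod>(j, l)\<in>?P. cmod (z j - z l) powr (2 * \<beta>))" by (rule prod_nonneg) auto
  show ?thesis unfolding gas_weight_def 1
    using 2 by (simp add: ennreal_mult mult.assoc)
qed

section \<open>The confined partition function is finite and positive\<close>

context lipschitz_equilibrium
begin

lemma bounded_K: "bounded K"
proof -
  obtain R0 where R0: "0 < R0" "\<And>x. x \<in> S \<Longrightarrow> cmod x \<le> R0" using S_bound by blast
  show ?thesis
  proof (rule boundedI)
    fix z assume "z \<in> K"
    obtain x where x: "x \<in> S" "infdist z S = dist z x"
      using infdist_attains_inf[OF closed_S S_nonempty, of z] by metis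
    then have "cmod (z - x) \<le> \<rho>" using \<open>z \<in> K\<close> by (simp add: K_def dist_norm)
    then show "cmod z \<le> R0 + \<rho>" using R0(2)[OF x(1)] norm_triangle_ineq2[of z x] by linarith
  qed
qed

text \<open>Unlike the full partition function, the confined one is finite for every N: K is bounded
  and \<open>\<Phi> \<ge> - C\<close>. Together with positivity this allows it to be cancelled from
  a quotient.\<close>

lemma restricted_gas_finite: "rgas N K < \<infinity>"
proof -
  obtain R where R: "0 < R" "\<And>x. x \<in> K \<Longrightarrow> cmod x \<le> R" using bounded_K unfolding bounded_pos by blast
  let ?P = "{(j, l). j < l \<and> l < N}"
  define c1 where "c1 = (2 * R) powr (2 * \<beta>)"
  define c where "c = ennreal (c1 ^ card ?P) * ennreal (exp (\<beta> * (real N * C))) ^ N"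
  have "rgas N K \<le> (\<integral>\<^sup>+z. c * indicator (Pi\<^sub>E {..<N} (\<lambda>_. K)) z \<partial>(configurations N))"
    unfolding restricted_gas_def
  proof (rule nn_integral_mono)
    fix z assume z: "z \<in> space (configurations N)"
    show "gas_weight N \<beta> (\<lambda>w. ereal (real N) * \<Phi> w) z * (\<Prod>i<N. indicator K (z i)) \<le> c * indicator (Pi\<^sub>E {..<N} (\<lambda>_. K)) z"
    proof (cases "\<forall>i<N. z i \<in> K")
      case True
      have "(\<Prod>(j, l)\<in>?P. cmod (z j - z l) powr (2 * \<beta>)) \<le> (\<Prod>(j, l)\<in>?P. c1)"
      proof (rule prod_mono, clarify)
        fix j l assume "j < l" "l < N"
        then have "cmod (z j) \<le> R" "cmod (z l) \<le> R" using True R(2) by auto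
        then have "cmod (z j - z l) \<le> 2 * R" using norm_triangle_ineq4[of "z j" "z l"] by linarith
        then show "0 \<le> cmod (z j - z l) powr (2 * \<beta>) \<and> cmod (z j - z l) powr (2 * \<beta>) \<le> c1"
          unfolding c1_def using beta by (intro conjI powr_mono2) auto
      qed
      then have 1: "ennreal (\<Prod>(j, l)\<in>?P. cmod (z j - z l) powr (2 * \<beta>)) \<le> ennreal (c1 ^ card ?P)"
        by (intro ennreal_leI) (simp add: case_prod_unfold)
      have 2: "(\<Prod>i<N. eexp (- (ereal \<beta> * (ereal (real N) * \<Phi> (z i))))) \<le> (\<Prod>i<N. ennreal (exp (\<beta> * (real N * C))))"
      proof (rule prod_mono_ennreal)
        fix i assume "i \<in> {..<N}"
        then have iK: "z i \<in> U" using True nbhd by (auto simp: K_def)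
        have "- C \<le> \<phi> (z i)" using weight_growthD(3)[OF growth, of "z i"] Phi_U[OF iK] by simp
        then have "\<beta> * (real N * (- C)) \<le> \<beta> * (real N * \<phi> (z i))" using beta by (intro mult_left_mono) auto
        then show "eexp (- (ereal \<beta> * (ereal (real N) * \<Phi> (z i)))) \<le> ennreal (exp (\<beta> * (real N * C)))"
          by (simp add: Phi_U[OF iK] eexp_def ennreal_leI)
      qed
      have "gas_weight N \<beta> (\<lambda>w. ereal (real N) * \<Phi> w) z \<le> c"
        unfolding gas_weight_def c_def using mult_mono[OF 1 2] by simp
      moreover have "z \<in> Pi\<^sub>E {..<N} (\<lambda>_. K)" using True z by (auto simp: space_PiM PiE_iff)
      ultimately show ?thesis using True by simp
    next
      case False
      then obtain i where "i < N" "z i \<notin> K" by auto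
      then have p0: "(\<Prod>i<N. indicator K (z i) :: ennreal) = 0" by (intro prod_zero bexI[of _ i]) (auto simp: indicator_def)
      show ?thesis unfolding p0 by simp
    qed
  qed
  also have "\<dots> = c * (\<Prod>i<N. emeasure lborel K)"
    by (subst nn_integral_cmult_indicator) (auto simp: lborel_product.emeasure_PiM intro!: sets_PiM_I_finite)
  also have "\<dots> < \<infinity>"
    using emeasure_bounded_finite[OF bounded_K]
    by (auto simp: c_def less_top[symmetric] ennreal_mult_eq_top_iff power_eq_top_ennreal)
  finally show ?thesis .
qed

text \<open>Within K, where \<Phi> is finite, the density vanishes only when two particles coincide;
  a product of disjoint discs is a box of positive measure that avoids this.\<close>

lemma restricted_gas_pos: "0 < rgas N K"
proof (rule ccontr)
  let ?M = "configurations N"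
  assume "\<not> 0 < rgas N K"
  then have z0: "rgas N K = 0" by simp
  obtain x0 where x0: "x0 \<in> S" using S_nonempty by auto
  \<comment> \<open>N discs of radius s with centres \<open>2 * s\<close> apart on a line from x0
    fit into the disc of radius \<rho> about x0, hence into K. The \<open>+ 1\<close> avoids
    division by zero for \<open>N = 0\<close>.\<close>
  define s where "s = \<rho> / (2 * (real N + 1))"
  have s: "0 < s" unfolding s_def using rho by simp
  define p where "p i = x0 + of_real (2 * s * real i)" for i :: nat
  have pK: "w \<in> K" if "i < N" "w \<in> ball (p i) s" for i w
  proof (rule near_K[OF x0])
    have "cmod (w - x0) \<le> cmod (w - p i) + cmod (p i - x0)" using norm_triangle_ineq[of "w - p i" "p i - x0"] by simp
    also have "\<dots> \<le> s + 2 * s * real i"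
    proof (rule add_mono)
      show "cmod (w - p i) \<le> s" using that by (simp add: dist_norm norm_minus_commute)
      have "p i - x0 = of_real (2 * s * real i)" by (simp add: p_def)
      then have "cmod (p i - x0) = \<bar>2 * s * real i\<bar>" by (simp only: norm_of_real)
      then show "cmod (p i - x0) \<le> 2 * s * real i" using s by simp
    qed
    also have "\<dots> \<le> s + 2 * s * (real N - 1)" using that s by (intro add_left_mono mult_left_mono) auto
    also have "\<dots> \<le> 2 * (real N + 1) * s" using s by (simp add: algebra_simps)
    also have "\<dots> = \<rho>" by (simp add: s_def)
    finally show "cmod (w - x0) \<le> \<rho>" .
  qed
  have dis: "v \<noteq> w" if "i < j" "v \<in> ball (p i) s" "w \<in> ball (p j) s" for i j v w
  proof
    assume "v = w"
    then have "dist (p i) (p j) < s + s" using that dist_triangle2[of "p i" "p j" w] by (auto simp: dist_commute)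
    moreover have "dist (p i) (p j) = 2 * s * (real j - real i)"
    proof -
      have "p j - p i = of_real (2 * s * (real j - real i))" by (simp add: p_def algebra_simps)
      then have "cmod (p j - p i) = \<bar>2 * s * (real j - real i)\<bar>" by (simp only: norm_of_real)
      then show ?thesis using that s by (simp add: dist_norm norm_minus_commute)
    qed
    moreover have "2 * s * 1 \<le> 2 * s * (real j - real i)" using that s by (intro mult_left_mono) auto
    ultimately show False by simp
  qed
  let ?box = "Pi\<^sub>E {..<N} (\<lambda>i. ball (p i) s)"
  have box: "?box \<in> sets ?M" by (intro sets_PiM_I_finite) auto
  have meas': "(\<lambda>z. gas_weight N \<beta> (\<lambda>w. ereal (real N) * \<Phi> w) z * (\<Prod>i<N. indicator K (z i))) \<in> borel_measurable ?M"
    by (intro borel_measurable_times_ennreal measurable_gas_weight measurable_indicator_prod) auto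
  have "AE z in ?M. gas_weight N \<beta> (\<lambda>w. ereal (real N) * \<Phi> w) z * (\<Prod>i<N. indicator K (z i)) = 0"
    using z0 unfolding restricted_gas_def by (subst (asm) nn_integral_0_iff_AE[OF meas'])
  then have "AE z in ?M. z \<notin> ?box"
  proof eventually_elim
    case (elim z)
    show ?case
    proof
      assume z: "z \<in> ?box"
      then have zi: "z i \<in> ball (p i) s" if "i < N" for i using that by (auto simp: PiE_iff)
      have zK: "z i \<in> K" if "i < N" for i using pK[OF that zi[OF that]] .
      have "(\<Prod>(j, l)\<in>{(j, l). j < l \<and> l < N}. cmod (z j - z l) powr (2 * \<beta>)) > 0"
      proof (rule prod_pos, clarify)
        fix j l assume jl: "j < l" "l < N"
        then have "z j \<noteq> z l" using dis[OF jl(1) zi zi] by auto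
        then show "0 < cmod (z j - z l) powr (2 * \<beta>)" by simp
      qed
      moreover have "(\<Prod>i<N. eexp (- (ereal \<beta> * (ereal (real N) * \<Phi> (z i))))) \<noteq> 0"
      proof -
        have "eexp (- (ereal \<beta> * (ereal (real N) * \<Phi> (z i)))) \<noteq> 0" if "i < N" for i
        proof -
          have "z i \<in> U" using zK[OF that] nbhd by (auto simp: K_def)
          then show ?thesis by (simp add: Phi_U eexp_def ennreal_eq_0_iff)
        qed
        then show ?thesis by auto
      qed
      moreover have "(\<Prod>i<N. indicator K (z i)) = (1 :: ennreal)" using zK by simp
      ultimately show False using elim by (simp add: gas_weight_def ennreal_eq_0_iff)
    qed
  qed
  then have "emeasure ?M ?box = 0"
    by (subst (asm) AE_iff_measurable[OF box]) (use sets.sets_into_space[OF box] in blast)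
  moreover have "emeasure ?M ?box = (\<Prod>i<N. emeasure lborel (ball (p i) s))"
    by (intro lborel_product.emeasure_PiM) auto
  moreover have "emeasure lborel (ball (p i) s) \<noteq> 0" for i
  proof -
    have "0 < unit_ball_vol (real DIM(complex)) * s ^ DIM(complex)" using s by (intro mult_pos_pos) auto
    moreover have "emeasure lborel (ball (p i) s) = ennreal (unit_ball_vol (real DIM(complex)) * s ^ DIM(complex))"
      using s by (intro emeasure_ball) auto
    ultimately show ?thesis by (metis ennreal_eq_0_iff not_le)
  qed
  ultimately show False by auto
qed

end

lemma measure_support_nonempty:
  fixes \<mu> :: "'a::second_countable_topology measure"
  assumes "prob_space \<mu>" "sets \<mu> = sets borel"
  shows "measure_support \<mu> \<noteq> {}"
proof
  assume "measure_support \<mu> = {}"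
  then have "UNIV \<in> null_sets \<mu>" using emeasure_compl_measure_support[OF assms(2)] by simp
  moreover have "emeasure \<mu> UNIV = 1"
    using prob_space.emeasure_space_1[OF assms(1)] sets_eq_imp_space_eq[OF assms(2)] by simp
  ultimately show False by (simp add: null_sets_def)
qed

lemma C_k_on_continuous: "C_k_on k f U \<Longrightarrow> continuous_on U f"
  by (cases k) (auto intro!: continuous_at_imp_continuous_on differentiable_imp_continuous_within)

text \<open>K need not be convex, so the mean value inequality is applied only in closed balls
  contained in K. The derivative is controlled by its two partial derivatives, which are bounded on
  K.\<close>

lemma C_k_on_Lipschitz:
  fixes f :: "complex \<Rightarrow> real"
  assumes Ck: "C_k_on (Suc k) f U" and K: "compact K" "K \<subseteq> U"
  shows "\<exists>L\<ge>0. \<forall>x r y. cball x r \<subseteq> K \<longrightarrow> cmod (y - x) \<le> r \<longrightarrow> \<bar>f y - f x\<bar> \<le> L * cmod (y - x)"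
proof -
  have df: "f differentiable (at x)" if "x \<in> U" for x using Ck that by simp
  have cD: "continuous_on U (\<lambda>x. frechet_derivative f (at x) b)" if "b \<in> Basis" for b
    using Ck that by (auto intro: C_k_on_continuous)
  have bd: "\<exists>B. \<forall>x\<in>K. \<bar>frechet_derivative f (at x) b\<bar> \<le> B" if b: "b \<in> Basis" for b
  proof -
    have "compact ((\<lambda>x. frechet_derivative f (at x) b) ` K)"
      by (rule compact_continuous_image[OF continuous_on_subset[OF cD[OF b] K(2)] K(1)])
    then have "bounded ((\<lambda>x. frechet_derivative f (at x) b) ` K)" by (rule compact_imp_bounded)
    then show ?thesis unfolding bounded_iff by auto
  qed
  obtain B1 where B1: "\<forall>x\<in>K. \<bar>frechet_derivative f (at x) 1\<bar> \<le> B1" using bd[of 1] by (auto simp: Basis_complex_def)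
  obtain B2 where B2: "\<forall>x\<in>K. \<bar>frechet_derivative f (at x) \<i>\<bar> \<le> B2" using bd[of \<i>] by (auto simp: Basis_complex_def)
  define L where "L = \<bar>B1\<bar> + \<bar>B2\<bar>"
  have on: "onorm (frechet_derivative f (at x)) \<le> L" if x: "x \<in> K" for x
  proof (rule onorm_le)
    fix v
    have "(f has_derivative frechet_derivative f (at x)) (at x)"
      using df[of x] x K(2) frechet_derivative_works by blast
    then interpret bounded_linear "frechet_derivative f (at x)" by (rule has_derivative_bounded_linear)
    let ?D = "frechet_derivative f (at x)"
    have "v = Re v *\<^sub>R 1 + Im v *\<^sub>R \<i>" by (simp add: complex_eq_iff)
    then have "?D v = Re v * ?D 1 + Im v * ?D \<i>" by (metis add scaleR real_scaleR_def)
    then have "\<bar>?D v\<bar> \<le> \<bar>Re v\<bar> * \<bar>?D 1\<bar> + \<bar>Im v\<bar> * \<bar>?D \<i>\<bar>"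
      using abs_triangle_ineq[of "Re v * ?D 1" "Im v * ?D \<i>"] by (simp add: abs_mult)
    also have "\<dots> \<le> cmod v * \<bar>B1\<bar> + cmod v * \<bar>B2\<bar>"
      using B1 B2 x abs_Re_le_cmod[of v] abs_Im_le_cmod[of v] by (intro add_mono mult_mono) force+
    finally show "norm (?D v) \<le> L * norm v" by (simp add: L_def algebra_simps)
  qed
  have "\<bar>f y - f x\<bar> \<le> L * cmod (y - x)" if sub: "cball x r \<subseteq> K" and y: "cmod (y - x) \<le> r" for x r y
  proof -
    have "norm (f y - f x) \<le> L * norm (y - x)"
    proof (rule differentiable_bound[of "cball x r" f "\<lambda>z. frechet_derivative f (at z)"])
      fix z assume z: "z \<in> cball x r"
      then have "z \<in> K" using sub by auto
      then show "onorm (frechet_derivative f (at z)) \<le> L" by (rule on)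
      have "f differentiable (at z)" using df \<open>z \<in> K\<close> K by auto
      then show "(f has_derivative frechet_derivative f (at z)) (at z within cball x r)"
        using frechet_derivative_works has_derivative_at_withinI by blast
    next
      have "0 \<le> r" using y norm_ge_zero order_trans by blast
      then show "x \<in> cball x r" by simp
      show "y \<in> cball x r" using y by (simp add: dist_norm norm_minus_commute)
    qed simp
    then show ?thesis by simp
  qed
  moreover have "0 \<le> L" by (simp add: L_def)
  ultimately show ?thesis by blast
qed

lemma elog_ge: "ennreal (exp x) \<le> y \<Longrightarrow> ereal x \<le> elog y"
proof (cases y)
  case (real r)
  assume le: "ennreal (exp x) \<le> y"
  then have "exp x \<le> r" using real by (simp add: ennreal_le_iff)
  then have "x \<le> ln r" by (simp add: ln_ge_iff less_le_trans[OF exp_gt_zero])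
  moreover have "0 < r" using \<open>exp x \<le> r\<close> less_le_trans[OF exp_gt_zero] by blast
  ultimately show ?thesis using real by (simp add: elog_def ennreal_eq_0_iff)
qed (simp add: elog_def)

text \<open>Confining a measure to the set \<open>D\<close> where \<open>\<Psi>\<close> is bounded below by the dilated weight, and
  undoing the dilation, compares the two minimal energies; the dilation contributes \<open>- ln c\<close>.\<close>

lemma (in equilibrium) free_energy_dilation:
  assumes g: "weight_growth \<Psi> \<epsilon> C" and meas' [measurable]: "\<Psi> \<in> borel_measurable borel" and c: "1 \<le> c"
    and D [measurable]: "D \<in> sets borel"
    and inD: "\<And>z. z \<in> D \<Longrightarrow> \<Phi> (z / of_real c) \<le> \<Psi> z"
    and outD: "\<And>z. z \<notin> D \<Longrightarrow> ereal (ln (1 + (cmod z)\<^sup>2) - C + M) \<le> \<Psi> z" and M: "Q \<mu> \<mu> \<le> ennreal M"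
  shows "ereal (enn2real (Q \<mu> \<mu>) / 2 - C - ln c) \<le> free_energy \<Psi>"
  unfolding free_energy_def
proof (rule INF_greatest)
  fix \<nu> assume \<nu>: "\<nu> \<in> prob_measures"
  interpret prob_space \<nu> using \<nu> by (simp add: prob_measures_def)
  have s [measurable_cong]: "sets \<nu> = sets borel" using \<nu> by (simp add: prob_measures_def)
  have one: "emeasure \<nu> (space \<nu>) = 1" by (rule emeasure_space_1)
  define q where "q = Q \<mu> \<mu>"
  have qf: "q \<noteq> \<infinity>" using fin by (simp add: q_def)
  define sc where "sc z = z / of_real c" for z :: complex
  have sc [measurable]: "sc \<in> borel_measurable borel" unfolding sc_def[abs_def] by measurable
  let ?k' = "energy_kernel \<Psi> C"
  let ?kD = "\<lambda>z w. k (sc z) (sc w) * indicator D z * indicator D w :: ennreal"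
  let ?r = "\<lambda>z w. q * (if z \<in> D \<and> w \<in> D then 0 else 1) :: ennreal"
  have lnc: "0 \<le> ln c" using c by simp
  \<comment> \<open>By \<open>outD\<close> such a pair costs at least \<open>M \<ge> q\<close>, as
    much as an average pair at equilibrium, so leaving D never lowers the energy.\<close>
  have outker: "q \<le> ?k' z w" if "z \<notin> D" for z w
  proof (cases "z = w")
    case False
    have 1: "ereal (ln (1 + (cmod z)\<^sup>2) - C + M) \<le> \<Psi> z" by (rule outD[OF that])
    have 2: "ereal (ln (1 + (cmod w)\<^sup>2) - C) \<le> \<Psi> w" by (rule weight_growthD(2)[OF g])
    have "ereal M \<le> ereal ((ln (1 + (cmod z)\<^sup>2) - C + M) + (ln (1 + (cmod w)\<^sup>2) - C) + (2 * C - ln ((cmod (z - w))\<^sup>2)))"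
      using ln_cmod_diff_le[of z w] by simp
    also have "\<dots> = ereal (ln (1 + (cmod z)\<^sup>2) - C + M) + ereal (ln (1 + (cmod w)\<^sup>2) - C) + ereal (2 * C - ln ((cmod (z - w))\<^sup>2))"
      by simp
    also have "\<dots> \<le> \<Psi> z + \<Psi> w + ereal (2 * C - ln ((cmod (z - w))\<^sup>2))"
      by (intro add_mono 1 2 order_refl)
    finally have "e2ennreal (ereal M) \<le> e2ennreal (\<Psi> z + \<Psi> w + ereal (2 * C - ln ((cmod (z - w))\<^sup>2)))"
      by (rule e2ennreal_mono)
    then have "ennreal M \<le> ?k' z w" using False by (simp add: energy_kernel_def)
    then show ?thesis using M unfolding q_def by (rule order_trans[rotated])
  qed (simp add: energy_kernel_def)
  \<comment> \<open>The term \<open>2 * ln c\<close> is the change of \<open>ln (|z - w|^2)\<close>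
    under \<open>sc\<close>; on D the weights are compared by \<open>inD\<close>.\<close>
  have pt: "?kD z w + ?r z w \<le> ?k' z w + ennreal (2 * ln c)" for z w
  proof (cases "z \<in> D \<and> w \<in> D")
    case True
    have "k (sc z) (sc w) \<le> ?k' z w + ennreal (2 * ln c)"
    proof (cases "z = w")
      case False
      have ne: "sc z \<noteq> sc w" using False c by (simp add: sc_def)
      have "cmod (sc z - sc w) = cmod (z - w) / c"
        using c by (simp add: sc_def diff_divide_distrib[symmetric] norm_divide)
      then have l: "ln ((cmod (sc z - sc w))\<^sup>2) = ln ((cmod (z - w))\<^sup>2) - 2 * ln c"
        using False c by (simp add: power_divide ln_div ln_realpow)
      have pz: "\<Phi> (sc z) \<le> \<Psi> z" "\<Phi> (sc w) \<le> \<Psi> w" using inD True by (auto simp: sc_def)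
      have "k (sc z) (sc w) = e2ennreal (\<Phi> (sc z) + \<Phi> (sc w) + ereal (2 * C - ln ((cmod (sc z - sc w))\<^sup>2)))"
        using ne by (simp add: energy_kernel_def)
      also have "\<dots> \<le> e2ennreal (\<Psi> z + \<Psi> w + ereal (2 * C - ln ((cmod (sc z - sc w))\<^sup>2)))"
        by (intro e2ennreal_mono add_mono pz order_refl)
      also have "\<dots> \<le> e2ennreal (\<Psi> z + \<Psi> w + ereal (2 * C - ln ((cmod (z - w))\<^sup>2))) + ennreal (2 * ln c)"
      proof (cases "\<Psi> z = \<infinity> \<or> \<Psi> w = \<infinity>")
        case True
        then show ?thesis using weight_growthD(4)[OF g, of z] weight_growthD(4)[OF g, of w]
          by (cases "\<Psi> z"; cases "\<Psi> w") auto
      next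
        case nf: False
        obtain a where a: "\<Psi> z = ereal a" using nf weight_growthD(4)[OF g, of z] by (cases "\<Psi> z") auto
        obtain b where b: "\<Psi> w = ereal b" using nf weight_growthD(4)[OF g, of w] by (cases "\<Psi> w") auto
        define t where "t = a + b + (2 * C - ln ((cmod (z - w))\<^sup>2))"
        have "e2ennreal (\<Psi> z + \<Psi> w + ereal (2 * C - ln ((cmod (sc z - sc w))\<^sup>2))) = ennreal (t + 2 * ln c)"
          unfolding a b l by (simp add: t_def algebra_simps)
        also have "\<dots> \<le> ennreal t + ennreal (2 * ln c)"
          using lnc by (cases "0 \<le> t") (simp_all add: ennreal_neg ennreal_plus ennreal_leI)
        also have "ennreal t = e2ennreal (\<Psi> z + \<Psi> w + ereal (2 * C - ln ((cmod (z - w))\<^sup>2)))"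
          unfolding a b by (simp add: t_def)
        finally show ?thesis .
      qed
      also have "\<dots> = ?k' z w + ennreal (2 * ln c)" using False by (simp add: energy_kernel_def)
      finally show ?thesis .
    qed (simp add: energy_kernel_def)
    then show ?thesis using True by simp
  next
    case False
    then have "q \<le> ?k' z w" using outker[of z w] outker[of w z] by (auto simp: energy_kernel_commute)
    moreover have kD0: "?kD z w = 0" and r0: "?r z w = q" using False by (auto simp: indicator_def)
    ultimately show ?thesis unfolding kD0 r0 by (simp add: add_increasing2)
  qed
  have m1 [measurable]: "(\<lambda>(z, w). k z w) \<in> borel_measurable (borel \<Otimes>\<^sub>M borel)" by measurable
  have mk: "(\<lambda>(z, w). k (sc z) (sc w)) \<in> borel_measurable (borel \<Otimes>\<^sub>M borel)"
    using measurable_compose[OF _ m1, of "\<lambda>(z, w). (sc z, sc w)" "borel \<Otimes>\<^sub>M borel"] by (simp add: case_prod_unfold)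
  have md: "(\<lambda>(z, w). ?kD z w) \<in> borel_measurable (borel \<Otimes>\<^sub>M borel)"
    using mk by (auto simp: case_prod_unfold)
  have mki: "(\<lambda>w. k (sc z) (sc w)) \<in> borel_measurable borel" for z by measurable
  have mo: "(\<lambda>z. \<integral>\<^sup>+w. ?kD z w \<partial>\<nu>) \<in> borel_measurable borel"
    by (rule borel_measurable_nn_integral) (use md in \<open>simp cong: measurable_cong_sets sets_pair_measure_cong\<close>)
  have mr: "(\<lambda>(z, w). ?r z w) \<in> borel_measurable (borel \<Otimes>\<^sub>M borel)" by measurable
  have mor: "(\<lambda>z. \<integral>\<^sup>+w. ?r z w \<partial>\<nu>) \<in> borel_measurable borel"
    by (rule borel_measurable_nn_integral) (use mr in \<open>simp cong: measurable_cong_sets sets_pair_measure_cong\<close>)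
  have mk': "(\<lambda>(z, w). ?k' z w) \<in> borel_measurable (borel \<Otimes>\<^sub>M borel)" by measurable
  have mok: "(\<lambda>z. \<integral>\<^sup>+w. ?k' z w \<partial>\<nu>) \<in> borel_measurable borel"
    by (rule borel_measurable_nn_integral) (use mk' in \<open>simp cong: measurable_cong_sets sets_pair_measure_cong\<close>)
  \<comment> \<open>Minimality of \<mu>, tested with the image under \<open>sc\<close> of \<nu>
    conditioned on D and multiplied by the square of the mass of D.\<close>
  have inside: "(\<integral>\<^sup>+z. (\<integral>\<^sup>+w. q * indicator D z * indicator D w \<partial>\<nu>) \<partial>\<nu>) \<le> (\<integral>\<^sup>+z. (\<integral>\<^sup>+w. ?kD z w \<partial>\<nu>) \<partial>\<nu>)"
  proof (cases "emeasure \<nu> D = 0")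
    case True
    have "(\<integral>\<^sup>+z. (\<integral>\<^sup>+w. q * indicator D z * indicator D w \<partial>\<nu>) \<partial>\<nu>) = 0"
      using True by (simp add: nn_integral_cmult)
    then show ?thesis by simp
  next
    case nz: False
    define d where "d = emeasure \<nu> D"
    have d: "d \<noteq> 0" "d \<noteq> \<infinity>" using nz by (simp_all add: d_def)
    define \<kappa> where "\<kappa> = distr (uniform_measure \<nu> D) borel sc"
    have su: "sets (uniform_measure \<nu> D) = sets borel" by (simp add: s)
    have \<kappa>: "\<kappa> \<in> prob_measures"
      unfolding prob_measures_def \<kappa>_def
      using prob_space_uniform_measure[OF nz] su
      by (auto intro!: prob_space.prob_space_distr simp: measurable_cong_sets[OF su refl])
    have int: "(\<integral>\<^sup>+z. f z \<partial>\<kappa>) = (\<integral>\<^sup>+z. f (sc z) * indicator D z \<partial>\<nu>) / d" if [measurable]: "f \<in> borel_measurable borel" for f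
      unfolding \<kappa>_def d_def
      by (subst nn_integral_distr) (auto simp: nn_integral_uniform_measure measurable_cong_sets[OF su refl])
    have "q \<le> Q \<kappa> \<kappa>" unfolding q_def by (rule minimal[OF \<kappa>])
    also have "\<dots> = (\<integral>\<^sup>+z. (\<integral>\<^sup>+w. k (sc z) (sc w) * indicator D w \<partial>\<nu>) / d * indicator D z \<partial>\<nu>) / d"
      unfolding mutual_energy_def using int[OF eff_measurable[OF \<kappa>]] int[OF kernel_measurable_section] by simp
    also have "(\<integral>\<^sup>+z. (\<integral>\<^sup>+w. k (sc z) (sc w) * indicator D w \<partial>\<nu>) / d * indicator D z \<partial>\<nu>) = (\<integral>\<^sup>+z. (\<integral>\<^sup>+w. ?kD z w \<partial>\<nu>) / d \<partial>\<nu>)"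
      by (intro nn_integral_cong) (auto simp: indicator_def)
    also have "\<dots> = (\<integral>\<^sup>+z. (\<integral>\<^sup>+w. ?kD z w \<partial>\<nu>) \<partial>\<nu>) / d"
      using mo by (intro nn_integral_divide) (simp cong: measurable_cong_sets)
    finally have "q * d * d \<le> (\<integral>\<^sup>+z. (\<integral>\<^sup>+w. ?kD z w \<partial>\<nu>) \<partial>\<nu>) / d / d * d * d"
      by (intro mult_right_mono) auto
    also have "\<dots> = (\<integral>\<^sup>+z. (\<integral>\<^sup>+w. ?kD z w \<partial>\<nu>) \<partial>\<nu>)"
    proof -
      have "x / d * d = x" for x using d by (simp add: ennreal_divide_times ennreal_divide_self less_top)
      then show ?thesis by (simp only:)
    qed
    finally have "q * d * d \<le> (\<integral>\<^sup>+z. (\<integral>\<^sup>+w. ?kD z w \<partial>\<nu>) \<partial>\<nu>)" .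
    moreover have "(\<integral>\<^sup>+z. (\<integral>\<^sup>+w. q * indicator D z * indicator D w \<partial>\<nu>) \<partial>\<nu>) = q * d * d"
    proof -
      have "(\<integral>\<^sup>+w. q * indicator D z * indicator D w \<partial>\<nu>) = (q * d) * indicator D z" for z
        by (subst nn_integral_cmult_indicator) (simp_all add: s d_def mult_ac)
      then show ?thesis by (simp only:) (subst nn_integral_cmult_indicator, simp_all add: s d_def)
    qed
    ultimately show ?thesis by simp
  qed
  \<comment> \<open>The constant q is split according to whether both points of a pair lie in D:
    there \<open>inside\<close> applies, elsewhere q itself bounds the kernel from below.\<close>
  have "q = (\<integral>\<^sup>+z. (\<integral>\<^sup>+w. q * indicator D z * indicator D w + ?r z w \<partial>\<nu>) \<partial>\<nu>)"
  proof -
    have "q * indicator D z * indicator D w + ?r z w = q" for z w by (auto simp: indicator_def)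
    then show ?thesis by (simp add: one)
  qed
  also have "\<dots> = (\<integral>\<^sup>+z. (\<integral>\<^sup>+w. q * indicator D z * indicator D w \<partial>\<nu>) \<partial>\<nu>) + (\<integral>\<^sup>+z. (\<integral>\<^sup>+w. ?r z w \<partial>\<nu>) \<partial>\<nu>)"
    using mor by (simp add: nn_integral_add cong: measurable_cong_sets)
  also have "\<dots> \<le> (\<integral>\<^sup>+z. (\<integral>\<^sup>+w. ?kD z w \<partial>\<nu>) \<partial>\<nu>) + (\<integral>\<^sup>+z. (\<integral>\<^sup>+w. ?r z w \<partial>\<nu>) \<partial>\<nu>)"
    by (intro add_right_mono inside)
  also have "\<dots> = (\<integral>\<^sup>+z. (\<integral>\<^sup>+w. ?kD z w + ?r z w \<partial>\<nu>) \<partial>\<nu>)"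
    using mo mor mki by (simp add: nn_integral_add cong: measurable_cong_sets)
  also have "\<dots> \<le> (\<integral>\<^sup>+z. (\<integral>\<^sup>+w. ?k' z w + ennreal (2 * ln c) \<partial>\<nu>) \<partial>\<nu>)"
    by (intro nn_integral_mono pt)
  also have "\<dots> = mutual_energy \<Psi> C \<nu> \<nu> + ennreal (2 * ln c)"
  proof -
    have "?k' z \<in> borel_measurable \<nu>" for z unfolding energy_kernel_def[abs_def] by measurable
    then show ?thesis using mok by (simp add: nn_integral_add one mutual_energy_def cong: measurable_cong_sets)
  qed
  finally have main: "q \<le> mutual_energy \<Psi> C \<nu> \<nu> + ennreal (2 * ln c)" .
  obtain r where r: "q = ennreal r" "0 \<le> r" using qf by (cases q) auto
  show "ereal (enn2real (Q \<mu> \<mu>) / 2 - C - ln c) \<le> weighted_energy \<Psi> \<nu>"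
  proof (cases "mutual_energy \<Psi> C \<nu> \<nu>")
    case top
    then show ?thesis unfolding weighted_energy_eq[OF g meas' \<nu>] by simp
  next
    case (real e)
    have "ennreal r \<le> ennreal (e + 2 * ln c)" using main real r lnc by (simp add: ennreal_plus)
    then have "r \<le> e + 2 * ln c" by (subst (asm) ennreal_le_iff) (use real lnc in auto)
    then show ?thesis unfolding weighted_energy_eq[OF g meas' \<nu>] real(2) q_def[symmetric] r(1)
      using real(1) r(2) by (simp add: enn2ereal_ennreal field_simps)
  qed
qed

section \<open>Exponential tilts of the gas\<close>

lemma eexp_tilt:
  assumes "x \<noteq> -\<infinity>" "0 < \<beta>" "0 < N"
  shows "eexp (- (ereal \<beta> * (ereal (real N) * x))) * ennreal (exp (- (\<beta> * real N * y))) =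
    eexp (- (ereal \<beta> * (ereal (real N) * (x + ereal y))))"
  using assms
  by (cases x) (auto simp: eexp_def ennreal_mult[symmetric] mult_exp_exp algebra_simps ennreal_top_mult)

text \<open>\<open>N^2\<close> times the linear statistic is N times the sum of the values
  \<open>u (z i)\<close>, so the tilt amounts to replacing \<Phi> by \<open>\<Phi> + u\<close>, and
  the expectation becomes a quotient of two partition functions.\<close>

lemma gas_weight_tilt:
  assumes "\<And>w. \<Phi> w \<noteq> -\<infinity>" "0 < \<beta>" "0 < N"
  shows "gas_weight N \<beta> (\<lambda>w. ereal (real N) * \<Phi> w) z * ennreal (exp (- (\<beta> * (real N)\<^sup>2 * linear_statistic N u z))) =
    gas_weight N \<beta> (\<lambda>w. ereal (real N) * (\<Phi> w + ereal (u w))) z"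
proof -
  have "exp (- (\<beta> * (real N)\<^sup>2 * linear_statistic N u z)) = (\<Prod>i<N. exp (- (\<beta> * real N * u (z i))))"
  proof -
    have "- (\<beta> * (real N)\<^sup>2 * linear_statistic N u z) = (\<Sum>i<N. - (\<beta> * real N * u (z i)))"
      using assms(3) by (simp add: linear_statistic_def power2_eq_square sum_negf sum_distrib_left mult.assoc)
    then show ?thesis by (simp add: exp_sum)
  qed
  then have "ennreal (exp (- (\<beta> * (real N)\<^sup>2 * linear_statistic N u z))) = (\<Prod>i<N. ennreal (exp (- (\<beta> * real N * u (z i)))))"
    by (simp add: prod_ennreal)
  then show ?thesis
    unfolding gas_weight_def eexp_tilt[OF assms, symmetric] by (simp add: prod.distrib mult.assoc)
qed

lemma gas_weight_cong:
  assumes "\<And>i. i < N \<Longrightarrow> V (z i) = V' (z i)"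
  shows "gas_weight N \<beta> V z = gas_weight N \<beta> V' z"
  unfolding gas_weight_def using assms by (auto intro!: arg_cong2[where f = times] prod.cong)

lemma ennreal_divide_antimono:
  fixes x y z :: ennreal
  assumes "y \<le> z"
  shows "x / z \<le> x / y"
proof -
  have "inverse z \<le> inverse y"
  proof (cases z)
    case (real c)
    then obtain d where d: "y = ennreal d" "0 \<le> d" using assms by (cases y) (auto simp: top_unique)
    show ?thesis
    proof (cases "d = 0")
      case False
      then have "0 < d" "d \<le> c" using assms d real by (auto simp: ennreal_le_iff)
      then show ?thesis unfolding d(1) real(2) by (simp add: inverse_ennreal ennreal_leI le_imp_inverse_le)
    qed (simp add: d)
  qed simp
  then show ?thesis unfolding divide_ennreal_def by (rule mult_left_mono) simp
qed

context lipschitz_equilibrium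
begin

text \<open>Numerator and denominator of this quotient are both compared with
  \<open>rgas N K\<close>: the numerator is restricted to particles in the dilated set, where the
  tilted weight is the dilated one, and the denominator is bounded by hypothesis. The unknown
  \<open>rgas N K\<close> then cancels.\<close>

lemma gas_expectation_lower_bound:
  assumes c: "0 < c" and N: "0 < N" and u: "u \<in> borel_measurable borel"
    and dil: "\<And>z. z \<in> K \<Longrightarrow> \<Phi> (of_real c * z) + ereal (u (of_real c * z)) = \<Phi> z"
    and Z: "partition_function N \<beta> (\<lambda>w. ereal (real N) * \<Phi> w) \<le> ennreal (exp (\<delta> * real N)) * rgas N K"
  shows "ennreal (exp (2 * real N * ln c + \<beta> * (real N * (real N - 1)) * ln c - \<delta> * real N)) \<le>
    (\<integral>\<^sup>+z. ennreal (exp (- (\<beta> * (real N)\<^sup>2 * linear_statistic N u z)))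
                \<partial>(coulomb_gas N \<beta> (\<lambda>w. ereal (real N) * \<Phi> w)))"
proof -
  let ?M = "configurations N"
  define V where "V = (\<lambda>w. ereal (real N) * \<Phi> w)"
  define V' where "V' = (\<lambda>w. ereal (real N) * (\<Phi> w + ereal (u w)))"
  define Z where "Z = partition_function N \<beta> V"
  define e where "e z = ennreal (exp (- (\<beta> * (real N)\<^sup>2 * linear_statistic N u z)))" for z
  note [measurable] = u
  have [measurable]: "V \<in> borel_measurable borel" "V' \<in> borel_measurable borel"
    unfolding V_def V'_def by measurable
  have gm: "gas_weight N \<beta> V \<in> borel_measurable ?M" "gas_weight N \<beta> V' \<in> borel_measurable ?M"
    by (rule measurable_gas_weight, measurable)+
  have em: "e \<in> borel_measurable ?M"
  proof -
    have "(\<lambda>z. u (z i)) \<in> borel_measurable ?M" if "i \<in> {..<N}" for i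
      using measurable_component_singleton[of i "{..<N}" "\<lambda>_. lborel :: complex measure"] that u
      by (intro measurable_compose[OF _ u]) auto
    then have "(\<lambda>z. \<Sum>i<N. u (z i)) \<in> borel_measurable ?M" by (rule borel_measurable_sum)
    then show ?thesis unfolding e_def[abs_def] linear_statistic_def by measurable
  qed
  have tilt: "gas_weight N \<beta> V z * e z = gas_weight N \<beta> V' z" for z
    unfolding V_def V'_def e_def by (rule gas_weight_tilt) (use weight_growthD(4)[OF growth] beta N in auto)
  have mK: "(\<lambda>w. w / of_real c) -` K \<in> sets (borel :: complex measure)"
    using measurable_sets[of "\<lambda>w::complex. w / of_real c" borel borel K] by simp
  define D where "D = (\<lambda>w. w / of_real c) -` K"
  define A where "A = c powr (\<beta> * (real N * (real N - 1)))"
  have "(\<integral>\<^sup>+z. gas_weight N \<beta> V' z \<partial>?M) \<ge> (\<integral>\<^sup>+z. gas_weight N \<beta> V' z * (\<Prod>i<N. indicator D (z i)) \<partial>?M)"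
  proof (rule nn_integral_mono)
    fix z :: "nat \<Rightarrow> complex"
    have "(\<Prod>i<N. indicator D (z i) :: ennreal) \<le> (\<Prod>i<N. 1)"
      by (rule prod_mono_ennreal) (simp add: indicator_def)
    then have "gas_weight N \<beta> V' z * (\<Prod>i<N. indicator D (z i)) \<le> gas_weight N \<beta> V' z * 1"
      by (intro mult_left_mono) auto
    then show "gas_weight N \<beta> V' z * (\<Prod>i<N. indicator D (z i)) \<le> gas_weight N \<beta> V' z" by simp
  qed
  moreover have "(\<integral>\<^sup>+z. gas_weight N \<beta> V' z * (\<Prod>i<N. indicator D (z i)) \<partial>?M) = ennreal (c\<^sup>2) ^ N * (ennreal A * rgas N K)"
  proof -
    have "(\<integral>\<^sup>+z. gas_weight N \<beta> V' z * (\<Prod>i<N. indicator D (z i)) \<partial>?M) = ennreal (c\<^sup>2) ^ N *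
      (\<integral>\<^sup>+z. gas_weight N \<beta> V' (\<lambda>i\<in>{..<N}. of_real c * z i) * (\<Prod>i<N. indicator D ((\<lambda>i\<in>{..<N}. of_real c * z i) i)) \<partial>?M)"
      by (rule nn_integral_PiM_scale[OF c])
        (intro borel_measurable_times_ennreal gm measurable_indicator_prod, auto simp: D_def mK)
    also have "(\<integral>\<^sup>+z. gas_weight N \<beta> V' (\<lambda>i\<in>{..<N}. of_real c * z i) * (\<Prod>i<N. indicator D ((\<lambda>i\<in>{..<N}. of_real c * z i) i)) \<partial>?M)
       = (\<integral>\<^sup>+z. ennreal A * (gas_weight N \<beta> V z * (\<Prod>i<N. indicator K (z i))) \<partial>?M)"
    proof (rule nn_integral_cong)
      fix z :: "nat \<Rightarrow> complex"
      have i: "(\<Prod>i<N. indicator D ((\<lambda>i\<in>{..<N}. of_real c * z i) i)) = (\<Prod>i<N. indicator K (z i) :: ennreal)"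
        by (rule prod.cong) (use c in \<open>auto simp: D_def indicator_def\<close>)
      have "gas_weight N \<beta> V' (\<lambda>i\<in>{..<N}. of_real c * z i) * (\<Prod>i<N. indicator K (z i)) = ennreal A * gas_weight N \<beta> V z * (\<Prod>i<N. indicator K (z i))"
      proof (cases "\<forall>i<N. z i \<in> K")
        case True
        have "gas_weight N \<beta> (\<lambda>w. V' (of_real c * w)) z = gas_weight N \<beta> V z"
          by (rule gas_weight_cong) (use True dil in \<open>simp add: V_def V'_def\<close>)
        then show ?thesis unfolding gas_weight_scale[OF c] A_def by simp
      next
        case False
        then obtain i where "i < N" "z i \<notin> K" by auto
        then have p0: "(\<Prod>i<N. indicator K (z i) :: ennreal) = 0" by (intro prod_zero bexI[of _ i]) (auto simp: indicator_def)
        show ?thesis unfolding p0 by simp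
      qed
      then show "gas_weight N \<beta> V' (\<lambda>i\<in>{..<N}. of_real c * z i) * (\<Prod>i<N. indicator D ((\<lambda>i\<in>{..<N}. of_real c * z i) i))
        = ennreal A * (gas_weight N \<beta> V z * (\<Prod>i<N. indicator K (z i)))"
        unfolding i by (simp add: mult.assoc)
    qed
    also have "\<dots> = ennreal A * rgas N K"
      unfolding restricted_gas_def V_def[symmetric]
      by (intro nn_integral_cmult borel_measurable_times_ennreal gm measurable_indicator_prod) auto
    finally show ?thesis .
  qed
  ultimately have low: "ennreal (c\<^sup>2) ^ N * (ennreal A * rgas N K) \<le> (\<integral>\<^sup>+z. gas_weight N \<beta> V' z \<partial>?M)" by simp
  obtain r where r: "rgas N K = ennreal r" "0 < r"
    using restricted_gas_finite[of N] restricted_gas_pos[of N] by (cases "rgas N K") auto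
  define X where "X = exp (2 * real N * ln c + \<beta> * (real N * (real N - 1)) * ln c)"
  have XA: "(c\<^sup>2) ^ N * A = X"
  proof -
    have "(c\<^sup>2) ^ N = exp (real N * (2 * ln c))"
      using c by (simp add: exp_of_nat_mult exp_double)
    then show ?thesis using c by (simp add: X_def A_def powr_def mult_exp_exp algebra_simps)
  qed
  have "ennreal (exp (2 * real N * ln c + \<beta> * (real N * (real N - 1)) * ln c - \<delta> * real N)) = ennreal (X * r) / ennreal (exp (\<delta> * real N) * r)"
    using r by (subst divide_ennreal) (simp_all add: X_def exp_diff exp_add field_simps)
  also have "\<dots> = (ennreal (c\<^sup>2) ^ N * (ennreal A * rgas N K)) / (ennreal (exp (\<delta> * real N)) * rgas N K)"
    unfolding XA[symmetric] r(1) using r(2) by (simp add: ennreal_mult ennreal_power A_def mult.assoc)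
  also have "\<dots> \<le> (\<integral>\<^sup>+z. gas_weight N \<beta> V' z \<partial>?M) / (ennreal (exp (\<delta> * real N)) * rgas N K)"
    by (rule divide_right_mono_ennreal[OF low])
  also have "\<dots> \<le> (\<integral>\<^sup>+z. gas_weight N \<beta> V' z \<partial>?M) / Z"
    using Z unfolding Z_def V_def by (rule ennreal_divide_antimono)
  also have "\<dots> = (\<integral>\<^sup>+z. gas_weight N \<beta> V z / Z * e z \<partial>?M)"
  proof -
    have "gas_weight N \<beta> V z / Z * e z = gas_weight N \<beta> V' z / Z" for z
      unfolding tilt[symmetric] divide_ennreal_def by (simp add: mult_ac)
    then show ?thesis using gm by (simp add: nn_integral_divide)
  qed
  also have "\<dots> = (\<integral>\<^sup>+z. e z \<partial>coulomb_gas N \<beta> V)"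
    unfolding coulomb_gas_def Z_def[symmetric]
    using gm em by (subst nn_integral_density) auto
  finally show ?thesis unfolding e_def V_def .
qed

end

theorem proposition6p1:
  fixes \<beta> :: real
    and \<phi> :: "complex \<Rightarrow> ereal"
    and \<mu> :: "complex measure"
    and U :: "complex set"
    and g :: "nat \<Rightarrow> (complex \<Rightarrow> real) \<Rightarrow> ereal"
  assumes beta: "0 < \<beta>" "\<beta> \<le> 1"
    and lsc: "lower_semicontinuous \<phi>"
    and growth: "strictly_super_log_growth \<phi>"
    and nonpolar: "\<not> polar {z. \<phi> z < \<infinity>}"
    and equilibrium: "is_equilibrium_measure \<phi> \<mu>"
    and nbhd: "open U" "measure_support \<mu> \<subseteq> U"
    and finite_on_U: "\<forall>z\<in>U. \<phi> z < \<infinity>"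
    and C5: "C_k_on 5 (\<lambda>z. real_of_ereal (\<phi> z)) U"
    and C1_boundary: "closed_C1_domain (measure_support \<mu>)"
    and laplacian_pos: "\<forall>z\<in>measure_support \<mu>. laplacian (\<lambda>w. real_of_ereal (\<phi> w)) z > 0"
    and deviation: "\<And>N u. N \<ge> 1 \<Longrightarrow> admissible \<phi> u \<Longrightarrow>
      ereal (1 / (\<beta> * (real N)\<^sup>2)) *
        elog (\<integral>\<^sup>+z. ennreal (exp (- (\<beta> * (real N)\<^sup>2 * linear_statistic N u z)))
                \<partial>(coulomb_gas N \<beta> (\<lambda>w. ereal (real N) * \<phi> w)))
      \<le> - free_energy (\<lambda>z. \<phi> z + ereal (u z)) + free_energy \<phi> + g N u"
  shows "\<exists>u. admissible \<phi> u \<and> limsup (\<lambda>N. ereal (real N) * g N u) > 0"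
proof -
  define f where "f z = real_of_ereal (\<phi> z)" for z
  define S where "S = measure_support \<mu>"
  have C5': "C_k_on 5 f U" using C5 by (simp add: f_def[abs_def])
  have contU: "continuous_on U f" by (rule C_k_on_continuous[OF C5'])
  have mu: "\<mu> \<in> prob_measures" using equilibrium by (simp add: is_equilibrium_measure_def)
  obtain \<epsilon> C0 where eps: "0 < \<epsilon>" and C0: "\<And>z. ereal ((1 + \<epsilon>) * ln (1 + (cmod z)\<^sup>2) - C0) \<le> \<phi> z"
    using growth unfolding strictly_super_log_growth_def by blast
  \<comment> \<open>The second summand leaves room for the perturbed weight: replacing z by
    \<open>z / c\<close> with \<open>c \<le> 2\<close> lowers
    \<open>(1 + \<epsilon>) * ln (1 + |z|^2)\<close> by at most
    \<open>2 * (1 + \<epsilon>) * ln 2\<close>. The same C then serves both weights.\<close>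
  define C where "C = max C0 0 + 2 * (1 + \<epsilon>) * ln 2"
  have "0 \<le> 2 * (1 + \<epsilon>) * ln 2" using eps by (intro mult_nonneg_nonneg) auto
  then have C: "0 \<le> C" "C0 + 2 * (1 + \<epsilon>) * ln 2 \<le> C" "C0 \<le> C" unfolding C_def by linarith+
  have wg: "weight_growth \<phi> \<epsilon> C"
    unfolding weight_growth_def
  proof (intro conjI allI eps C(1))
    fix z
    have "ereal ((1 + \<epsilon>) * ln (1 + (cmod z)\<^sup>2) - C) \<le> ereal ((1 + \<epsilon>) * ln (1 + (cmod z)\<^sup>2) - C0)" using C by simp
    then show "ereal ((1 + \<epsilon>) * ln (1 + (cmod z)\<^sup>2) - C) \<le> \<phi> z" using C0 by (rule order_trans)
  qed
  have phiU: "\<phi> z = ereal (f z)" if "z \<in> U" for z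
    using finite_on_U that weight_growthD(4)[OF wg, of z] by (cases "\<phi> z") (auto simp: f_def)
  have meas: "\<phi> \<in> borel_measurable borel" by (rule lower_semicontinuous_measurable[OF lsc])
  note [measurable] = meas
  interpret W: weight \<phi> \<epsilon> C by unfold_locales (rule wg, rule meas)
  have S_ne: "S \<noteq> {}" unfolding S_def using mu by (intro measure_support_nonempty) (auto simp: prob_measures_def)
  then obtain x where x: "x \<in> S" by auto
  then have xU: "x \<in> U" using nbhd by (auto simp: S_def)
  \<comment> \<open>Near a point of the support \<phi> is continuous, hence bounded, so the uniform
    measure on a small disc has finite energy.\<close>
  have "\<exists>\<nu>\<in>prob_measures. W.Q \<nu> \<nu> < \<infinity>"
  proof -
    have "\<forall>\<^sub>F z in nhds x. z \<in> U \<and> f z < f x + 1"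
    proof (rule eventually_conj)
      show "\<forall>\<^sub>F z in nhds x. z \<in> U" using nbhd xU by (simp add: eventually_nhds_in_open)
      have "isCont f x" using contU nbhd xU by (simp add: continuous_on_eq_continuous_at)
      then have "(f \<longlongrightarrow> f x) (nhds x)" unfolding isCont_def tendsto_at_iff_tendsto_nhds .
      then show "\<forall>\<^sub>F z in nhds x. f z < f x + 1" by (rule order_tendstoD) simp
    qed
    then obtain r where r: "0 < r" "\<And>z. dist z x < r \<Longrightarrow> z \<in> U \<and> f z < f x + 1"
      unfolding eventually_nhds_metric by blast
    have em: "emeasure lborel (ball x r) = ennreal (unit_ball_vol (real DIM(complex)) * r ^ DIM(complex))"
      using r by (intro emeasure_ball) auto
    have "0 < unit_ball_vol (real DIM(complex)) * r ^ DIM(complex)" using r by (intro mult_pos_pos) auto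
    then have em0: "emeasure lborel (ball x r) \<noteq> 0" unfolding em by (metis ennreal_eq_0_iff not_le)
    have "\<phi> z \<le> ereal (f x + 1)" if "z \<in> ball x r" for z
      using r(2)[of z] that phiU[of z] by (auto simp: dist_commute)
    then show ?thesis
      using W.finite_energy_uniform[of "ball x r" "f x + 1"] em0 em by (auto simp: less_top[symmetric])
  qed
  then obtain \<nu> where \<nu>: "\<nu> \<in> prob_measures" "W.Q \<nu> \<nu> < \<infinity>" by blast
  have eq: "equilibrium \<phi> \<epsilon> C \<mu>" and fe: "free_energy \<phi> = ereal (enn2real (W.Q \<mu> \<mu>) / 2 - C)"
    using W.free_energy_eq_equilibrium[OF equilibrium \<nu>] by auto
  interpret E: equilibrium \<phi> \<epsilon> C \<mu> by (rule eq)
  interpret R: regular_equilibrium \<phi> \<epsilon> C \<mu> U "\<lambda>z. real_of_ereal (\<phi> z)" "measure_support \<mu>"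
    by unfold_locales (use nbhd finite_on_U contU in \<open>auto simp: f_def[abs_def]\<close>)
  have cS: "compact S" unfolding S_def by (rule R.compact_S)
  obtain e where e: "0 < e" "(\<Union>x\<in>S. cball x e) \<subseteq> U"
    using compact_subset_open_imp_cball_epsilon_subset[OF cS nbhd(1)] nbhd(2) by (auto simp: S_def)
  \<comment> \<open>Three nested neighbourhoods: particles are confined to distance \<rho>, the
    perturbation interpolates within \<open>2 * \<rho>\<close>, and points moved by the dilation
    stay within \<open>3 * \<rho>\<close>, where \<phi> is regular.\<close>
  define \<rho> where "\<rho> = e / 3"
  have rho: "0 < \<rho>" using e by (simp add: \<rho>_def)
  define K3 where "K3 = {z. infdist z S \<le> 3 * \<rho>}"
  have cK3: "compact K3" unfolding K3_def using rho by (intro compact_infdist_le S_ne cS) auto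
  have K3U: "K3 \<subseteq> U"
  proof
    fix z assume "z \<in> K3"
    obtain y where "y \<in> S" "infdist z S = dist z y"
      using infdist_attains_inf[OF compact_imp_closed[OF cS] S_ne, of z] by metis
    then have "z \<in> cball y e" "y \<in> S" using \<open>z \<in> K3\<close> by (auto simp: K3_def \<rho>_def dist_commute)
    then show "z \<in> U" using e(2) by blast
  qed
  obtain L where L: "0 \<le> L" "\<And>x r y. cball x r \<subseteq> K3 \<Longrightarrow> cmod (y - x) \<le> r \<Longrightarrow> \<bar>f y - f x\<bar> \<le> L * cmod (y - x)"
    using C_k_on_Lipschitz[of 4 f U K3] C5' cK3 K3U by (auto simp: numeral_eq_Suc)
  interpret G: lipschitz_equilibrium \<phi> \<epsilon> C \<mu> U "\<lambda>z. real_of_ereal (\<phi> z)" "measure_support \<mu>" \<rho> L \<beta>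
  proof unfold_locales
    show "{z. infdist z (measure_support \<mu>) \<le> \<rho>} \<subseteq> U"
      using K3U rho by (auto simp: K3_def S_def)
    fix x y assume x: "x \<in> measure_support \<mu>" and y: "cmod (y - x) \<le> \<rho>"
    have "cball x \<rho> \<subseteq> K3"
    proof
      fix z assume "z \<in> cball x \<rho>"
      then show "z \<in> K3" using infdist_le[of x S z] x rho by (simp add: K3_def S_def dist_commute)
    qed
    from L(2)[OF this y] show "\<bar>real_of_ereal (\<phi> y) - real_of_ereal (\<phi> x)\<bar> \<le> L * cmod (y - x)" by (simp add: f_def)
  qed (use rho L beta in auto)
  have GK: "G.K = {z. infdist z S \<le> \<rho>}" by (simp add: G.K_def S_def)
  obtain R1 where R1: "0 < R1" "\<And>z. z \<in> K3 \<Longrightarrow> cmod z \<le> R1"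
    using compact_imp_bounded[OF cK3] unfolding bounded_pos by blast
  \<comment> \<open>Multiplication and division by c move points of K3 by at most
    \<open>\<rho> / 2\<close>; the bound \<open>c \<le> 2\<close> is used for the growth
    constant.\<close>
  define c where "c = 1 + min 1 (\<rho> / (2 * R1))"
  have c: "1 < c" "c \<le> 2" "(c - 1) * R1 \<le> \<rho> / 2"
  proof -
    have "0 < \<rho> / (2 * R1)" using rho R1 by simp
    then show "1 < c" "c \<le> 2" by (auto simp: c_def)
    have "(c - 1) * R1 \<le> \<rho> / (2 * R1) * R1" using R1 by (intro mult_right_mono) (auto simp: c_def)
    then show "(c - 1) * R1 \<le> \<rho> / 2" using R1 by simp
  qed
  define K2 where "K2 = {z. infdist z S \<le> 2 * \<rho>}"
  have K23: "K2 \<subseteq> K3" using rho by (auto simp: K2_def K3_def)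
  have cK2: "compact K2" unfolding K2_def using rho by (intro compact_infdist_le S_ne cS) auto
  have shrink: "z / of_real c \<in> U" if z: "z \<in> K2" for z
  proof -
    have "z / of_real c - z = of_real (1 / c - 1) * z" by (simp add: algebra_simps)
    then have "cmod (z / of_real c - z) = \<bar>1 / c - 1\<bar> * cmod z" by (simp only: norm_mult norm_of_real)
    also have "\<bar>1 / c - 1\<bar> = 1 - 1 / c" using c by (simp add: abs_if)
    also have "(1 - 1 / c) * cmod z \<le> (c - 1) * R1"
    proof (rule mult_mono)
      have "1 - 1 / c = (c - 1) / c" using c by (simp add: field_simps)
      also have "\<dots> \<le> c - 1" using c by (simp add: divide_le_eq mult_left_le)
      finally show "1 - 1 / c \<le> c - 1" .
    qed (use R1 z K23 c in auto)
    finally have "dist (z / of_real c) z \<le> \<rho> / 2" using c by (simp add: dist_norm)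
    then have "infdist (z / of_real c) S \<le> 3 * \<rho>"
      using infdist_triangle[of "z / of_real c" S z] z rho by (simp add: K2_def)
    then show ?thesis using K3U by (auto simp: K3_def)
  qed
  have expand: "infdist (of_real c * z) S \<le> 3 / 2 * \<rho>" if z: "z \<in> G.K" for z
  proof -
    have "z \<in> K3" using z rho by (simp add: GK K3_def)
    have "of_real c * z - z = of_real (c - 1) * z" by (simp add: algebra_simps)
    then have "cmod (of_real c * z - z) = \<bar>c - 1\<bar> * cmod z" by (simp only: norm_mult norm_of_real)
    also have "\<bar>c - 1\<bar> = c - 1" using c by simp
    also have "(c - 1) * cmod z \<le> (c - 1) * R1" using R1 \<open>z \<in> K3\<close> c by (intro mult_left_mono) auto
    finally have "dist (of_real c * z) z \<le> \<rho> / 2" using c by (simp add: dist_norm)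
    then show ?thesis using infdist_triangle[of "of_real c * z" S z] z by (simp add: GK)
  qed
  \<comment> \<open>On K2 adding h to \<phi> gives the dilated weight. Farther out \<phi> may be
    infinite and h need not have any meaning.\<close>
  define h where "h z = f (z / of_real c) - f z" for z
  have ch: "continuous_on K2 h"
    unfolding h_def
    using c shrink K23 K3U
    by (intro continuous_intros continuous_on_compose2[OF contU] continuous_on_subset[OF contU]) auto
  have "bounded (h ` K2)" by (intro compact_imp_bounded compact_continuous_image ch cK2)
  then obtain B where B: "\<And>z. z \<in> K2 \<Longrightarrow> \<bar>h z\<bar> \<le> B" unfolding bounded_iff by auto
  define q where "q = enn2real (W.Q \<mu> \<mu>)"
  \<comment> \<open>\<open>q \<le> M\<close> makes mass outside K2 expensive,
    \<open>B \<le> M\<close> keeps the interpolation above the dilated weight, and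
    \<open>0 \<le> M\<close> preserves the growth of \<phi>.\<close>
  define M where "M = max q (max B 0)"
  have M: "q \<le> M" "B \<le> M" "0 \<le> M" by (auto simp: M_def)
  \<comment> \<open>Equal to 1 up to distance \<open>3 / 2 * \<rho>\<close>, which covers the
    dilated confinement region, and to 0 from distance \<open>2 * \<rho>\<close> on.\<close>
  define cutoff where "cutoff z = max 0 (min 1 (4 - 2 * infdist z S / \<rho>))" for z
  have chi: "0 \<le> cutoff z" "cutoff z \<le> 1" for z by (auto simp: cutoff_def)
  have chi1: "cutoff z = 1" if "infdist z S \<le> 3 / 2 * \<rho>" for z
    using that rho by (simp add: cutoff_def field_simps)
  have chi0: "cutoff z = 0" if "2 * \<rho> \<le> infdist z S" for z
    using that rho by (simp add: cutoff_def field_simps)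
  define u where "u z = cutoff z * (h z - M) + M" for z
  \<comment> \<open>Continuity of h is available only on K2, so two closed pieces are glued along
    \<open>infdist z S = 2 * \<rho>\<close>, where the cutoff vanishes.\<close>
  have cont_u: "continuous_on UNIV u"
  proof -
    have "continuous_on K2 u"
      unfolding u_def cutoff_def using rho by (intro continuous_intros ch) auto
    moreover have "continuous_on {z. 2 * \<rho> \<le> infdist z S} u"
      by (rule continuous_on_eq[of _ "\<lambda>_. M"]) (auto simp: u_def chi0)
    moreover have "closed K2" using cK2 by (rule compact_imp_closed)
    moreover have "closed {z. 2 * \<rho> \<le> infdist z S}" by (intro closed_Collect_le continuous_intros)
    ultimately have "continuous_on (K2 \<union> {z. 2 * \<rho> \<le> infdist z S}) u" by (intro continuous_on_closed_Un)
    moreover have "K2 \<union> {z. 2 * \<rho> \<le> infdist z S} = UNIV" by (auto simp: K2_def)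
    ultimately show ?thesis by simp
  qed
  have u_meas [measurable]: "u \<in> borel_measurable borel" using cont_u by (rule borel_measurable_continuous_onI)
  define \<psi> where "\<psi> z = \<phi> z + ereal (u z)" for z
  have inK2: "\<phi> (z / of_real c) \<le> \<psi> z" if z: "z \<in> K2" for z
  proof -
    have "cutoff z * (M - h z) \<le> 1 * (M - h z)"
      using chi[of z] B[OF z] M by (intro mult_right_mono) auto
    then have "f (z / of_real c) \<le> f z + u z" by (simp add: u_def h_def algebra_simps)
    then show ?thesis using phiU[OF shrink[OF z]] phiU[of z] z K23 K3U by (auto simp: \<psi>_def)
  qed
  have outK2: "\<psi> z = \<phi> z + ereal M" if "z \<notin> K2" for z
    using that chi0[of z] by (simp add: \<psi>_def u_def K2_def)
  have psi_growth: "weight_growth \<psi> \<epsilon> C"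
    unfolding weight_growth_def
  proof (intro conjI allI eps C(1))
    fix z
    show "ereal ((1 + \<epsilon>) * ln (1 + (cmod z)\<^sup>2) - C) \<le> \<psi> z"
    proof (cases "z \<in> K2")
      case True
      have "(1 + (cmod z)\<^sup>2) / 4 \<le> 1 + (cmod (z / of_real c))\<^sup>2"
      proof -
        have "c\<^sup>2 \<le> 2\<^sup>2" using c by (intro power_mono) auto
        then have "(cmod z)\<^sup>2 / 4 \<le> (cmod z)\<^sup>2 / c\<^sup>2" using c by (intro divide_left_mono) auto
        also have "\<dots> = (cmod (z / of_real c))\<^sup>2" using c by (simp add: norm_divide power_divide)
        finally show ?thesis by simp
      qed
      then have "ln ((1 + (cmod z)\<^sup>2) / 4) \<le> ln (1 + (cmod (z / of_real c))\<^sup>2)"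
        by (intro ln_mono) (auto intro: add_pos_nonneg)
      moreover have "ln ((1 + (cmod z)\<^sup>2) / 4) = ln (1 + (cmod z)\<^sup>2) - 2 * ln 2"
      proof -
        have "ln (4 :: real) = 2 * ln 2" using ln_realpow[of 2 2] by simp
        moreover have "0 < 1 + (cmod z)\<^sup>2" by (intro add_pos_nonneg) auto
        ultimately show ?thesis by (simp add: ln_div)
      qed
      ultimately have "(1 + \<epsilon>) * (ln (1 + (cmod z)\<^sup>2) - 2 * ln 2) \<le> (1 + \<epsilon>) * ln (1 + (cmod (z / of_real c))\<^sup>2)"
        using eps by (intro mult_left_mono) auto
      then have "(1 + \<epsilon>) * ln (1 + (cmod z)\<^sup>2) - C \<le> (1 + \<epsilon>) * ln (1 + (cmod (z / of_real c))\<^sup>2) - C0"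
        using C(2) by (simp add: algebra_simps)
      then have "ereal ((1 + \<epsilon>) * ln (1 + (cmod z)\<^sup>2) - C) \<le> ereal ((1 + \<epsilon>) * ln (1 + (cmod (z / of_real c))\<^sup>2) - C0)" by simp
      also have "\<dots> \<le> \<phi> (z / of_real c)" by (rule C0)
      also have "\<dots> \<le> \<psi> z" by (rule inK2[OF True])
      finally show ?thesis .
    next
      case False
      have "\<phi> z + 0 \<le> \<phi> z + ereal M" using M by (intro add_left_mono) simp
      then show ?thesis using weight_growthD(1)[OF wg, of z] unfolding outK2[OF False] by (metis add.right_neutral order_trans)
    qed
  qed
  have psi_meas: "\<psi> \<in> borel_measurable borel" unfolding \<psi>_def by measurable
  have adm: "admissible \<phi> u"
    unfolding admissible_def strictly_super_log_growth_def
    using cont_u psi_growth eps unfolding weight_growth_def \<psi>_def by blast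
  have Qq: "W.Q \<mu> \<mu> = ennreal q" using E.fin by (simp add: q_def less_top)
  have fpsi: "ereal (q / 2 - C - ln c) \<le> free_energy \<psi>"
    unfolding q_def
  proof (rule E.free_energy_dilation[OF psi_growth psi_meas])
    show "K2 \<in> sets borel" using compact_imp_closed[OF cK2] by simp
    fix z assume "z \<notin> K2"
    then have "\<psi> z = \<phi> z + ereal M" by (rule outK2)
    moreover have "ereal (ln (1 + (cmod z)\<^sup>2) - C) + ereal M \<le> \<phi> z + ereal M"
      by (intro add_right_mono weight_growthD(2)[OF wg])
    ultimately show "ereal (ln (1 + (cmod z)\<^sup>2) - C + M) \<le> \<psi> z" by simp
  next
    show "W.Q \<mu> \<mu> \<le> ennreal M" unfolding Qq using M by (intro ennreal_leI)
  qed (use c inK2 in auto)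
  have dil: "\<phi> (of_real c * z) + ereal (u (of_real c * z)) = \<phi> z" if z: "z \<in> G.K" for z
  proof -
    have 1: "cutoff (of_real c * z) = 1" by (rule chi1[OF expand[OF z]])
    have "of_real c * z \<in> K2" using expand[OF z] rho by (simp add: K2_def)
    then have 2: "of_real c * z \<in> U" using K23 K3U by blast
    have 3: "z \<in> U" using z K3U rho by (auto simp: GK K3_def)
    show ?thesis using 1 c by (simp add: phiU[OF 2] phiU[OF 3] u_def h_def)
  qed
  \<comment> \<open>Half of the surplus \<open>(2 - \<beta>) * ln c\<close> per particle. It pays
    for the confinement, and an equal surplus \<open>\<delta> * N\<close> remains in the
    exponent.\<close>
  define \<delta> where "\<delta> = (2 - \<beta>) * ln c / 2"
  have lnc: "0 < ln c" using c by simp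
  have \<delta>: "0 < \<delta>" unfolding \<delta>_def using beta lnc by simp
  have key: "ereal (\<delta> / \<beta>) \<le> ereal (real N) * g N u"
    if N: "1 \<le> N" and Z: "partition_function N \<beta> (\<lambda>w. ereal (real N) * \<phi> w) \<le> ennreal (exp (\<delta> * real N)) * G.rgas N G.K" for N
  proof -
    have N0: "0 < real N" using N by simp
    define I where "I = (\<integral>\<^sup>+z. ennreal (exp (- (\<beta> * (real N)\<^sup>2 * linear_statistic N u z)))
                \<partial>(coulomb_gas N \<beta> (\<lambda>w. ereal (real N) * \<phi> w)))"
    define x where "x = 2 * real N * ln c + \<beta> * (real N * (real N - 1)) * ln c - \<delta> * real N"
    have "ennreal (exp x) \<le> I"
      unfolding I_def x_def by (rule G.gas_expectation_lower_bound[OF _ _ u_meas dil Z]) (use c N in auto)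
    then have "ereal x \<le> elog I" by (rule elog_ge)
    then have "ereal (1 / (\<beta> * (real N)\<^sup>2)) * ereal x \<le> ereal (1 / (\<beta> * (real N)\<^sup>2)) * elog I"
      using beta by (intro ereal_mult_left_mono) auto
    also have "\<dots> \<le> - free_energy \<psi> + free_energy \<phi> + g N u"
      unfolding I_def \<psi>_def by (rule deviation[OF N adm])
    also have "\<dots> \<le> ereal (- (q / 2 - C - ln c)) + ereal (q / 2 - C) + g N u"
    proof (intro add_mono order_refl)
      show "- free_energy \<psi> \<le> ereal (- (q / 2 - C - ln c))"
        using fpsi by (metis ereal_minus_le_minus uminus_ereal.simps(1))
      show "free_energy \<phi> \<le> ereal (q / 2 - C)" using fe by (simp add: q_def)
    qed
    also have "\<dots> = ereal (ln c) + g N u" by simp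
    \<comment> \<open>After division by \<open>\<beta> * N^2\<close> the leading part is
      \<open>ln c\<close>, exactly the bound on the difference of the free energies. It cancels, and
      \<open>\<delta> / (\<beta> * N)\<close> has to be covered by \<open>g N u\<close>.\<close>
    also have "ereal (1 / (\<beta> * (real N)\<^sup>2)) * ereal x = ereal (ln c) + ereal (\<delta> / (\<beta> * real N))"
    proof -
      have "2 * ln c = 2 * \<delta> + \<beta> * ln c" by (simp add: \<delta>_def field_simps)
      then have "x = \<beta> * (real N)\<^sup>2 * ln c + \<delta> * real N"
        unfolding x_def power2_eq_square by (simp add: algebra_simps)
      then show ?thesis using beta N0 by (simp add: field_simps power2_eq_square)
    qed
    finally have "ereal (\<delta> / (\<beta> * real N)) \<le> g N u" by (cases "g N u") auto
    then have "ereal (real N) * ereal (\<delta> / (\<beta> * real N)) \<le> ereal (real N) * g N u"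
      using N0 by (intro ereal_mult_left_mono) auto
    then show ?thesis using N0 beta by simp
  qed
  have "\<forall>\<^sub>F N in sequentially. ereal (\<delta> / \<beta>) \<le> ereal (real N) * g N u"
    using G.partition_function_le[OF \<delta>] eventually_ge_at_top[of 1]
    by eventually_elim (rule key)
  then have "ereal (\<delta> / \<beta>) \<le> limsup (\<lambda>N. ereal (real N) * g N u)"
    by (intro le_Limsup) auto
  moreover have "0 < ereal (\<delta> / \<beta>)" using \<delta> beta by simp
  ultimately have "0 < limsup (\<lambda>N. ereal (real N) * g N u)" by (rule less_le_trans[rotated])
  then show ?thesis using adm by blast
qed

end
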